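(* Let $F_\varepsilon$ be an analytic (or $C^\infty$, or formal) family of area-preserving maps defined in a neighbourhood of the origin of $\mathbb{R}^2$ such that $F_0(0)=0$, and $DF_0(0)$ has the double eigenvalue $\mu_0=-1$ and is not diagonalisable. Then there exists a canonical formal change of variables $\phi_\varepsilon$ such that $$F_\varepsilon=\phi_\varepsilon^{-1}\circ\bigl(-\Phi^1_{h_\varepsilon}\bigr)\circ\phi_\varepsilon,$$ where $$h_\varepsilon(x,y)=\frac{y^2}{2}+U_\varepsilon(x)\quad\text{with}\quad U_\varepsilon(x)=\sum_{k+2m\ge2}u_{km}x^{2k}\varepsilon^m .$$ Moreover, the coefficients of the series are defined uniquely by the family $F_\varepsilon$: if two canonical formal changes of variables bring $F_\varepsilon$ to this form with coefficients $u_{km}$ and $\tilde u_{km}$ respectively, then $u_{km}=\tilde u_{km}$ for all $(k,m)$ with $k\ge1$ (the terms $u_{0m}\varepsilon^m$ do not influence the time-one map).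
   Context: A family $F_\varepsilon$ is analytic (resp. $C^\infty$, formal) jointly in $(x,y,\varepsilon)$ and is identified with its Taylor series at $(x,y,\varepsilon)=(0,0,0)$; all conjugacy identities are identities of formal power series with real coefficients. Area-preserving means that the Jacobian determinant with respect to $(x,y)$ is $\pm1$. A canonical formal change of variables is a pair $\phi_\varepsilon$ of formal power series in $(x,y,\varepsilon)$ with $\phi_0(0,0)=(0,0)$ whose Jacobian determinant with respect to $(x,y)$ is identically $1$ or identically $-1$ (a reflection of orientation is allowed). Compositions are in $(x,y)$, with $\varepsilon$ as a parameter. All summation indices are non-negative integers. For formal series, $\{f,g\}=\partial_xf\,\partial_yg-\partial_yf\,\partial_xg$ and $L_\chi g=\{g,\chi\}$. The formal time-one map of $\chi$ is $\Phi^1_\chi(x,y)=(\exp(L_\chi)x,\exp(L_\chi)y)$, $\exp(L_\chi)g=\sum_{k\ge0}\frac1{k!}L_\chi^kg$. Here it is well defined coefficientwise because, assigning orders $2,3,6$ to $x,y,\varepsilon$, the series $h_\varepsilon$ contains (besides constants) only monomials of order at least $6$. $-\Phi^1_h$ is the map $(x,y)\mapsto-\Phi^1_h(x,y)$. *)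

theory Defs
  imports "HOL-Analysis.Analysis" "HOL-Computational_Algebra.Formal_Power_Series"
    "Jordan_Normal_Form.Char_Poly"
begin

text \<open>
  Series in \<open>x, y, \<epsilon>\<close> are nested univariate series: the outermost variable is
  \<open>\<epsilon>\<close>, then \<open>y\<close>, and the innermost one is \<open>x\<close>.
\<close>

type_synonym ser = "real fps fps fps"

definition cf :: "ser \<Rightarrow> nat \<Rightarrow> nat \<Rightarrow> nat \<Rightarrow> real" where
  "cf g i j m = fps_nth (fps_nth (fps_nth g m) j) i"

definition mk_ser :: "(nat \<Rightarrow> nat \<Rightarrow> nat \<Rightarrow> real) \<Rightarrow> ser" where
  "mk_ser c = Abs_fps (\<lambda>m. Abs_fps (\<lambda>j. Abs_fps (\<lambda>i. c i j m)))"

definition const_ser :: "real \<Rightarrow> ser" where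
  "const_ser a = fps_const (fps_const (fps_const a))"

definition x_ser :: ser where "x_ser = fps_const (fps_const fps_X)"
definition y_ser :: ser where "y_ser = fps_const fps_X"
definition eps_ser :: ser where "eps_ser = fps_X"

definition ser_dx :: "ser \<Rightarrow> ser" where
  "ser_dx g = Abs_fps (\<lambda>m. Abs_fps (\<lambda>j. fps_deriv (fps_nth (fps_nth g m) j)))"

definition ser_dy :: "ser \<Rightarrow> ser" where
  "ser_dy g = Abs_fps (\<lambda>m. fps_deriv (fps_nth g m))"

type_synonym fmap = "ser \<times> ser"

text \<open>The \<open>\<epsilon>\<close>-family of formal maps sends the origin to the origin at \<open>\<epsilon> = 0\<close>.\<close>

definition fixes_origin :: "fmap \<Rightarrow> bool" where
  "fixes_origin G \<longleftrightarrow> cf (fst G) 0 0 0 = 0 \<and> cf (snd G) 0 0 0 = 0"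

text \<open>
  Substitution \<open>g(G\<^sub>1, G\<^sub>2, \<epsilon>)\<close>.  It is meaningful only if \<open>fixes_origin G\<close>;
  then \<open>G\<^sub>1\<^sup>p G\<^sub>2\<^sup>q \<epsilon>\<^sup>r\<close> has no terms of total degree below \<open>p + q + r\<close>, so
  the finite sum below is the full coefficient.
\<close>

definition ser_subst :: "ser \<Rightarrow> fmap \<Rightarrow> ser" where
  "ser_subst g G = mk_ser (\<lambda>i j m.
     \<Sum>(p, q, r) \<in> {(p, q, r). p + q + r \<le> i + j + m}.
       cf g p q r * cf (fst G ^ p * snd G ^ q * eps_ser ^ r) i j m)"

definition fmap_comp :: "fmap \<Rightarrow> fmap \<Rightarrow> fmap" where
  "fmap_comp F G = (ser_subst (fst F) G, ser_subst (snd F) G)"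

definition fmap_id :: fmap where
  "fmap_id = (x_ser, y_ser)"

definition fmap_uminus :: "fmap \<Rightarrow> fmap" where
  "fmap_uminus G = (- fst G, - snd G)"

definition fmap_inverse :: "fmap \<Rightarrow> fmap \<Rightarrow> bool" where
  "fmap_inverse \<phi> \<psi> \<longleftrightarrow> fixes_origin \<phi> \<and> fixes_origin \<psi> \<and>
     fmap_comp \<phi> \<psi> = fmap_id \<and> fmap_comp \<psi> \<phi> = fmap_id"

definition jac_det :: "fmap \<Rightarrow> ser" where
  "jac_det G = ser_dx (fst G) * ser_dy (snd G) - ser_dy (fst G) * ser_dx (snd G)"

definition area_preserving :: "fmap \<Rightarrow> bool" where
  "area_preserving G \<longleftrightarrow> jac_det G = 1 \<or> jac_det G = -1"

definition canonical_change :: "fmap \<Rightarrow> bool" where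
  "canonical_change \<phi> \<longleftrightarrow> fixes_origin \<phi> \<and> area_preserving \<phi>"

text \<open>\<open>F = \<phi>\<^sup>-\<^sup>1 \<circ> G \<circ> \<phi>\<close>\<close>

definition conjugates :: "fmap \<Rightarrow> fmap \<Rightarrow> fmap \<Rightarrow> bool" where
  "conjugates \<phi> F G \<longleftrightarrow>
     (\<exists>\<psi>. fmap_inverse \<phi> \<psi> \<and> F = fmap_comp \<psi> (fmap_comp G \<phi>))"

text \<open>\<open>DF\<^sub>0(0)\<close>\<close>

definition lin_part :: "fmap \<Rightarrow> real mat" where
  "lin_part F = mat_of_rows_list 2
     [[cf (fst F) 1 0 0, cf (fst F) 0 1 0],
      [cf (snd F) 1 0 0, cf (snd F) 0 1 0]]"

definition diagonalisable :: "real mat \<Rightarrow> bool" where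
  "diagonalisable A \<longleftrightarrow> (\<exists>D. diagonal_mat D \<and> similar_mat A D)"

definition poisson :: "ser \<Rightarrow> ser \<Rightarrow> ser" where
  "poisson f g = ser_dx f * ser_dy g - ser_dy f * ser_dx g"

definition lie :: "ser \<Rightarrow> ser \<Rightarrow> ser" where
  "lie H g = poisson g H"

text \<open>
  The sum is taken coefficientwise.  For the Hamiltonians \<open>ham u\<close> below each
  coefficient receives only finitely many nonzero contributions.
\<close>

definition exp_lie :: "ser \<Rightarrow> ser \<Rightarrow> ser" where
  "exp_lie H g = mk_ser (\<lambda>i j m. \<Sum>k. cf ((lie H ^^ k) g) i j m / fact k)"

definition time_one :: "ser \<Rightarrow> fmap" where
  "time_one H = (exp_lie H x_ser, exp_lie H y_ser)"

text \<open>
  \<open>U = \<Sum> u k m x\<^bsup>2k\<^esup> \<epsilon>\<^sup>m\<close> over \<open>k + 2m \<ge> 2\<close>; the values \<open>u 0 0\<close> and \<open>u 1 0\<close> are ignored.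
\<close>

definition U_ser :: "(nat \<Rightarrow> nat \<Rightarrow> real) \<Rightarrow> ser" where
  "U_ser u = mk_ser (\<lambda>i j m.
     if j = 0 \<and> even i \<and> i div 2 + 2 * m \<ge> 2 then u (i div 2) m else 0)"

definition ham :: "(nat \<Rightarrow> nat \<Rightarrow> real) \<Rightarrow> ser" where
  "ham u = const_ser (1 / 2) * y_ser ^ 2 + U_ser u"

text \<open>Points of \<open>\<real>\<^sup>3\<close> are triples \<open>(x, y, \<epsilon>)\<close>.\<close>

type_synonym pt = "real \<times> real \<times> real"

definition pdx :: "(pt \<Rightarrow> real) \<Rightarrow> pt \<Rightarrow> real" where
  "pdx f = (\<lambda>(x, y, e). deriv (\<lambda>t. f (t, y, e)) x)"

definition pdy :: "(pt \<Rightarrow> real) \<Rightarrow> pt \<Rightarrow> real" where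
  "pdy f = (\<lambda>(x, y, e). deriv (\<lambda>t. f (x, t, e)) y)"

definition pde :: "(pt \<Rightarrow> real) \<Rightarrow> pt \<Rightarrow> real" where
  "pde f = (\<lambda>(x, y, e). deriv (\<lambda>t. f (x, y, t)) e)"

definition has_partials_on :: "pt set \<Rightarrow> (pt \<Rightarrow> real) \<Rightarrow> bool" where
  "has_partials_on S f \<longleftrightarrow> (\<forall>(x, y, e) \<in> S.
     (\<lambda>t. f (t, y, e)) field_differentiable (at x) \<and>
     (\<lambda>t. f (x, t, e)) field_differentiable (at y) \<and>
     (\<lambda>t. f (x, y, t)) field_differentiable (at e))"

primrec Ck_on :: "nat \<Rightarrow> pt set \<Rightarrow> (pt \<Rightarrow> real) \<Rightarrow> bool" where
  "Ck_on 0 S f \<longleftrightarrow> continuous_on S f"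
| "Ck_on (Suc k) S f \<longleftrightarrow> continuous_on S f \<and> has_partials_on S f \<and>
     Ck_on k S (pdx f) \<and> Ck_on k S (pdy f) \<and> Ck_on k S (pde f)"

definition smooth_on :: "pt set \<Rightarrow> (pt \<Rightarrow> real) \<Rightarrow> bool" where
  "smooth_on S f \<longleftrightarrow> (\<forall>k. Ck_on k S f)"

definition taylor_cf :: "(pt \<Rightarrow> real) \<Rightarrow> pt \<Rightarrow> nat \<Rightarrow> nat \<Rightarrow> nat \<Rightarrow> real" where
  "taylor_cf f p i j m =
     (pdx ^^ i) ((pdy ^^ j) ((pde ^^ m) f)) p / (fact i * fact j * fact m)"

definition analytic_fun_on :: "pt set \<Rightarrow> (pt \<Rightarrow> real) \<Rightarrow> bool" where
  "analytic_fun_on S f \<longleftrightarrow> smooth_on S f \<and>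
     (\<forall>p \<in> S. \<exists>r>0. \<forall>(x, y, e) \<in> ball 0 r.
        ((\<lambda>(i, j, m). taylor_cf f p i j m * x ^ i * y ^ j * e ^ m)
           has_sum f (p + (x, y, e))) UNIV)"

definition area_preserving_on :: "pt set \<Rightarrow> (pt \<Rightarrow> real \<times> real) \<Rightarrow> bool" where
  "area_preserving_on S f \<longleftrightarrow> (\<forall>p \<in> S.
     \<bar>pdx (fst \<circ> f) p * pdy (snd \<circ> f) p - pdy (fst \<circ> f) p * pdx (snd \<circ> f) p\<bar> = 1)"

definition smooth_family :: "(pt \<Rightarrow> real \<times> real) \<Rightarrow> bool" where
  "smooth_family f \<longleftrightarrow> (\<exists>S. open S \<and> 0 \<in> S \<and>
     smooth_on S (fst \<circ> f) \<and> smooth_on S (snd \<circ> f) \<and> area_preserving_on S f)"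

definition analytic_family :: "(pt \<Rightarrow> real \<times> real) \<Rightarrow> bool" where
  "analytic_family f \<longleftrightarrow> (\<exists>S. open S \<and> 0 \<in> S \<and>
     analytic_fun_on S (fst \<circ> f) \<and> analytic_fun_on S (snd \<circ> f) \<and> area_preserving_on S f)"

definition taylor_map :: "(pt \<Rightarrow> real \<times> real) \<Rightarrow> fmap" where
  "taylor_map f = (mk_ser (taylor_cf (fst \<circ> f) 0), mk_ser (taylor_cf (snd \<circ> f) 0))"

end

theory Submission
  imports Defs
begin

text \<open>
  Give \<open>x, y, \<epsilon>\<close> the weights \<open>2, 3, 6\<close>, so that \<open>{g, \<chi>}\<close> raises weights by \<open>p - 5\<close> if \<open>\<chi>\<close> has
  weight \<open>p\<close>.  After a linear change, \<open>-F\<close> is \<open>(x + y, y)\<close> plus terms of higher weight.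

  Existence: suppose that \<open>F\<close> agrees with \<open>-\<Phi>\<^sup>1\<^sub>h\<close> up to some weight.  By area preservation the
  leading discrepancy is Hamiltonian, say \<open>e\<close>.  Conjugating with \<open>\<Phi>\<^sup>1\<^sub>\<chi>\<close>, the factor \<open>-1\<close> allows one
  to remove the odd part of \<open>e\<close>, and an even \<open>\<chi>\<close> of one weight less contributes \<open>y \<partial>\<^sub>x \<chi>\<close>, which removes
  all even terms divisible by \<open>y\<close>.  The even powers of \<open>x\<close> are absorbed in \<open>h\<close>.

  Uniqueness: let \<open>T\<close> conjugate two normal forms \<open>h, k\<close>, with leading Hamiltonian \<open>e\<close>.  Separating parities
  shows that \<open>e\<close> is even.  At the next weight \<open>k - h + y \<partial>\<^sub>x e = 0\<close>, where the first difference contains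
  no \<open>y\<close>; hence both vanish and \<open>e\<close> depends on \<open>y\<^sup>2, \<epsilon>\<close> only.  Replacing \<open>y\<^sup>2\<close> by \<open>2 k\<close> yields a
  Hamiltonian whose flow preserves \<open>k\<close> and can be split off from \<open>T\<close>.
\<close>

text \<open>Everything is done with the operators \<open>g \<mapsto> g \<circ> G\<close> on series
  instead of the maps: they are linear and multiplicative, so they can be compared weight by weight.
  The weights are such that the shear \<open>x \<mapsto> x + y\<close> differs from the identity by
  an operator that raises weights. All ingredients except the central symmetry then become
  unipotent, and every infinite process stops in each coefficient. A translation by a multiple of
  \<epsilon> raises weights too, so it is enough that the origin is fixed at \<epsilon> = 0. The
  central symmetry is not unipotent. It is moved past the conjugating operator \<open>T\<close>:
  conjugacy of \<open>- M\<close> with \<open>- exp_lie h\<close> reads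
  \<open>M (flip T g) = T (exp_lie h g)\<close>. For a generator \<open>e\<close> of
  \<open>T\<close> the two sides differ to first order by \<open>e - neg e\<close>, so an even
  generator drops out at its own weight and acts only one weight later, through its bracket with
  \<open>y\<^sup>2 / 2\<close>. This delay is why existence needs a separate first step and why
  uniqueness has to look at two consecutive weights.\<close>

lemma cf_mk_ser [simp]: "cf (mk_ser c) i j m = c i j m"
  by (simp add: cf_def mk_ser_def)

lemma ser_eqI: "(\<And>i j m. cf f i j m = cf g i j m) \<Longrightarrow> f = g"
  by (simp add: cf_def fps_eq_iff)

lemma cf_add [simp]: "cf (f + g) i j m = cf f i j m + cf g i j m"
  and cf_diff [simp]: "cf (f - g) i j m = cf f i j m - cf g i j m"
  and cf_uminus [simp]: "cf (- f) i j m = - cf f i j m"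
  and cf_0 [simp]: "cf 0 i j m = 0"
  by (simp_all add: cf_def)

lemma cf_1: "cf 1 i j m = (if i = 0 \<and> j = 0 \<and> m = 0 then 1 else 0)"
  by (simp add: cf_def)

lemma cf_sum [simp]: "cf (sum f A) i j m = (\<Sum>a\<in>A. cf (f a) i j m)"
  by (induction A rule: infinite_finite_induct) auto

lemma cf_mult: "cf (f * g) i j m = (\<Sum>c\<le>m. \<Sum>b\<le>j. \<Sum>a\<le>i. cf f a b c * cf g (i - a) (j - b) (m - c))"
  by (simp add: cf_def fps_mult_nth fps_sum_nth atMost_atLeast0)

lemma cf_const_mult [simp]: "cf (const_ser a * g) i j m = a * cf g i j m"
  by (simp add: cf_def const_ser_def)

lemma const_ser_add: "const_ser (a + b) = const_ser a + const_ser b"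
  and const_ser_mult: "const_ser (a * b) = const_ser a * const_ser b"
  and const_ser_uminus: "const_ser (- a) = - const_ser a"
  and const_ser_0 [simp]: "const_ser 0 = 0"
  and const_ser_1 [simp]: "const_ser 1 = 1"
  by (simp_all add: const_ser_def fps_const_mult[symmetric] del: fps_const_mult)

lemma const_ser_of_nat: "const_ser (of_nat n) = of_nat n"
  by (induction n) (simp_all add: const_ser_add)

lemma cf_dx [simp]: "cf (ser_dx g) i j m = real (i + 1) * cf g (i + 1) j m"
  by (simp add: cf_def ser_dx_def)

lemma cf_dy [simp]: "cf (ser_dy g) i j m = real (j + 1) * cf g i (j + 1) m"
  by (simp add: cf_def ser_dy_def fps_of_nat[symmetric] del: of_nat_Suc)

definition mon :: "nat \<Rightarrow> nat \<Rightarrow> nat \<Rightarrow> ser" where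
  "mon i j m = x_ser ^ i * y_ser ^ j * eps_ser ^ m"

lemma cf_mon: "cf (mon p q r) i j m = (if i = p \<and> j = q \<and> m = r then 1 else 0)"
proof -
  have "mon p q r = fps_const (fps_const (fps_X ^ p) * fps_X ^ q) * fps_X ^ r"
    by (simp add: mon_def x_ser_def y_ser_def eps_ser_def)
  then show ?thesis
    by (simp add: cf_def fps_X_power_mult_right_nth fps_X_power_iff)
qed

lemma x_ser_mon: "x_ser = mon 1 0 0" and y_ser_mon: "y_ser = mon 0 1 0"
  and eps_ser_mon: "eps_ser = mon 0 0 1"
  by (simp_all add: mon_def)

lemma mon_mult: "mon i j m * mon i' j' m' = mon (i + i') (j + j') (m + m')"
  by (simp add: mon_def power_add algebra_simps)

section \<open>Derivations of the series ring and the Poisson bracket\<close>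

lemma ser_dx_add: "ser_dx (f + g) = ser_dx f + ser_dx g"
  and ser_dx_diff: "ser_dx (f - g) = ser_dx f - ser_dx g"
  and ser_dx_uminus: "ser_dx (- f) = - ser_dx f"
  and ser_dx_const_mult: "ser_dx (const_ser a * f) = const_ser a * ser_dx f"
  and ser_dy_add: "ser_dy (f + g) = ser_dy f + ser_dy g"
  and ser_dy_diff: "ser_dy (f - g) = ser_dy f - ser_dy g"
  and ser_dy_uminus: "ser_dy (- f) = - ser_dy f"
  and ser_dy_const_mult: "ser_dy (const_ser a * f) = const_ser a * ser_dy f"
  and ser_dx_dy: "ser_dx (ser_dy f) = ser_dy (ser_dx f)"
  by (rule ser_eqI; simp add: distrib_left right_diff_distrib; simp add: algebra_simps)+

text \<open>Since \<open>x\<close> is the innermost variable, \<open>ser_dx\<close> is the ordinary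
  derivative lifted through two layers of coefficients, and \<open>ser_dy\<close> is lifted through
  one. This is the product rule for a single layer.\<close>

lemma deriv_coeffwise_mult:
  fixes d :: "'a::comm_ring_1 \<Rightarrow> 'a"
  assumes add: "\<And>a b. d (a + b) = d a + d b" and mult: "\<And>a b. d (a * b) = d a * b + a * d b"
  shows "Abs_fps (\<lambda>n. d (fps_nth (f * g) n)) =
    Abs_fps (\<lambda>n. d (fps_nth f n)) * g + f * Abs_fps (\<lambda>n. d (fps_nth g n))"
proof -
  have d0: "d 0 = 0" using add[of 0 0] by simp
  have "d (sum h A) = (\<Sum>a\<in>A. d (h a))" for h :: "nat \<Rightarrow> 'a" and A
    by (induction A rule: infinite_finite_induct) (auto simp: add d0)
  then show ?thesis
    by (simp add: fps_eq_iff fps_mult_nth mult sum.distrib)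
qed

lemma ser_dx_mult: "ser_dx (f * g) = ser_dx f * g + f * ser_dx g"
proof -
  let ?d = "\<lambda>u::real fps fps. Abs_fps (\<lambda>j. fps_deriv (fps_nth u j))"
  have *: "?d (u + v) = ?d u + ?d v" "?d (u * v) = ?d u * v + u * ?d v" for u v
    by (simp add: fps_eq_iff, rule deriv_coeffwise_mult) (simp_all add: algebra_simps)
  show ?thesis
    unfolding ser_dx_def by (rule deriv_coeffwise_mult[where d = ?d]) (simp_all only: *)
qed

lemma ser_dy_mult: "ser_dy (f * g) = ser_dy f * g + f * ser_dy g"
  unfolding ser_dy_def by (rule deriv_coeffwise_mult) (simp_all add: algebra_simps)

lemma ser_dx_simps [simp]: "ser_dx x_ser = 1" "ser_dx y_ser = 0" "ser_dx eps_ser = 0"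
  "ser_dx (const_ser a) = 0" "ser_dx 1 = 0" "ser_dx 0 = 0"
  and ser_dy_simps [simp]: "ser_dy x_ser = 0" "ser_dy y_ser = 1" "ser_dy eps_ser = 0"
  "ser_dy (const_ser a) = 0" "ser_dy 1 = 0" "ser_dy 0 = 0"
  by (rule ser_eqI; simp add: x_ser_mon y_ser_mon eps_ser_mon cf_mon cf_1;
      simp add: const_ser_def cf_def)+

lemma poisson_add_left: "poisson (f + g) h = poisson f h + poisson g h"
  and poisson_add_right: "poisson h (f + g) = poisson h f + poisson h g"
  and poisson_diff_left: "poisson (f - g) h = poisson f h - poisson g h"
  and poisson_diff_right: "poisson h (f - g) = poisson h f - poisson h g"
  and poisson_uminus_left: "poisson (- f) h = - poisson f h"
  and poisson_uminus_right: "poisson h (- f) = - poisson h f"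
  and poisson_mult_left: "poisson (f * g) h = poisson f h * g + f * poisson g h"
  and poisson_mult_right: "poisson h (f * g) = poisson h f * g + f * poisson h g"
  and poisson_self [simp]: "poisson f f = 0"
  and poisson_const [simp]: "poisson (const_ser a) f = 0" "poisson f (const_ser a) = 0"
  and poisson_eps [simp]: "poisson eps_ser f = 0" "poisson f eps_ser = 0"
  and poisson_one [simp]: "poisson 1 f = 0" "poisson f 1 = 0"
  and poisson_x_y: "poisson x_ser y_ser = 1" "poisson x_ser f = ser_dy f" "poisson y_ser f = - ser_dx f"
  and poisson_jacobi: "poisson (poisson f g) h = poisson (poisson f h) g + poisson f (poisson g h)"
  by (simp_all add: poisson_def ser_dx_add ser_dy_add ser_dx_diff ser_dy_diff ser_dx_mult ser_dy_mult
      ser_dx_uminus ser_dy_uminus ser_dx_dy algebra_simps)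

lemma poisson_const_mult: "poisson (const_ser a * f) g = const_ser a * poisson f g"
  "poisson f (const_ser a * g) = const_ser a * poisson f g"
  by (simp_all add: poisson_mult_left poisson_mult_right)

section \<open>Weighted filtrations\<close>

text \<open>Two choices of weights occur: 1, 1, 1 gives the topology in which substitutions are
  continuous, and 2, 3, 6 orders the terms for the dynamics.\<close>

definition filt :: "nat \<Rightarrow> nat \<Rightarrow> nat \<Rightarrow> nat \<Rightarrow> ser set" where
  "filt a b c n = {g. \<forall>i j m. a * i + b * j + c * m < n \<longrightarrow> cf g i j m = 0}"

lemma filtI: "(\<And>i j m. a * i + b * j + c * m < n \<Longrightarrow> cf g i j m = 0) \<Longrightarrow> g \<in> filt a b c n"
  by (simp add: filt_def)

lemma filtD: "g \<in> filt a b c n \<Longrightarrow> a * i + b * j + c * m < n \<Longrightarrow> cf g i j m = 0"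
  by (simp add: filt_def)

lemma filt_mono: "g \<in> filt a b c n \<Longrightarrow> k \<le> n \<Longrightarrow> g \<in> filt a b c k"
  by (simp add: filt_def)

lemma filt_zero [simp]: "filt a b c 0 = UNIV" and zero_in_filt [simp]: "0 \<in> filt a b c n"
  by (simp_all add: filt_def)

lemma filt_add: "f \<in> filt a b c n \<Longrightarrow> g \<in> filt a b c n \<Longrightarrow> f + g \<in> filt a b c n"
  and filt_diff: "f \<in> filt a b c n \<Longrightarrow> g \<in> filt a b c n \<Longrightarrow> f - g \<in> filt a b c n"
  and filt_uminus: "f \<in> filt a b c n \<Longrightarrow> - f \<in> filt a b c n"
  and filt_const_mult: "f \<in> filt a b c n \<Longrightarrow> const_ser s * f \<in> filt a b c n"
  by (simp_all add: filt_def)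

lemma filt_sum: "(\<And>x. x \<in> A \<Longrightarrow> f x \<in> filt a b c n) \<Longrightarrow> sum f A \<in> filt a b c n"
  by (simp add: filt_def)

lemma filt_mult:
  assumes "f \<in> filt a b c n" "g \<in> filt a b c k"
  shows "f * g \<in> filt a b c (n + k)"
proof (rule filtI)
  fix i j m assume w: "a * i + b * j + c * m < n + k"
  have "cf f p q r * cf g (i - p) (j - q) (m - r) = 0" if "p \<le> i" "q \<le> j" "r \<le> m" for p q r
  proof (cases "a * p + b * q + c * r < n")
    case True then show ?thesis using assms by (simp add: filtD)
  next
    case False
    have "a * i = a * p + a * (i - p)" "b * j = b * q + b * (j - q)" "c * m = c * r + c * (m - r)"
      using that by (simp_all add: distrib_left[symmetric])
    then have "a * (i - p) + b * (j - q) + c * (m - r) < k" using False w by linarith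
    then show ?thesis using assms by (simp add: filtD)
  qed
  then show "cf (f * g) i j m = 0" unfolding cf_mult by (intro sum.neutral ballI) simp
qed

lemma filt_mult_le: "f \<in> filt a b c n \<Longrightarrow> g \<in> filt a b c k \<Longrightarrow> l \<le> n + k \<Longrightarrow> f * g \<in> filt a b c l"
  using filt_mult filt_mono by blast

lemma filt_power: "f \<in> filt a b c n \<Longrightarrow> f ^ k \<in> filt a b c (k * n)"
  by (induction k) (auto intro: filt_mult_le)

lemma filt_0I: "(\<And>n. g \<in> filt a b c n) \<Longrightarrow> g = 0"
  by (rule ser_eqI) (metis cf_0 filtD lessI)

lemma filt_eqI: "(\<And>n. f - g \<in> filt a b c n) \<Longrightarrow> f = g"
  using filt_0I[of "f - g" a b c] by simp

section \<open>Substitution\<close>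

definition simplex3 :: "nat \<Rightarrow> (nat \<times> nat \<times> nat) set" where
  "simplex3 n = {(p, q, r). p + q + r \<le> n}"

lemma simplex3_iff [simp]: "(p, q, r) \<in> simplex3 n \<longleftrightarrow> p + q + r \<le> n"
  by (simp add: simplex3_def)

lemma finite_simplex3 [simp]: "finite (simplex3 n)"
proof -
  have "simplex3 n \<subseteq> {..n} \<times> {..n} \<times> {..n}" by (auto simp: simplex3_def)
  then show ?thesis by (rule finite_subset) simp
qed

definition ser_trunc :: "nat \<Rightarrow> ser \<Rightarrow> ser" where
  "ser_trunc n g = (\<Sum>(p, q, r)\<in>simplex3 n. const_ser (cf g p q r) * mon p q r)"

lemma cf_trunc: "cf (ser_trunc n g) i j m = (if i + j + m \<le> n then cf g i j m else 0)"
proof -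
  have "cf (ser_trunc n g) i j m =
      (\<Sum>t\<in>simplex3 n. if t = (i, j, m) then cf g i j m else 0)"
    unfolding ser_trunc_def cf_sum
    by (rule sum.cong) (auto simp: cf_mon split: prod.splits)
  then show ?thesis by simp
qed

lemma trunc_remainder: "g - ser_trunc n g \<in> filt 1 1 1 (Suc n)"
  by (rule filtI) (simp add: cf_trunc)

section \<open>Continuous linear operators on series\<close>

definition ser_linear :: "(ser \<Rightarrow> ser) \<Rightarrow> bool" where
  "ser_linear A \<longleftrightarrow> (\<forall>f g. A (f + g) = A f + A g) \<and> (\<forall>a f. A (const_ser a * f) = const_ser a * A f)"

text \<open>Continuity at 0 in the topology of the total degree; for linear operators this is
  continuity everywhere.\<close>

definition ser_cont :: "(ser \<Rightarrow> ser) \<Rightarrow> bool" where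
  "ser_cont A \<longleftrightarrow> (\<forall>n. \<exists>k. \<forall>g\<in>filt 1 1 1 k. A g \<in> filt 1 1 1 n)"

lemma linear_add: "ser_linear A \<Longrightarrow> A (f + g) = A f + A g"
  and linear_const_mult: "ser_linear A \<Longrightarrow> A (const_ser a * f) = const_ser a * A f"
  by (simp_all add: ser_linear_def)

lemma linear_0: "ser_linear A \<Longrightarrow> A 0 = 0"
  using linear_const_mult[of A 0 0] by simp

lemma linear_uminus: "ser_linear A \<Longrightarrow> A (- f) = - A f"
  using linear_const_mult[of A "-1" f] by (simp add: const_ser_uminus)

lemma linear_diff: "ser_linear A \<Longrightarrow> A (f - g) = A f - A g"
  using linear_add[of A f "- g"] by (simp add: linear_uminus)

lemma linear_sum: "ser_linear A \<Longrightarrow> A (sum f X) = (\<Sum>x\<in>X. A (f x))"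
  by (induction X rule: infinite_finite_induct) (auto simp: linear_add linear_0)

lemma linear_trunc:
  "ser_linear A \<Longrightarrow> A (ser_trunc n g) = (\<Sum>(p, q, r)\<in>simplex3 n. const_ser (cf g p q r) * A (mon p q r))"
  unfolding ser_trunc_def by (simp add: linear_sum linear_const_mult case_prod_unfold)

text \<open>Finite combinations of monomials are dense, so identities between continuous linear
  operators can be checked on monomials.\<close>

lemma linear_eq_0I:
  assumes "ser_linear A" "ser_cont A" "\<And>i j m. A (mon i j m) = 0"
  shows "A g = 0"
proof (rule filt_0I[of _ 1 1 1])
  fix n
  obtain k where k: "\<And>g. g \<in> filt 1 1 1 k \<Longrightarrow> A g \<in> filt 1 1 1 n"
    using assms(2) unfolding ser_cont_def by metis
  have "A (g - ser_trunc k g) \<in> filt 1 1 1 n"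
    by (rule k, rule filt_mono[OF trunc_remainder]) simp
  then show "A g \<in> filt 1 1 1 n"
    using assms by (simp add: linear_diff linear_trunc case_prod_unfold)
qed

lemma linear_intros:
  assumes "ser_linear A" "ser_linear B"
  shows "ser_linear (\<lambda>g. A g + B g)" "ser_linear (\<lambda>g. A g - B g)" "ser_linear (\<lambda>g. A (B g))"
    "ser_linear (\<lambda>g. A g * f)" "ser_linear (\<lambda>g. f * A g)"
  using assms by (auto simp: ser_linear_def algebra_simps)

lemma linear_basic: "ser_linear ser_dx" "ser_linear ser_dy" "ser_linear (\<lambda>g. g)"
  "ser_linear (\<lambda>g. g * f)" "ser_linear (\<lambda>g. f * g)"
  by (simp_all add: ser_linear_def distrib_left distrib_right ser_dx_add ser_dy_add ser_dx_const_mult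
      ser_dy_const_mult mult.assoc mult.left_commute)

lemma cont_intros:
  assumes "ser_cont A" "ser_cont B"
  shows "ser_cont (\<lambda>g. A g + B g)" "ser_cont (\<lambda>g. A g - B g)" "ser_cont (\<lambda>g. A (B g))"
    "ser_cont (\<lambda>g. A g * f)" "ser_cont (\<lambda>g. f * A g)"
proof -
  have *: "\<exists>k. \<forall>g\<in>filt 1 1 1 k. A g \<in> filt 1 1 1 n \<and> B g \<in> filt 1 1 1 n" for n
  proof -
    obtain k l where "\<forall>g\<in>filt 1 1 1 k. A g \<in> filt 1 1 1 n" "\<forall>g\<in>filt 1 1 1 l. B g \<in> filt 1 1 1 n"
      using assms unfolding ser_cont_def by meson
    then have "\<forall>g\<in>filt 1 1 1 (max k l). A g \<in> filt 1 1 1 n \<and> B g \<in> filt 1 1 1 n"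
      by (meson filt_mono max.cobounded1 max.cobounded2)
    then show ?thesis by blast
  qed
  show "ser_cont (\<lambda>g. A g + B g)"
    unfolding ser_cont_def using * by (blast intro: filt_add)
  show "ser_cont (\<lambda>g. A g - B g)"
    unfolding ser_cont_def using * by (blast intro: filt_diff)
  show "ser_cont (\<lambda>g. A (B g))"
    using assms unfolding ser_cont_def by meson
  have f: "f \<in> filt 1 1 1 0" by simp
  have "u * f \<in> filt 1 1 1 n \<and> f * u \<in> filt 1 1 1 n" if "u \<in> filt 1 1 1 n" for u n
    using filt_mult[OF that f] by (simp add: mult.commute)
  then show "ser_cont (\<lambda>g. A g * f)" "ser_cont (\<lambda>g. f * A g)"
    unfolding ser_cont_def using * by blast+
qed

lemma cont_basic: "ser_cont ser_dx" "ser_cont ser_dy" "ser_cont (\<lambda>g. g)"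
proof -
  have "ser_dx g \<in> filt 1 1 1 n" "ser_dy g \<in> filt 1 1 1 n" if "g \<in> filt 1 1 1 (Suc n)" for g n
    using that by (auto simp: filt_def)
  then show "ser_cont ser_dx" "ser_cont ser_dy" unfolding ser_cont_def by blast+
  show "ser_cont (\<lambda>g. g)" unfolding ser_cont_def by blast
qed

section \<open>Continuous algebra homomorphisms over the parameter\<close>

definition ser_hom :: "(ser \<Rightarrow> ser) \<Rightarrow> bool" where
  "ser_hom A \<longleftrightarrow> ser_linear A \<and> ser_cont A \<and> (\<forall>f g. A (f * g) = A f * A g) \<and> A 1 = 1 \<and> A eps_ser = eps_ser"

lemma
  assumes "ser_hom A"
  shows hom_linear: "ser_linear A" and hom_cont: "ser_cont A" and hom_mult: "A (f * g) = A f * A g"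
    and hom_one: "A 1 = 1" and hom_eps: "A eps_ser = eps_ser"
    and hom_add: "A (f + g) = A f + A g" and hom_diff: "A (f - g) = A f - A g"
    and hom_uminus: "A (- f) = - A f" and hom_0: "A 0 = 0"
  using assms by (simp_all add: ser_hom_def linear_add linear_diff linear_uminus linear_0)

lemma hom_const_mult: "ser_hom A \<Longrightarrow> A (const_ser a * f) = const_ser a * A f"
  by (rule linear_const_mult[OF hom_linear])

lemma hom_const: "ser_hom A \<Longrightarrow> A (const_ser a) = const_ser a"
  using hom_const_mult[of A a 1] by (simp add: hom_one)

lemma hom_power: "ser_hom A \<Longrightarrow> A (f ^ n) = A f ^ n"
  by (induction n) (simp_all add: hom_mult hom_one)

lemma hom_mon: "ser_hom A \<Longrightarrow> A (mon i j m) = A x_ser ^ i * A y_ser ^ j * eps_ser ^ m"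
  by (simp add: mon_def hom_mult hom_power hom_eps)

lemma hom_eqI:
  assumes "ser_hom A" "ser_hom B" "A x_ser = B x_ser" "A y_ser = B y_ser"
  shows "A = B"
proof
  fix g
  have "A g - B g = 0"
    by (rule linear_eq_0I[where A = "\<lambda>g. A g - B g"])
      (use assms in \<open>simp_all add: linear_intros(2) cont_intros(2) hom_linear hom_cont hom_mon\<close>)
  then show "A g = B g" by simp
qed

lemma hom_comp: "ser_hom A \<Longrightarrow> ser_hom B \<Longrightarrow> ser_hom (\<lambda>g. A (B g))"
  by (simp add: ser_hom_def linear_intros(3) cont_intros(3))

lemma hom_id: "ser_hom (\<lambda>g. g)"
  by (simp add: ser_hom_def linear_basic cont_basic)

lemma fixes_origin_iff: "fixes_origin G \<longleftrightarrow> fst G \<in> filt 1 1 1 1 \<and> snd G \<in> filt 1 1 1 1"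
  by (auto simp: fixes_origin_def filt_def)

lemma subst_monomial_in_filt:
  assumes "G1 \<in> filt a b c a" "G2 \<in> filt a b c b"
  shows "G1 ^ p * G2 ^ q * eps_ser ^ r \<in> filt a b c (a * p + b * q + c * r)"
proof -
  have "eps_ser \<in> filt a b c c" by (rule filtI) (auto simp: eps_ser_mon cf_mon)
  then show ?thesis
    using filt_mult[OF filt_mult[OF filt_power[OF assms(1)] filt_power[OF assms(2)]] filt_power, of eps_ser c p q r]
    by (simp add: mult.commute)
qed

text \<open>Products of total degree above \<open>i + j + m\<close> contribute nothing, so the range
  of summation may be enlarged. \<open>subst_mon\<close> needs a range that contains its own
  index.\<close>

lemma cf_subst:
  assumes "fixes_origin G" "i + j + m \<le> n"
  shows "cf (ser_subst g G) i j m =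
    (\<Sum>(p, q, r)\<in>simplex3 n. cf g p q r * cf (fst G ^ p * snd G ^ q * eps_ser ^ r) i j m)"
proof -
  have "cf (fst G ^ p * snd G ^ q * eps_ser ^ r) i j m = 0" if "i + j + m < p + q + r" for p q r
    using subst_monomial_in_filt[of "fst G" 1 1 1 "snd G" p q r] assms that
    by (simp add: fixes_origin_iff filtD)
  then show ?thesis unfolding ser_subst_def cf_mk_ser simplex3_def[symmetric]
    by (intro sum.mono_neutral_left) (use assms in auto)
qed

lemma subst_in_filt:
  assumes "fixes_origin G" "fst G \<in> filt a b c a" "snd G \<in> filt a b c b" "g \<in> filt a b c n"
  shows "ser_subst g G \<in> filt a b c n"
proof (rule filtI)
  fix i j m assume w: "a * i + b * j + c * m < n"
  have "cf g p q r * cf (fst G ^ p * snd G ^ q * eps_ser ^ r) i j m = 0" for p q r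
  proof (cases "a * p + b * q + c * r < n")
    case True then show ?thesis using assms by (simp add: filtD)
  next
    case False
    then show ?thesis using w filtD[OF subst_monomial_in_filt[OF assms(2,3), of p q r]] by simp
  qed
  then show "cf (ser_subst g G) i j m = 0"
    unfolding cf_subst[OF assms(1) order_refl] by (intro sum.neutral) auto
qed

lemma subst_linear: "fixes_origin G \<Longrightarrow> ser_linear (\<lambda>g. ser_subst g G)"
  unfolding ser_linear_def
  by (intro conjI allI ser_eqI)
    (simp_all add: cf_subst[OF _ order_refl] case_prod_unfold sum.distrib[symmetric] sum_distrib_left distrib_right mult.assoc)

lemma subst_mon:
  assumes "fixes_origin G"
  shows "ser_subst (mon p q r) G = fst G ^ p * snd G ^ q * eps_ser ^ r"
proof (rule ser_eqI)
  fix i j m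
  have "cf (ser_subst (mon p q r) G) i j m =
    (\<Sum>t\<in>simplex3 (i + j + m + p + q + r). if t = (p, q, r) then cf (fst G ^ p * snd G ^ q * eps_ser ^ r) i j m else 0)"
    unfolding cf_subst[OF assms, of i j m "i + j + m + p + q + r" "mon p q r", simplified]
    by (rule sum.cong) (auto simp: cf_mon split: if_splits)
  then show "cf (ser_subst (mon p q r) G) i j m = cf (fst G ^ p * snd G ^ q * eps_ser ^ r) i j m"
    by simp
qed

lemma subst_cont: "fixes_origin G \<Longrightarrow> ser_cont (\<lambda>g. ser_subst g G)"
  unfolding ser_cont_def using subst_in_filt[of G 1 1 1] by (auto simp: fixes_origin_iff)

text \<open>Clear for two monomials, and extended by density first in one factor and then in the
  other.\<close>

lemma subst_mult:
  assumes "fixes_origin G"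
  shows "ser_subst (f * g) G = ser_subst f G * ser_subst g G"
proof -
  let ?S = "\<lambda>g. ser_subst g G"
  note S = subst_linear[OF assms] subst_cont[OF assms]
  have mm: "?S (mon i j m * mon p q r) = ?S (mon i j m) * ?S (mon p q r)" for i j m p q r
    by (simp add: mon_mult subst_mon[OF assms] power_add algebra_simps)
  have S': "ser_linear (\<lambda>g. ?S (f * g))" "ser_linear (\<lambda>g. ?S (g * f))"
    "ser_cont (\<lambda>g. ?S (f * g))" "ser_cont (\<lambda>g. ?S (g * f))" for f
    by (rule linear_intros(3)[OF S(1) linear_basic(5)] linear_intros(3)[OF S(1) linear_basic(4)]
        cont_intros(3)[OF S(2) cont_intros(5)[OF cont_basic(3) cont_basic(3)]]
        cont_intros(3)[OF S(2) cont_intros(4)[OF cont_basic(3) cont_basic(3)]])+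
  have "?S (f * mon p q r) - ?S f * ?S (mon p q r) = 0" for f p q r
    by (rule linear_eq_0I[where A = "\<lambda>f. ?S (f * mon p q r) - ?S f * ?S (mon p q r)"])
      (simp_all add: linear_intros(2) linear_intros(4)[OF S(1) S(1)] cont_intros(2) cont_intros(4)[OF S(2) S(2)] S' mm)
  then have fm: "?S (f * mon p q r) = ?S f * ?S (mon p q r)" for f p q r by simp
  have "?S (f * g) - ?S f * ?S g = 0"
    by (rule linear_eq_0I[where A = "\<lambda>g. ?S (f * g) - ?S f * ?S g"])
      (simp_all add: linear_intros(2) linear_intros(5)[OF S(1) S(1)] cont_intros(2) cont_intros(5)[OF S(2) S(2)] S' fm)
  then show ?thesis by simp
qed

lemma subst_x: "fixes_origin G \<Longrightarrow> ser_subst x_ser G = fst G"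
  and subst_y: "fixes_origin G \<Longrightarrow> ser_subst y_ser G = snd G"
  and subst_eps: "fixes_origin G \<Longrightarrow> ser_subst eps_ser G = eps_ser"
  and subst_one: "fixes_origin G \<Longrightarrow> ser_subst 1 G = 1"
  using subst_mon[of G 1 0 0] subst_mon[of G 0 1 0] subst_mon[of G 0 0 1] subst_mon[of G 0 0 0]
  by (simp_all add: mon_def)

lemma hom_subst: "fixes_origin G \<Longrightarrow> ser_hom (\<lambda>g. ser_subst g G)"
  by (simp add: ser_hom_def subst_linear subst_cont subst_mult subst_one subst_eps)

lemma cf_power_0: "cf (f ^ n) 0 0 0 = cf f 0 0 0 ^ n"
  by (induction n) (simp_all add: cf_mult cf_1)

text \<open>Powers of a series without constant term tend to 0, and by continuity so do the powers
  of its image. The constant term of the image is therefore a real number with a vanishing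
  power.\<close>

lemma hom_fixes_origin:
  assumes "ser_hom A"
  shows "fixes_origin (A x_ser, A y_ser)"
proof -
  have "cf (A f) 0 0 0 = 0" if "f \<in> filt 1 1 1 1" for f
  proof -
    obtain k where "\<And>g. g \<in> filt 1 1 1 k \<Longrightarrow> A g \<in> filt 1 1 1 1"
      using hom_cont[OF assms] unfolding ser_cont_def by metis
    then have "A (f ^ k) \<in> filt 1 1 1 1" using filt_power[OF that, of k] by simp
    then have "cf (A f) 0 0 0 ^ k = 0" using assms by (simp add: hom_power filtD flip: cf_power_0)
    then show ?thesis by simp
  qed
  moreover have "x_ser \<in> filt 1 1 1 1" "y_ser \<in> filt 1 1 1 1"
    by (rule filtI; simp add: x_ser_mon y_ser_mon cf_mon)+
  ultimately show ?thesis by (simp add: fixes_origin_def)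
qed

lemma hom_subst_eq: "ser_hom A \<Longrightarrow> A g = ser_subst g (A x_ser, A y_ser)"
  by (rule fun_cong[of A "\<lambda>g. ser_subst g (A x_ser, A y_ser)"], rule hom_eqI)
    (simp_all add: hom_subst hom_fixes_origin subst_x subst_y)

text \<open>The two sides of the chain rule both obey a product rule along \<open>A\<close>; so does
  their difference, which is then determined by its values on the generators.\<close>

lemma twisted_derivation_eq_0I:
  assumes hom: "ser_hom A" and lin: "ser_linear C" "ser_cont C"
    and mult: "\<And>f g. C (f * g) = C f * A g + A f * C g"
    and gen: "C x_ser = 0" "C y_ser = 0" "C eps_ser = 0"
  shows "C g = 0"
proof (rule linear_eq_0I[OF lin])
  have "C 1 = 0" using mult[of 1 1] hom_one[OF hom] by simp
  then have "C f = 0 \<Longrightarrow> C (f ^ n) = 0" for f n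
    by (induction n) (simp_all add: mult)
  then show "C (mon i j m) = 0" for i j m
    using gen by (simp add: mon_def mult)
qed

lemma chain_rule:
  assumes "ser_hom A"
  shows "ser_dx (A f) = A (ser_dx f) * ser_dx (A x_ser) + A (ser_dy f) * ser_dx (A y_ser)"
    and "ser_dy (A f) = A (ser_dx f) * ser_dy (A x_ser) + A (ser_dy f) * ser_dy (A y_ser)"
proof -
  note A = hom_linear[OF assms] hom_cont[OF assms]
  have *: "d (A f) - (A (ser_dx f) * d (A x_ser) + A (ser_dy f) * d (A y_ser)) = 0"
    if d: "d = ser_dx \<or> d = ser_dy" for d
  proof (rule twisted_derivation_eq_0I[OF assms, where C = "\<lambda>f. d (A f) - (A (ser_dx f) * d (A x_ser) + A (ser_dy f) * d (A y_ser))"])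
    have ld: "ser_linear d" "ser_cont d" using d linear_basic cont_basic by auto
    have l: "ser_linear (\<lambda>f. A (ser_dx f))" "ser_linear (\<lambda>f. A (ser_dy f))" "ser_linear (\<lambda>f. d (A f))"
      by (rule linear_intros(3)[OF A(1) linear_basic(1)] linear_intros(3)[OF A(1) linear_basic(2)]
          linear_intros(3)[OF ld(1) A(1)])+
    show "ser_linear (\<lambda>f. d (A f) - (A (ser_dx f) * d (A x_ser) + A (ser_dy f) * d (A y_ser)))"
      by (intro linear_intros(2)[OF l(3)] linear_intros(1)[OF linear_intros(4)[OF l(1) l(1)] linear_intros(4)[OF l(2) l(2)]])
    have c: "ser_cont (\<lambda>f. A (ser_dx f))" "ser_cont (\<lambda>f. A (ser_dy f))" "ser_cont (\<lambda>f. d (A f))"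
      by (rule cont_intros(3)[OF A(2) cont_basic(1)] cont_intros(3)[OF A(2) cont_basic(2)]
          cont_intros(3)[OF ld(2) A(2)])+
    show "ser_cont (\<lambda>f. d (A f) - (A (ser_dx f) * d (A x_ser) + A (ser_dy f) * d (A y_ser)))"
      by (intro cont_intros(2)[OF c(3)] cont_intros(1)[OF cont_intros(4)[OF c(1) c(1)] cont_intros(4)[OF c(2) c(2)]])
    fix f g
    have "d (u * v) = d u * v + u * d v" for u v using d ser_dx_mult ser_dy_mult by auto
    then show "d (A (f * g)) - (A (ser_dx (f * g)) * d (A x_ser) + A (ser_dy (f * g)) * d (A y_ser)) =
       (d (A f) - (A (ser_dx f) * d (A x_ser) + A (ser_dy f) * d (A y_ser))) * A g +
       A f * (d (A g) - (A (ser_dx g) * d (A x_ser) + A (ser_dy g) * d (A y_ser)))"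
      using assms by (simp add: hom_mult hom_add ser_dx_mult ser_dy_mult algebra_simps)
  qed (use assms d in \<open>auto simp: hom_one hom_0 hom_eps\<close>)
  show "ser_dx (A f) = A (ser_dx f) * ser_dx (A x_ser) + A (ser_dy f) * ser_dx (A y_ser)"
    and "ser_dy (A f) = A (ser_dx f) * ser_dy (A x_ser) + A (ser_dy f) * ser_dy (A y_ser)"
    using *[of ser_dx] *[of ser_dy] by simp_all
qed

text \<open>The bracket is a determinant of first derivatives, so the chain rule and the
  multiplicativity of determinants produce the Jacobian as a factor.\<close>

lemma hom_poisson:
  "ser_hom A \<Longrightarrow> poisson (A f) (A g) = poisson (A x_ser) (A y_ser) * A (poisson f g)"
  by (simp add: poisson_def chain_rule[of A f] chain_rule[of A g] hom_diff hom_mult algebra_simps)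

section \<open>Operators on the filtration with weights 2, 3, 6\<close>

abbreviation V :: "nat \<Rightarrow> ser set" where "V \<equiv> filt 2 3 6"

text \<open>Monomials in \<open>\<epsilon>\<close> alone are Casimirs, so a Hamiltonian is only visible up to them.\<close>

definition Vham :: "nat \<Rightarrow> ser set" where
  "Vham n = {g. \<forall>i j m. 0 < i + j \<and> 2 * i + 3 * j + 6 * m < n \<longrightarrow> cf g i j m = 0}"

definition shifts :: "nat \<Rightarrow> (ser \<Rightarrow> ser) \<Rightarrow> bool" where
  "shifts q A \<longleftrightarrow> (\<forall>n. \<forall>g\<in>V n. A g \<in> V (n + q))"

abbreviation close :: "nat \<Rightarrow> (ser \<Rightarrow> ser) \<Rightarrow> (ser \<Rightarrow> ser) \<Rightarrow> bool" where
  "close q A B \<equiv> shifts q (\<lambda>g. A g - B g)"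

lemma shiftsI: "(\<And>n g. g \<in> V n \<Longrightarrow> A g \<in> V (n + q)) \<Longrightarrow> shifts q A"
  and shiftsD: "shifts q A \<Longrightarrow> g \<in> V n \<Longrightarrow> A g \<in> V (n + q)"
  by (auto simp: shifts_def)

lemma shiftsD_le: "shifts q A \<Longrightarrow> g \<in> V n \<Longrightarrow> k \<le> n + q \<Longrightarrow> A g \<in> V k"
  using shiftsD filt_mono by blast

lemma shifts_mono: "shifts q A \<Longrightarrow> r \<le> q \<Longrightarrow> shifts r A"
  unfolding shifts_def using filt_mono by (metis add_left_mono)

lemma shifts_add: "shifts q A \<Longrightarrow> shifts q B \<Longrightarrow> shifts q (\<lambda>g. A g + B g)"
  and shifts_diff: "shifts q A \<Longrightarrow> shifts q B \<Longrightarrow> shifts q (\<lambda>g. A g - B g)"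
  and shifts_uminus: "shifts q A \<Longrightarrow> shifts q (\<lambda>g. - A g)"
  by (auto simp: shifts_def filt_add filt_diff filt_uminus)

lemma shifts_comp: "shifts p A \<Longrightarrow> shifts q B \<Longrightarrow> r \<le> p + q \<Longrightarrow> shifts r (\<lambda>g. A (B g))"
  by (rule shiftsI, rule shiftsD_le[of p A], assumption, rule shiftsD[of q B], assumption, assumption) simp

lemma shifts_id: "shifts 0 (\<lambda>g. g)"
  by (simp add: shifts_def)

lemma close_refl [simp]: "close q A A"
  by (simp add: shifts_def)

lemma close_sym: "close q A B \<Longrightarrow> close q B A"
  using shifts_uminus[of q "\<lambda>g. A g - B g"] by simp

lemma close_trans: "close q A B \<Longrightarrow> close q B C \<Longrightarrow> close q A C"
  using shifts_add[of q "\<lambda>g. A g - B g" "\<lambda>g. B g - C g"] by simp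

lemma close_add: "close q A A' \<Longrightarrow> close q B B' \<Longrightarrow> close q (\<lambda>g. A g + B g) (\<lambda>g. A' g + B' g)"
  using shifts_add[of q "\<lambda>g. A g - A' g" "\<lambda>g. B g - B' g"] by (simp add: algebra_simps)

lemma close_comp_left: "ser_linear A \<Longrightarrow> shifts p A \<Longrightarrow> close q B C \<Longrightarrow> r \<le> p + q \<Longrightarrow> close r (\<lambda>g. A (B g)) (\<lambda>g. A (C g))"
  using shifts_comp[of p A q "\<lambda>g. B g - C g" r] by (simp add: linear_diff)

lemma close_comp_right: "close q B C \<Longrightarrow> shifts p A \<Longrightarrow> r \<le> p + q \<Longrightarrow> close r (\<lambda>g. B (A g)) (\<lambda>g. C (A g))"
  using shifts_comp[of q "\<lambda>g. B g - C g" p A r] by simp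

lemma shifts_close: "close q A B \<Longrightarrow> shifts r B \<Longrightarrow> r \<le> q \<Longrightarrow> shifts r A"
  using shifts_add[of r "\<lambda>g. A g - B g" B] shifts_mono[of q "\<lambda>g. A g - B g" r] by simp

lemma close_idD: "close q A (\<lambda>g. g) \<Longrightarrow> shifts 0 A"
  by (rule shifts_close[OF _ shifts_id]) auto

lemma V_dx: "g \<in> V n \<Longrightarrow> ser_dx g \<in> V (n - 2)" and V_dy: "g \<in> V n \<Longrightarrow> ser_dy g \<in> V (n - 3)"
  by (auto simp: filt_def)

lemma V_poisson: "f \<in> V a \<Longrightarrow> g \<in> V b \<Longrightarrow> n + 5 \<le> a + b \<Longrightarrow> poisson f g \<in> V n"
  unfolding poisson_def
  using filt_mult_le[OF V_dx[of f a] V_dy[of g b], of n] filt_mult_le[OF V_dy[of f a] V_dx[of g b], of n]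
  by (simp add: filt_diff)

lemma V_Vham: "f \<in> V n \<Longrightarrow> f \<in> Vham n"
  by (simp add: filt_def Vham_def)

lemma Vham_diff: "f \<in> Vham n \<Longrightarrow> g \<in> Vham n \<Longrightarrow> f - g \<in> Vham n"
  and Vham_add: "f \<in> Vham n \<Longrightarrow> g \<in> Vham n \<Longrightarrow> f + g \<in> Vham n"
  by (simp_all add: Vham_def)

lemma shifts_lie: 
  assumes "f \<in> Vham (q + 5)" shows "shifts q (lie f)"
proof (rule shiftsI)
  fix n g assume g: "g \<in> V n"
  have f: "ser_dx f \<in> V (q + 3)" "ser_dy f \<in> V (q + 2)"
    using assms by (auto simp: filt_def Vham_def)
  show "lie f g \<in> V (n + q)" unfolding lie_def poisson_def
    by (rule filt_diff[OF filt_mult_le[OF V_dx[OF g] f(2)] filt_mult_le[OF V_dy[OF g] f(1)]]) auto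
qed

text \<open>The values on \<open>x\<close> and \<open>y\<close> return both partial derivatives of
  \<open>f\<close>. This direction turns a comparison of flows to leading order into one of
  Hamiltonians.\<close>

lemma shifts_lie_iff: "shifts q (lie f) \<longleftrightarrow> f \<in> Vham (q + 5)"
proof
  assume s: "shifts q (lie f)"
  have "x_ser \<in> V 2" "y_ser \<in> V 3" by (rule filtI; auto simp: x_ser_mon y_ser_mon cf_mon)+
  then have "ser_dy f \<in> V (2 + q)" "- ser_dx f \<in> V (3 + q)"
    using shiftsD[OF s] by (metis lie_def poisson_x_y(2), metis lie_def poisson_x_y(3))
  then have y: "2 * i + 3 * j + 6 * m < 2 + q \<Longrightarrow> cf f i (Suc j) m = 0"
    and x: "2 * i + 3 * j + 6 * m < 3 + q \<Longrightarrow> cf f (Suc i) j m = 0" for i j m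
    by (auto simp: filt_def simp flip: of_nat_Suc)
  show "f \<in> Vham (q + 5)" unfolding Vham_def
  proof (intro CollectI allI impI, elim conjE)
    fix i j m :: nat assume "0 < i + j" "2 * i + 3 * j + 6 * m < q + 5"
    then show "cf f i j m = 0"
      using x[of "i - 1" j m] y[of i "j - 1" m] by (cases i; cases j) auto
  qed
qed (rule shifts_lie)

lemma linear_lie: "ser_linear (lie f)"
  by (simp add: ser_linear_def lie_def poisson_add_left poisson_const_mult)

lemma lie_add: "lie (f + g) u = lie f u + lie g u"
  and lie_diff: "lie (f - g) u = lie f u - lie g u"
  and lie_uminus: "lie (- f) u = - lie f u"
  by (simp_all add: lie_def poisson_add_right poisson_diff_right poisson_uminus_right)

text \<open>The weight of a monomial lies between 2 and 6 times its total degree, so both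
  filtrations define the same topology.\<close>

lemma shifts_0_cont: assumes "shifts 0 A" shows "ser_cont A"
proof -
  have "A g \<in> filt 1 1 1 n" if "g \<in> filt 1 1 1 (3 * n)" for n g
  proof -
    have "g \<in> V (6 * n)" using that by (auto simp: filt_def)
    then have "A g \<in> V (6 * n)" using shiftsD[OF assms] by simp
    then show ?thesis by (auto simp: filt_def)
  qed
  then show ?thesis unfolding ser_cont_def by blast
qed

text \<open>The gain \<open>q\<close> is read off from monomials after truncation. The remainder has
  a weight so large that \<open>shifts 0 A\<close> alone suffices for it.\<close>

lemma shifts_on_monI:
  assumes "ser_linear A" "shifts 0 A" "\<And>i j m. A (mon i j m) \<in> V (2 * i + 3 * j + 6 * m + q)"
  shows "shifts q A"
proof (rule shiftsI)
  fix n g assume g: "g \<in> V n"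
  have "g - ser_trunc (n + q) g \<in> V (n + q)"
    using trunc_remainder[of g "n + q"] by (auto simp: filt_def)
  then have 1: "A (g - ser_trunc (n + q) g) \<in> V (n + q)" using shiftsD[OF assms(2)] by simp
  have 2: "A (ser_trunc (n + q) g) \<in> V (n + q)"
    unfolding linear_trunc[OF assms(1)]
  proof (rule filt_sum, clarify)
    fix i j m
    show "const_ser (cf g i j m) * A (mon i j m) \<in> V (n + q)"
    proof (cases "2 * i + 3 * j + 6 * m < n")
      case True then show ?thesis using g by (simp add: filtD)
    next
      case False then show ?thesis
        by (intro filt_const_mult filt_mono[OF assms(3)[of i j m]]) simp
    qed
  qed
  show "A g \<in> V (n + q)" using filt_add[OF 1 2] by (simp add: linear_diff[OF assms(1)])
qed

section \<open>The exponential of a Lie derivative\<close>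

definition lie_term :: "ser \<Rightarrow> nat \<Rightarrow> ser \<Rightarrow> ser" where
  "lie_term H k g = const_ser (1 / fact k) * (lie H ^^ k) g"

lemma linear_lie_pow: "ser_linear (lie H ^^ k)"
  by (induction k) (use linear_lie[of H] in \<open>simp_all add: ser_linear_def\<close>)

lemma linear_lie_term: "ser_linear (lie_term H k)"
  unfolding lie_term_def by (rule linear_intros(5)[OF linear_lie_pow linear_lie_pow])

lemma shifts_lie_pow: "shifts q (lie H) \<Longrightarrow> shifts (k * q) (lie H ^^ k)"
proof (induction k)
  case (Suc k) then show ?case using shifts_comp[of q "lie H" "k * q" "lie H ^^ k"] by (simp add: comp_def)
qed (simp add: shifts_def)

lemma shifts_lie_term: "shifts q (lie H) \<Longrightarrow> shifts (k * q) (lie_term H k)"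
  using shifts_lie_pow[where q = q and H = H and k = k] by (simp add: shifts_def lie_term_def filt_const_mult)

text \<open>Every bracket with \<open>H\<close> gains weight \<open>q\<close>, so the series for a
  coefficient is a finite sum, and what the partial sum misses contains at least
  \<open>N + 1\<close> brackets.\<close>

lemma exp_lie_remainder:
  assumes "shifts q (lie H)" "1 \<le> q" "g \<in> V n"
  shows "exp_lie H g - (\<Sum>k\<le>N. lie_term H k g) \<in> V (n + (N + 1) * q)"
proof (rule filtI)
  fix i j m assume w: "2 * i + 3 * j + 6 * m < n + (N + 1) * q"
  have "cf ((lie H ^^ k) g) i j m = 0" if "k > N" for k
  proof -
    have "(N + 1) * q \<le> k * q" using that by (intro mult_right_mono) auto
    then show ?thesis using shiftsD[OF shifts_lie_pow[OF assms(1)] assms(3), of k] w by (auto intro: filtD)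
  qed
  then have "cf (exp_lie H g) i j m = (\<Sum>k\<le>N. cf ((lie H ^^ k) g) i j m / fact k)"
    unfolding exp_lie_def cf_mk_ser by (intro suminf_finite) auto
  then show "cf (exp_lie H g - (\<Sum>k\<le>N. lie_term H k g)) i j m = 0"
    by (simp add: lie_term_def)
qed

lemma exp_lie_remainder_0:
  assumes "shifts 1 (lie H)" "n \<le> N + 1"
  shows "exp_lie H g - (\<Sum>k\<le>N. lie_term H k g) \<in> V n"
  using exp_lie_remainder[OF assms(1), of g 0 N] assms(2) by (auto intro: filt_mono)

lemma exp_lie_linear:
  assumes H: "shifts 1 (lie H)" shows "ser_linear (exp_lie H)"
proof -
  have "exp_lie H (f + g) = exp_lie H f + exp_lie H g" for f g
  proof (rule filt_eqI[of _ _ 2 3 6])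
    fix n :: nat
    let ?r = "\<lambda>g. exp_lie H g - (\<Sum>k\<le>n. lie_term H k g)"
    have "?r (f + g) - (?r f + ?r g) \<in> V n"
      by (intro filt_diff filt_add exp_lie_remainder_0[OF H]) auto
    also have "?r (f + g) - (?r f + ?r g) = exp_lie H (f + g) - (exp_lie H f + exp_lie H g)"
      by (simp add: linear_add[OF linear_lie_term] sum.distrib)
    finally show "exp_lie H (f + g) - (exp_lie H f + exp_lie H g) \<in> V n" .
  qed
  moreover have "exp_lie H (const_ser a * f) = const_ser a * exp_lie H f" for a f
  proof (rule filt_eqI[of _ _ 2 3 6])
    fix n :: nat
    let ?r = "\<lambda>g. exp_lie H g - (\<Sum>k\<le>n. lie_term H k g)"
    have "?r (const_ser a * f) - const_ser a * ?r f \<in> V n"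
      by (intro filt_diff filt_const_mult exp_lie_remainder_0[OF H]) auto
    also have "?r (const_ser a * f) - const_ser a * ?r f = exp_lie H (const_ser a * f) - const_ser a * exp_lie H f"
      by (simp add: linear_const_mult[OF linear_lie_term] right_diff_distrib sum_distrib_left)
    finally show "exp_lie H (const_ser a * f) - const_ser a * exp_lie H f \<in> V n" .
  qed
  ultimately show ?thesis by (simp add: ser_linear_def)
qed

lemma exp_lie_close_id:
  assumes "shifts q (lie H)" "1 \<le> q" shows "close q (exp_lie H) (\<lambda>g. g)"
  using exp_lie_remainder[OF assms, of _ _ 0] by (intro shiftsI) (simp add: lie_term_def)

lemma exp_lie_close_linear:
  assumes "shifts q (lie H)" "1 \<le> q" shows "close (2 * q) (exp_lie H) (\<lambda>g. g + lie H g)"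
  using exp_lie_remainder[OF assms, of _ _ 1] by (intro shiftsI) (simp add: lie_term_def mult_2)

lemma exp_lie_fixed:
  assumes "lie H g = 0" shows "exp_lie H g = g"
proof -
  have "ser_linear (lie H ^^ k)" for k by (rule linear_lie_pow)
  then have "(lie H ^^ Suc k) g = 0" for k
    using assms by (simp only: funpow_Suc_right comp_def linear_0)
  then have "cf ((lie H ^^ k) g) i j m / fact k = (if k = 0 then cf g i j m else 0)" for k i j m
    by (cases k) (simp_all del: funpow.simps(2))
  then show ?thesis unfolding exp_lie_def
    by (intro ser_eqI) (use suminf_finite[of "{0::nat}" "\<lambda>k. if k = 0 then c else 0" for c] in \<open>simp\<close>)
qed

text \<open>A term of the expansion that contains \<open>a\<close> and at least one further bracket
  gains \<open>q + 1\<close>. Only the single bracket with \<open>a\<close> survives, and no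
  commutator of \<open>h\<close> and \<open>a\<close> appears at this order.\<close>

lemma exp_lie_perturb:
  assumes h: "shifts 1 (lie h)" and a: "shifts q (lie a)" "1 \<le> q"
  shows "close (q + 1) (exp_lie (h + a)) (\<lambda>g. exp_lie h g + lie a g)"
proof (rule shiftsI)
  have ha: "shifts 1 (lie (h + a))"
    using shifts_add[OF h shifts_mono[OF a]] by (simp add: lie_add[abs_def])
  have pow: "close (q + k) (lie (h + a) ^^ Suc k) (lie h ^^ Suc k)" for k
  proof (induction k)
    case 0 then show ?case using a by (simp add: lie_add)
  next
    case (Suc k)
    have "shifts (q + Suc k) (\<lambda>g. lie (h + a) ((lie (h + a) ^^ Suc k) g - (lie h ^^ Suc k) g) + lie a ((lie h ^^ Suc k) g))"
      by (intro shifts_add shifts_comp[OF ha Suc] shifts_comp[OF a(1) shifts_lie_pow[OF h]]) auto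
    moreover have "lie (h + a) (u - v) + lie a v = lie (h + a) u - lie h v" for u v
      by (simp add: linear_diff[OF linear_lie] lie_add)
    ultimately show ?case by (simp only: funpow.simps(2)[of "Suc k"] comp_apply add_Suc_right)
  qed
  fix n g assume g: "g \<in> V n"
  let ?r = "\<lambda>H. exp_lie H g - (\<Sum>k\<le>q + 1. lie_term H k g)"
  let ?t = "\<lambda>k. lie_term (h + a) k g - lie_term h k g"
  have r: "?r H \<in> V (n + (q + 1))" if "shifts 1 (lie H)" for H
    using exp_lie_remainder[OF that _ g, of "q + 1"] by (auto intro: filt_mono)
  have t: "?t (Suc (Suc k)) \<in> V (n + (q + 1))" for k
  proof -
    have "?t (Suc (Suc k)) = const_ser (1 / fact (Suc (Suc k))) * ((lie (h + a) ^^ Suc (Suc k)) g - (lie h ^^ Suc (Suc k)) g)"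
      by (simp only: lie_term_def right_diff_distrib)
    then show ?thesis
      using shiftsD_le[OF pow[of "Suc k"] g, of "n + (q + 1)"] by (simp only: filt_const_mult)
  qed
  \<comment> \<open>The difference vanishes for \<open>k = 0\<close> and equals
    \<open>lie a g\<close> for \<open>k = 1\<close>; all later terms are covered by
    \<open>t\<close>.\<close>
  have "{..q + 1} = insert 0 (insert 1 (Suc ` Suc ` {..<q}))"
    by (auto simp: image_image image_iff) (metis One_nat_def Suc_le_mono Suc_pred lessThan_iff less_Suc_eq_le neq0_conv not_less_eq)
  then have "(\<Sum>k\<le>q + 1. ?t k) = ?t 0 + (?t 1 + (\<Sum>k<q. ?t (Suc (Suc k))))"
    by (simp only:) (simp add: image_image sum.reindex image_iff inj_on_def comp_def)
  also have "\<dots> = lie a g + (\<Sum>k<q. ?t (Suc (Suc k)))" by (simp add: lie_term_def lie_add)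
  finally have *: "(\<Sum>k\<le>q + 1. ?t k) - lie a g \<in> V (n + (q + 1))" using t by (simp add: filt_sum)
  have "?r (h + a) - ?r h + ((\<Sum>k\<le>q + 1. ?t k) - lie a g) \<in> V (n + (q + 1))"
    by (intro filt_add filt_diff r ha h *)
  moreover have "?r (h + a) - ?r h + ((\<Sum>k\<le>q + 1. ?t k) - lie a g) = exp_lie (h + a) g - (exp_lie h g + lie a g)"
    by (simp only: sum_subtractf) (simp add: algebra_simps)
  ultimately show "exp_lie (h + a) g - (exp_lie h g + lie a g) \<in> V (n + (q + 1))" by (simp only:)
qed

lemma lie_lie_term: "lie H (lie_term H k g) = of_nat (Suc k) * lie_term H (Suc k) g"
proof -
  have "const_ser (1 / fact k) = of_nat (Suc k) * const_ser (1 / fact (Suc k))"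
    unfolding const_ser_of_nat[symmetric] const_ser_mult[symmetric] by (simp add: divide_simps)
  moreover have "lie H (lie_term H k g) = const_ser (1 / fact k) * (lie H ^^ Suc k) g"
    by (simp add: lie_term_def linear_const_mult[OF linear_lie])
  ultimately show ?thesis by (simp only: lie_term_def mult.assoc)
qed

text \<open>Leibniz rule for the divided powers of a derivation, where the binomial coefficients
  cancel. \<open>B\<close> stays abstract because both the product and the Poisson bracket are of
  this kind, the latter by the Jacobi identity.\<close>

lemma lie_term_bilinear:
  assumes lin: "\<And>f. ser_linear (\<lambda>g. B f g)" "\<And>g. ser_linear (\<lambda>f. B f g)"
    and der: "\<And>f g. lie H (B f g) = B (lie H f) g + B f (lie H g)"
  shows "lie_term H k (B f g) = (\<Sum>a\<le>k. B (lie_term H a f) (lie_term H (k - a) g))"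
proof (induction k)
  case 0 show ?case by (simp add: lie_term_def)
next
  case (Suc k)
  let ?b = "\<lambda>a. B (lie_term H a f) (lie_term H (Suc k - a) g)"
  have nat: "B (of_nat c * u) v = of_nat c * B u v" "B u (of_nat c * v) = of_nat c * B u v" for c u v
    using linear_const_mult[OF lin(1), where a = "of_nat c"] linear_const_mult[OF lin(2), where a = "of_nat c"]
    by (simp_all add: const_ser_of_nat)
  have "of_nat (Suc k) * lie_term H (Suc k) (B f g) = lie H (\<Sum>a\<le>k. B (lie_term H a f) (lie_term H (k - a) g))"
    by (simp only: lie_lie_term[symmetric] Suc)
  also have "\<dots> = (\<Sum>a\<le>k. of_nat (Suc a) * ?b (Suc a)) + (\<Sum>a\<le>k. of_nat (Suc k - a) * ?b a)"
    by (simp add: linear_sum[OF linear_lie] der lie_lie_term nat sum.distrib Suc_diff_le del: of_nat_Suc)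
  also have "(\<Sum>a\<le>k. of_nat (Suc a) * ?b (Suc a)) = (\<Sum>a\<le>Suc k. of_nat a * ?b a)"
    by (simp add: sum.atMost_Suc_shift del: of_nat_Suc sum.atMost_Suc)
  also have "(\<Sum>a\<le>k. of_nat (Suc k - a) * ?b a) = (\<Sum>a\<le>Suc k. of_nat (Suc k - a) * ?b a)"
    by simp
  also have "(\<Sum>a\<le>Suc k. of_nat a * ?b a) + (\<Sum>a\<le>Suc k. of_nat (Suc k - a) * ?b a) = (\<Sum>a\<le>Suc k. of_nat (Suc k) * ?b a)"
    unfolding sum.distrib[symmetric]
    by (rule sum.cong) (simp_all add: distrib_right[symmetric] of_nat_add[symmetric] del: of_nat_add of_nat_Suc)
  finally have "of_nat (Suc k) * lie_term H (Suc k) (B f g) = of_nat (Suc k) * (\<Sum>a\<le>Suc k. ?b a)"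
    by (simp only: sum_distrib_left)
  then have "const_ser (1 / of_nat (Suc k)) * (const_ser (of_nat (Suc k)) * lie_term H (Suc k) (B f g)) =
      const_ser (1 / of_nat (Suc k)) * (const_ser (of_nat (Suc k)) * (\<Sum>a\<le>Suc k. ?b a))"
    by (simp only: const_ser_of_nat)
  then show ?case
    by (simp only: mult.assoc[symmetric] const_ser_mult[symmetric]) (simp del: of_nat_Suc sum.atMost_Suc)
qed

lemma exp_lie_bilinear:
  assumes H: "shifts 1 (lie H)"
    and lin: "\<And>f. ser_linear (\<lambda>g. B f g)" "\<And>g. ser_linear (\<lambda>f. B f g)"
    and der: "\<And>f g. lie H (B f g) = B (lie H f) g + B f (lie H g)"
    and filt: "\<And>a b n f g. f \<in> V a \<Longrightarrow> g \<in> V b \<Longrightarrow> n + 5 \<le> a + b \<Longrightarrow> B f g \<in> V n"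
  shows "exp_lie H (B f g) = B (exp_lie H f) (exp_lie H g)"
proof (rule filt_eqI[of _ _ 2 3 6])
  fix n :: nat
  \<comment> \<open>The bracket may lose weight 5, and the partial sums are taken long enough to
    compensate for it.\<close>
  define K where "K = n + 5"
  let ?E = "\<lambda>u. \<Sum>k\<le>K. lie_term H k u"
  let ?b = "\<lambda>a b. B (lie_term H a f) (lie_term H b g)"
  let ?T = "{(a, b). a + b \<le> K}" and ?Q = "{..K} \<times> {..K}"
  have r: "exp_lie H u - ?E u \<in> V (n + 5)" for u by (rule exp_lie_remainder_0[OF H]) (simp add: K_def)
  have u0: "u \<in> V 0" for u by simp
  have 1: "B (exp_lie H f - ?E f) (exp_lie H g) \<in> V n" "B (?E f) (exp_lie H g - ?E g) \<in> V n"
    by (rule filt[OF r u0] filt[OF u0 r]; simp)+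
  have "B (exp_lie H f) (exp_lie H g) = B (exp_lie H f - ?E f) (exp_lie H g) + B (?E f) (exp_lie H g - ?E g) + B (?E f) (?E g)"
    by (simp add: linear_diff[OF lin(1)] linear_diff[OF lin(2)])
  also have "B (?E f) (?E g) = (\<Sum>(a, b)\<in>?Q. ?b a b)"
    by (simp only: linear_sum[OF lin(1)] linear_sum[OF lin(2)] sum.cartesian_product[symmetric]) (rule sum.swap)
  also have "\<dots> = (\<Sum>(a, b)\<in>?Q - ?T. ?b a b) + (\<Sum>(a, b)\<in>?T. ?b a b)"
    by (rule sum.subset_diff) auto
  also have "(\<Sum>(a, b)\<in>?T. ?b a b) = ?E (B f g)"
    by (simp add: lie_term_bilinear[OF lin der] sum.triangle_reindex_eq)
  finally have eq: "exp_lie H (B f g) - B (exp_lie H f) (exp_lie H g) =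
      (exp_lie H (B f g) - ?E (B f g)) - (B (exp_lie H f - ?E f) (exp_lie H g)
        + B (?E f) (exp_lie H g - ?E g) + (\<Sum>(a, b)\<in>?Q - ?T. ?b a b))"
    by (simp only: algebra_simps)
  \<comment> \<open>Outside the triangle the two factors carry more than \<open>K\<close> brackets
    together, so their weight exceeds \<open>n + 5\<close> before \<open>B\<close> is
    applied.\<close>
  have "(\<Sum>(a, b)\<in>?Q - ?T. ?b a b) \<in> V n"
  proof (rule filt_sum, simp only: case_prod_unfold, goal_cases)
    case (1 t)
    obtain a b where t: "t = (a, b)" by (cases t)
    from 1 t have *: "K < a + b" by auto
    have "lie_term H k u \<in> V k" for k u
      using shiftsD[OF shifts_lie_term[OF H] u0, of k u] by simp
    then have "?b a b \<in> V n" using * by (intro filt[of _ a _ b]) (auto simp: K_def)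
    then show ?case by (simp add: t)
  qed
  moreover have "exp_lie H (B f g) - ?E (B f g) \<in> V n" by (rule filt_mono[OF r]) simp
  ultimately show "exp_lie H (B f g) - B (exp_lie H f) (exp_lie H g) \<in> V n"
    unfolding eq using 1 by (simp only: filt_diff filt_add)
qed

section \<open>Unipotent symplectic automorphisms\<close>

text \<open>A formal map \<open>G\<close> acts on series by \<open>g \<mapsto> g \<circ> G\<close>; conversely a continuous automorphism \<open>A\<close>
  fixing \<open>\<epsilon>\<close> comes from the map \<open>(A x, A y)\<close>, with the order of compositions reversed.\<close>

definition psym :: "(ser \<Rightarrow> ser) \<Rightarrow> bool" where
  "psym T \<longleftrightarrow> ser_hom T \<and> shifts 0 T \<and> poisson (T x_ser) (T y_ser) = 1"

text \<open>Unipotent with respect to the weights: the shear \<open>x \<mapsto> x + y\<close>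
  qualifies because \<open>y\<close> is heavier than \<open>x\<close>.\<close>

definition paut :: "(ser \<Rightarrow> ser) \<Rightarrow> bool" where
  "paut T \<longleftrightarrow> psym T \<and> close 1 T (\<lambda>g. g)"

lemma x_in_V: "x_ser \<in> V 2" and y_in_V: "y_ser \<in> V 3" and eps_in_V: "eps_ser \<in> V 6"
  by (rule filtI; auto simp: x_ser_mon y_ser_mon eps_ser_mon cf_mon)+

lemma psym_hom: "psym T \<Longrightarrow> ser_hom T" and psym_shifts: "psym T \<Longrightarrow> shifts 0 T"
  and psym_poisson: "psym T \<Longrightarrow> poisson (T f) (T g) = T (poisson f g)"
  and psym_linear: "psym T \<Longrightarrow> ser_linear T"
  by (simp_all add: psym_def hom_poisson hom_linear)

lemma psym_comp: "psym S \<Longrightarrow> psym T \<Longrightarrow> psym (\<lambda>g. S (T g))"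
  by (simp add: psym_def hom_comp shifts_comp[of 0 S 0 T] psym_poisson[unfolded psym_def] hom_one)

lemma paut_psym: "paut T \<Longrightarrow> psym T" and paut_close: "paut T \<Longrightarrow> close 1 T (\<lambda>g. g)"
  and paut_linear: "paut T \<Longrightarrow> ser_linear T" and paut_shifts: "paut T \<Longrightarrow> shifts 0 T"
  and paut_hom: "paut T \<Longrightarrow> ser_hom T"
  by (simp_all add: paut_def psym_linear psym_shifts psym_hom)

lemma close_id_comp:
  assumes "close q S (\<lambda>g. g)" "close q T (\<lambda>g. g)"
  shows "close q (\<lambda>g. S (T g)) (\<lambda>g. g)"
  using close_trans[OF close_comp_right[OF assms(1) close_idD[OF assms(2)], of q] assms(2)] by simp

lemma paut_comp: "paut S \<Longrightarrow> paut T \<Longrightarrow> paut (\<lambda>g. S (T g))"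
  unfolding paut_def using psym_comp close_id_comp by blast

text \<open>Completeness: a coefficient of weight \<open>w\<close> does not change from index
  \<open>w + 1\<close> on, and is read off there.\<close>

lemma series_limit:
  assumes "\<And>n. s (Suc n) - s n \<in> V n"
  obtains g where "\<And>n. g - s n \<in> V n"
proof -
  define g where "g = mk_ser (\<lambda>i j m. cf (s (Suc (2 * i + 3 * j + 6 * m))) i j m)"
  have step: "s (n + k) - s n \<in> V n" for n k
  proof (induction k)
    case (Suc k)
    have "s (Suc (n + k)) - s (n + k) \<in> V n" by (rule filt_mono[OF assms]) simp
    from filt_add[OF this Suc] show ?case by simp
  qed simp
  have "g - s n \<in> V n" for n
  proof (rule filtI)
    fix i j m :: nat assume "2 * i + 3 * j + 6 * m < n"
    then have "s n - s (Suc (2 * i + 3 * j + 6 * m)) \<in> V (Suc (2 * i + 3 * j + 6 * m))"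
      using step[of "Suc (2 * i + 3 * j + 6 * m)" "n - Suc (2 * i + 3 * j + 6 * m)"] by simp
    from filtD[OF this, of i j m] show "cf (g - s n) i j m = 0" by (simp add: g_def)
  qed
  then show ?thesis by (rule that)
qed

lemma paut_inj: "paut T \<Longrightarrow> T f = T g \<Longrightarrow> f = g"
proof (rule filt_eqI[of f g 2 3 6])
  fix n assume T: "paut T" and eq: "T f = T g"
  show "f - g \<in> V n"
  proof (induction n)
    case (Suc n)
    have "T (f - g) = 0" using eq T by (simp add: linear_diff[OF paut_linear])
    then show ?case using filt_uminus[OF shiftsD[OF paut_close[OF T] Suc]] by simp
  qed simp
qed

text \<open>Neumann series for \<open>T = 1 - N\<close>, which converges because \<open>N\<close>
  raises weights.\<close>

lemma paut_surj:
  assumes T: "paut T" obtains g where "T g = f"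
proof -
  define N where "N = (\<lambda>g. g - T g)"
  define s where "s n = (\<Sum>k<n. (N ^^ k) f)" for n
  have N: "shifts 1 N" using close_sym[OF paut_close[OF T]] by (simp add: N_def)
  have Nk: "(N ^^ k) f \<in> V k" for k
    by (induction k) (use shiftsD[OF N] in fastforce)+
  then have "s (Suc n) - s n \<in> V n" for n by (simp add: s_def)
  then obtain g where g: "\<And>n. g - s n \<in> V n" using series_limit by blast
  have Ts: "T (s n) = f - (N ^^ n) f" for n
  proof (induction n)
    case 0 then show ?case by (simp add: s_def linear_0[OF paut_linear[OF T]])
  next
    case (Suc n)
    have "T (s (Suc n)) = T (s n) + T ((N ^^ n) f)"
      by (simp add: s_def linear_add[OF paut_linear[OF T]])
    then show ?case using Suc by (simp add: N_def)
  qed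
  have "T g = f"
  proof (rule filt_eqI[of _ _ 2 3 6])
    fix n
    have "T (g - s n) \<in> V n" using shiftsD[OF paut_shifts[OF T] g[of n]] by simp
    then have "T (g - s n) - (N ^^ n) f \<in> V n" by (rule filt_diff[OF _ Nk])
    then show "T g - f \<in> V n" by (simp add: linear_diff[OF paut_linear[OF T]] Ts)
  qed
  then show ?thesis by (rule that)
qed

lemma paut_bij:
  assumes "paut T" shows "bij T"
proof (rule bijI)
  show "inj T" by (rule injI) (rule paut_inj[OF assms])
  have "\<exists>g. T g = f" for f by (rule paut_surj[OF assms, of f]) blast
  then show "surj T" unfolding surj_def by metis
qed

lemma paut_inv_f: "paut T \<Longrightarrow> Hilbert_Choice.inv T (T g) = g" and paut_f_inv: "paut T \<Longrightarrow> T (Hilbert_Choice.inv T g) = g"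
  using paut_bij[of T] by (simp_all add: bij_is_inj bij_is_surj surj_f_inv_f)

lemma paut_inv_close:
  assumes T: "paut T" and q: "close q T (\<lambda>g. g)" shows "close q (Hilbert_Choice.inv T) (\<lambda>g. g)"
proof (rule shiftsI)
  fix n g assume g: "g \<in> V n"
  define u where "u = Hilbert_Choice.inv T g"
  have Tu: "T u = g" by (simp add: u_def paut_f_inv[OF T])
  \<comment> \<open>The inverse is not yet known to respect weights. The bound on \<open>u\<close>
    is raised by one at a time, using that \<open>T u - u\<close> is always one weight better than
    \<open>u\<close>.\<close>
  have "u \<in> V k" if "k \<le> n" for k using that
  proof (induction k)
    case (Suc k)
    then have "T u - u \<in> V (Suc k)" using shiftsD[OF paut_close[OF T], of u k] by simp
    from filt_diff[OF filt_mono[OF g, of "Suc k"] this] Suc show ?case by (simp add: Tu)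
  qed simp
  then have "T u - u \<in> V (n + q)" using shiftsD[OF q] by blast
  then show "Hilbert_Choice.inv T g - g \<in> V (n + q)" using filt_uminus by (fastforce simp: Tu u_def[symmetric])
qed

lemma paut_inv: assumes T: "paut T" shows "paut (Hilbert_Choice.inv T)"
proof -
  note h = paut_hom[OF T]
  have close: "close 1 (Hilbert_Choice.inv T) (\<lambda>g. g)" by (rule paut_inv_close[OF T paut_close[OF T]])
  have eq: "Hilbert_Choice.inv T f = g" if "f = T g" for f g using that paut_inv_f[OF T] by simp
  have "ser_hom (Hilbert_Choice.inv T)" unfolding ser_hom_def ser_linear_def
    by (intro conjI allI shifts_0_cont close_idD[OF close]; rule eq)
      (simp_all add: hom_add[OF h] hom_mult[OF h] hom_one[OF h] hom_eps[OF h] hom_const_mult[OF h] hom_const[OF h] paut_f_inv[OF T])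
  moreover have "poisson (Hilbert_Choice.inv T x_ser) (Hilbert_Choice.inv T y_ser) = 1"
    by (rule paut_inj[OF T])
      (simp add: psym_poisson[OF paut_psym[OF T], symmetric] paut_f_inv[OF T] poisson_x_y hom_one[OF h])
  ultimately show ?thesis using close close_idD[OF close] by (simp add: paut_def psym_def)
qed

text \<open>The exponential of a derivation is multiplicative, and since \<open>lie H\<close> is
  also a derivation of the bracket, brackets are preserved. Applied to
  \<open>poisson x_ser y_ser = 1\<close> the latter is the Jacobian condition.\<close>

lemma exp_lie_paut: assumes H: "shifts 1 (lie H)" shows "paut (exp_lie H)"
proof -
  have cl: "close 1 (exp_lie H) (\<lambda>g. g)" by (rule exp_lie_close_id[OF H]) simp
  have s0: "shifts 0 (exp_lie H)" by (rule close_idD[OF cl])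
  have lin: "ser_linear (exp_lie H)" by (rule exp_lie_linear[OF H])
  have mult: "exp_lie H (f * g) = exp_lie H f * exp_lie H g" for f g
    by (rule exp_lie_bilinear[OF H, where B = "(*)"])
      (auto simp: linear_basic lie_def poisson_mult_left intro: filt_mult_le)
  have "exp_lie H (poisson f g) = poisson (exp_lie H f) (exp_lie H g)" for f g
  proof (rule exp_lie_bilinear[OF H, where B = poisson])
    show "lie H (poisson f g) = poisson (lie H f) g + poisson f (lie H g)" for f g
      unfolding lie_def by (rule poisson_jacobi)
  qed (auto simp: ser_linear_def poisson_add_left poisson_add_right poisson_const_mult intro: V_poisson)
  from this[of x_ser y_ser, symmetric] have "poisson (exp_lie H x_ser) (exp_lie H y_ser) = 1"
    by (simp add: poisson_x_y exp_lie_fixed lie_def)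
  then show ?thesis using cl
    by (simp add: paut_def psym_def ser_hom_def lin s0 shifts_0_cont mult exp_lie_fixed lie_def)
qed

text \<open>Naturality of flows: \<open>T\<close> preserves brackets, hence it intertwines the
  powers of \<open>lie H\<close> with those of \<open>lie (T H)\<close>.\<close>

lemma psym_exp_lie:
  assumes T: "psym T" and H: "shifts 1 (lie H)" "shifts 1 (lie (T H))"
  shows "T (exp_lie H f) = exp_lie (T H) (T f)"
proof (rule filt_eqI[of _ _ 2 3 6])
  fix n :: nat
  note lin = psym_linear[OF T]
  have pow: "T ((lie H ^^ k) f) = (lie (T H) ^^ k) (T f)" for k
    by (induction k) (simp_all add: lie_def psym_poisson[OF T, symmetric])
  let ?r = "\<lambda>H f. exp_lie H f - (\<Sum>k\<le>n. lie_term H k f)"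
  have "T (?r H f) \<in> V n"
    using shiftsD[OF psym_shifts[OF T] exp_lie_remainder_0[OF H(1), of n n f]] by simp
  then have "T (?r H f) - ?r (T H) (T f) \<in> V n"
    by (intro filt_diff exp_lie_remainder_0[OF H(2)]) auto
  then show "T (exp_lie H f) - exp_lie (T H) (T f) \<in> V n"
    by (simp add: linear_diff[OF lin] linear_sum[OF lin] lie_term_def linear_const_mult[OF lin] pow)
qed

lemma lie_psym: "psym T \<Longrightarrow> T (lie H f) = lie (T H) (T f)"
  by (simp add: lie_def psym_poisson)

text \<open>A homomorphism is controlled by its generators: the estimate \<open>P\<close> below is
  stable under products, hence passes from \<open>x\<close>, \<open>y\<close>, \<epsilon> to all
  monomials.\<close>

lemma hom_close_idI:
  assumes G: "ser_hom G" and x: "G x_ser - x_ser \<in> V (2 + q)" and y: "G y_ser - y_ser \<in> V (3 + q)"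
  shows "close q G (\<lambda>g. g)"
proof -
  have GV: "G x_ser \<in> V 2" "G y_ser \<in> V 3"
    using filt_add[OF filt_mono[OF x, of 2] x_in_V] filt_add[OF filt_mono[OF y, of 3] y_in_V] by simp_all
  have s0: "shifts 0 G"
    by (rule shiftsI, subst hom_subst_eq[OF G])
      (use subst_in_filt[OF hom_fixes_origin[OF G], of 2 3 6] GV in simp)
  define P where "P n f \<longleftrightarrow> f \<in> V n \<and> G f - f \<in> V (n + q)" for n f
  have mult: "P (n + k) (f * g)" if "P n f" "P k g" for n k f g
  proof -
    have "G (f * g) - f * g = (G f - f) * G g + f * (G g - g)" by (simp add: hom_mult[OF G] algebra_simps)
    moreover have "G g \<in> V k" using that shiftsD[OF s0, of g k] by (simp add: P_def)
    ultimately have "G (f * g) - f * g \<in> V (n + k + q)"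
      using that by (auto simp: P_def intro!: filt_add filt_mult_le[of "G f - f" _ _ _ "n + q" _ k] filt_mult_le[of f _ _ _ n _ "k + q"])
    then show ?thesis using that by (auto simp: P_def intro: filt_mult)
  qed
  have one: "P 0 1" by (simp add: P_def hom_one[OF G])
  have pow: "P (k * n) (f ^ k)" if "P n f" for n k f
    by (induction k) (use one mult[OF that] in auto)
  have gen: "P 2 x_ser" "P 3 y_ser" "P 6 eps_ser"
    using x y by (simp_all add: P_def hom_eps[OF G] x_in_V y_in_V eps_in_V)
  have "P (2 * i + 3 * j + 6 * m) (mon i j m)" for i j m
    using mult[OF mult[OF pow[OF gen(1)] pow[OF gen(2)]] pow[OF gen(3)], of i j m] by (simp add: mon_def mult.commute)
  then show ?thesis
    by (intro shifts_on_monI[OF linear_intros(2)[OF hom_linear[OF G] linear_basic(3)] shifts_diff[OF s0 shifts_id]])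
      (simp add: P_def)
qed

text \<open>\<open>G\<close> is multiplicative while \<open>1 + lie e\<close> is so only up to a
  product of two displacements. That product gains \<open>2 q\<close>, which is at least
  \<open>q + 1\<close>, so the comparison on generators again propagates to monomials.\<close>

lemma hom_close_derivationI:
  assumes G: "ser_hom G" "close q G (\<lambda>g. g)" "1 \<le> q" and e: "shifts q (lie e)"
    and x: "G x_ser - (x_ser + lie e x_ser) \<in> V (3 + q)" and y: "G y_ser - (y_ser + lie e y_ser) \<in> V (4 + q)"
  shows "close (q + 1) G (\<lambda>g. g + lie e g)"
proof -
  define D where "D f = G f - (f + lie e f)" for f
  have linD: "ser_linear D" unfolding D_def
    by (intro linear_intros(2)[OF hom_linear[OF G(1)]] linear_intros(1)[OF linear_basic(3)] linear_lie)
  have sD: "shifts 0 D"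
    using shifts_mono[OF shifts_diff[OF G(2) e], of 0] by (simp add: D_def[abs_def] algebra_simps)
  define P where "P n f \<longleftrightarrow> f \<in> V n \<and> D f \<in> V (n + (q + 1))" for n f
  have mult: "P (n + k) (f * g)" if "P n f" "P k g" for n k f g
  proof -
    have "D (f * g) = D f * g + f * D g + (G f - f) * (G g - g)"
      by (simp add: D_def hom_mult[OF G(1)] lie_def poisson_mult_left algebra_simps)
    moreover have "G f - f \<in> V (n + q)" "G g - g \<in> V (k + q)"
      using that shiftsD[OF G(2)] by (simp_all add: P_def)
    ultimately have "D (f * g) \<in> V (n + k + (q + 1))"
      using that filt_mult_le[of "D f" 2 3 6 "n + (q + 1)" g k "n + k + (q + 1)"]
        filt_mult_le[of f 2 3 6 n "D g" "k + (q + 1)" "n + k + (q + 1)"]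
        filt_mult_le[of "G f - f" 2 3 6 "n + q" "G g - g" "k + q" "n + k + (q + 1)"] G(3)
      by (simp add: P_def filt_add)
    then show ?thesis using that by (auto simp: P_def intro: filt_mult)
  qed
  have one: "P 0 1" by (simp add: P_def D_def hom_one[OF G(1)] lie_def)
  have pow: "P (k * n) (f ^ k)" if "P n f" for n k f
    by (induction k) (use one mult[OF that] in auto)
  have gen: "P 2 x_ser" "P 3 y_ser" "P 6 eps_ser"
    using filt_mono[OF x, of "2 + (q + 1)"] filt_mono[OF y, of "3 + (q + 1)"]
    by (simp_all add: P_def D_def hom_eps[OF G(1)] x_in_V y_in_V eps_in_V lie_def[of e eps_ser] add.commute)
  have "P (2 * i + 3 * j + 6 * m) (mon i j m)" for i j m
    using mult[OF mult[OF pow[OF gen(1)] pow[OF gen(2)]] pow[OF gen(3)], of i j m] by (simp add: mon_def mult.commute)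
  then have "shifts (q + 1) D" by (intro shifts_on_monI[OF linD sD]) (simp add: P_def)
  then show ?thesis by (simp add: D_def[abs_def])
qed

text \<open>To leading order the Jacobian condition says that the displacement field is divergence free,
  hence Hamiltonian.\<close>

lemma paut_leading_term:
  assumes G: "paut G" "close q G (\<lambda>g. g)" "1 \<le> q"
  obtains e where "e \<in> V (q + 5)" "close (q + 1) G (\<lambda>g. g + lie e g)"
proof -
  define a where "a = G x_ser - x_ser"
  define b where "b = G y_ser - y_ser"
  have a: "a \<in> V (q + 2)" and b: "b \<in> V (q + 3)"
    using shiftsD[OF G(2) x_in_V] shiftsD[OF G(2) y_in_V] by (simp_all add: a_def b_def add.commute)
  have "poisson (x_ser + a) (y_ser + b) = 1"
    using G(1) by (simp add: a_def b_def paut_def psym_def)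
  then have div: "ser_dx a + ser_dy b = - poisson a b"
    by (simp add: poisson_def ser_dx_add ser_dy_add algebra_simps)
  \<comment> \<open>The bracket is quadratic in the displacement and has weight at least
    \<open>(q + 2) + (q + 3) - 5 = 2 q\<close>.\<close>
  have "poisson a b \<in> V (q + 1)" by (rule V_poisson[OF a b]) (use G(3) in simp)
  then have div0: "2 * i + 3 * j + 6 * m < q + 1 \<Longrightarrow> cf (ser_dx a + ser_dy b) i j m = 0" for i j m
    unfolding div by (simp add: filtD)
  \<comment> \<open>\<open>a\<close> is integrated in \<open>y\<close>; the part of \<open>e\<close>
    without \<open>y\<close> is integrated from \<open>b\<close> at \<open>y = 0\<close>.\<close>
  define e where "e = mk_ser (\<lambda>i j m. if 0 < j then cf a i (j - 1) m / real j
     else if 0 < i then - cf b (i - 1) 0 m / real i else 0)"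
  have eV: "e \<in> V (q + 5)"
  proof (rule filtI)
    fix i j m :: nat assume "2 * i + 3 * j + 6 * m < q + 5"
    then show "cf e i j m = 0" using filtD[OF a, of i "j - 1" m] filtD[OF b, of "i - 1" 0 m]
      by (cases i; cases j) (auto simp: e_def)
  qed
  have ey: "ser_dy e = a" by (rule ser_eqI) (simp add: e_def)
  \<comment> \<open>The first component is matched exactly by \<open>e\<close>, the second one only
    up to the divergence, which \<open>div0\<close> bounds.\<close>
  have ex: "b + ser_dx e \<in> V (4 + q)"
  proof (rule filtI)
    fix i j m assume w: "2 * i + 3 * j + 6 * m < 4 + q"
    show "cf (b + ser_dx e) i j m = 0"
    proof (cases j)
      case (Suc l)
      then have "cf (ser_dx a + ser_dy b) i l m = 0" using w by (intro div0) simp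
      then have "real (Suc i) * cf a (Suc i) l m = - (real (Suc l) * cf b i (Suc l) m)" by simp
      then show ?thesis by (simp add: e_def Suc divide_simps del: of_nat_Suc)
    qed (simp add: e_def)
  qed
  have "close (q + 1) G (\<lambda>g. g + lie e g)"
    by (rule hom_close_derivationI[OF paut_hom[OF G(1)] G(2,3) shifts_lie[OF V_Vham[OF eV]]])
      (use ex in \<open>simp_all add: lie_def poisson_x_y ey a_def b_def diff_diff_eq2 diff_add_eq\<close>)
  then show ?thesis using eV that by blast
qed

section \<open>The central symmetry\<close>

definition neg :: "ser \<Rightarrow> ser" where "neg g = ser_subst g (- x_ser, - y_ser)"

lemma fixes_origin_neg: "fixes_origin (- x_ser, - y_ser)"
  by (simp add: fixes_origin_def x_ser_mon y_ser_mon cf_mon)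

lemma cf_minus_one_power: "cf ((-1) ^ k * f) i j m = (-1) ^ k * cf f i j m"
  by (cases "even k") simp_all

lemma cf_neg: "cf (neg g) i j m = (-1) ^ (i + j) * cf g i j m"
proof -
  have "(- x_ser) ^ p * (- y_ser) ^ q * eps_ser ^ r = (-1) ^ (p + q) * mon p q r" for p q r
    using power_mult_distrib[of "-1" x_ser p] power_mult_distrib[of "-1" y_ser q]
    by (simp add: mon_def power_add)
  then have "cf (neg g) i j m = (\<Sum>t\<in>simplex3 (i + j + m). if t = (i, j, m) then (-1) ^ (i + j) * cf g i j m else 0)"
    unfolding neg_def cf_subst[OF fixes_origin_neg order_refl]
    by (intro sum.cong) (auto simp: cf_minus_one_power cf_mon split: if_splits)
  then show ?thesis by simp
qed

lemma neg_neg [simp]: "neg (neg g) = g"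
  by (rule ser_eqI) (simp add: cf_neg)

lemma neg_hom: "ser_hom neg"
  using hom_subst[OF fixes_origin_neg] by (simp add: neg_def[abs_def])

lemma neg_xy: "neg x_ser = - x_ser" "neg y_ser = - y_ser"
  by (simp_all add: neg_def subst_x subst_y fixes_origin_neg)

lemma neg_shifts: "shifts 0 neg"
  by (rule shiftsI, rule filtI) (simp add: cf_neg filtD)

lemma neg_psym: "psym neg"
  by (simp add: psym_def neg_hom neg_shifts neg_xy poisson_uminus_left poisson_uminus_right poisson_x_y)

lemma neg_Vham: "f \<in> Vham n \<Longrightarrow> neg f \<in> Vham n"
  by (simp add: Vham_def cf_neg)

text \<open>Appears when the central symmetry is moved past \<open>T\<close>: an equation
  \<open>M (neg (T g)) = T (N (neg g))\<close> for all \<open>g\<close> becomes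
  \<open>M (flip T g) = T (N g)\<close>.\<close>

definition flip :: "(ser \<Rightarrow> ser) \<Rightarrow> ser \<Rightarrow> ser" where
  "flip T g = neg (T (neg g))"

lemma flip_close: "close q A B \<Longrightarrow> close q (flip A) (flip B)"
  unfolding flip_def
  using close_comp_left[OF psym_linear[OF neg_psym] neg_shifts close_comp_right[OF _ neg_shifts, of q A B q]]
  by simp

lemma flip_paut: "paut T \<Longrightarrow> paut (flip T)"
proof -
  assume T: "paut T"
  have "close 1 (flip T) (\<lambda>g. g)"
    using flip_close[OF paut_close[OF T]] by (simp add: flip_def)
  moreover have "psym (flip T)"
    unfolding flip_def[abs_def] by (intro psym_comp[OF neg_psym] psym_comp[OF _ neg_psym] paut_psym[OF T])
  ultimately show ?thesis by (simp add: paut_def)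
qed

lemma flip_exp_lie: "shifts 1 (lie H) \<Longrightarrow> flip (exp_lie H) g = exp_lie (neg H) g"
  unfolding flip_def by (subst psym_exp_lie[OF neg_psym])
    (simp_all add: shifts_lie_iff neg_Vham[where n = 6, simplified] flip: One_nat_def)

lemma flip_lie: "flip (lie e) g = lie (neg e) g"
  unfolding flip_def by (subst lie_psym[OF neg_psym]) simp

section \<open>Uniqueness of the normal form\<close>

text \<open>A first-order term is insensitive to a unipotent factor up to one more weight, so
  first-order terms of a composition simply add, here and in the next lemma.\<close>

lemma close_near_id_right:
  assumes T: "close (q + 1) T (\<lambda>g. g + L g)" and L: "ser_linear L" "shifts q L"
    and E: "close 1 E (\<lambda>g. g)"
  shows "close (q + 1) (\<lambda>g. T (E g)) (\<lambda>g. E g + L g)"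
proof (rule close_trans)
  show "close (q + 1) (\<lambda>g. T (E g)) (\<lambda>g. E g + L (E g))"
    using close_comp_right[OF T close_idD[OF E]] by simp
  show "close (q + 1) (\<lambda>g. E g + L (E g)) (\<lambda>g. E g + L g)"
    using close_add[OF close_refl close_comp_left[OF L E]] by simp
qed

lemma close_near_id_left:
  assumes T: "close (q + 1) T (\<lambda>g. g + L g)" and L: "shifts q L"
    and E: "ser_linear E" "close 1 E (\<lambda>g. g)"
  shows "close (q + 1) (\<lambda>g. E (T g)) (\<lambda>g. E g + L g)"
proof (rule close_trans)
  show "close (q + 1) (\<lambda>g. E (T g)) (\<lambda>g. E g + E (L g))"
    using close_comp_left[OF E(1) close_idD[OF E(2)] T, of "q + 1"] by (simp add: linear_add[OF E(1)])
  have "close (q + 1) (\<lambda>g. E (L g)) (\<lambda>g. L g)"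
    by (rule close_comp_right[OF E(2) L]) simp
  then show "close (q + 1) (\<lambda>g. E g + E (L g)) (\<lambda>g. E g + L g)"
    by (rule close_add[OF close_refl])
qed

lemma exp_lie_close_derivation:
  assumes "shifts q (lie e)" "1 \<le> q" shows "close (q + 1) (exp_lie e) (\<lambda>g. g + lie e g)"
  using shifts_mono[OF exp_lie_close_linear[OF assms], of "q + 1"] assms(2) by simp

text \<open>Comparing the parts of even and odd parity in the conjugacy equation separately.\<close>

lemma conjugacy_leading_term:
  assumes T: "paut T" "close q T (\<lambda>g. g)" "1 \<le> q"
    and h: "shifts 1 (lie h)" "neg h = h" and k: "shifts 1 (lie k)" "neg k = k"
    and hk: "shifts q (lie (k - h))"
    and eq: "\<And>g. T (exp_lie h g) = exp_lie k (flip T g)"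
  obtains e where "e \<in> V (q + 5)" "neg e = e" "close (q + 1) T (\<lambda>g. g + lie e g)" "k - h \<in> Vham (q + 6)"
proof -
  obtain e where e: "e \<in> V (q + 5)" "close (q + 1) T (\<lambda>g. g + lie e g)"
    using paut_leading_term[OF T] by blast
  let ?E = "exp_lie h" and ?d = "k - h"
  have lie_e: "shifts q (lie e)" "shifts q (lie (neg e))"
    using V_Vham[OF e(1)] neg_Vham by (auto intro: shifts_lie)
  have E: "close 1 ?E (\<lambda>g. g)" "ser_linear ?E"
    using exp_lie_paut[OF h(1)] by (simp_all add: paut_close[simplified] paut_linear)
  have fT: "close (q + 1) (flip T) (\<lambda>g. g + lie (neg e) g)"
    using flip_close[OF e(2)] flip_lie[of e] by (simp add: flip_def hom_add[OF neg_hom])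
  have 1: "close (q + 1) (\<lambda>g. T (?E g)) (\<lambda>g. ?E g + lie e g)"
    by (rule close_near_id_right[OF e(2) linear_lie lie_e(1) E(1)])
  have "close (q + 1) (exp_lie k) (\<lambda>g. ?E g + lie ?d g)"
    using exp_lie_perturb[OF h(1) hk T(3)] by simp
  from close_comp_right[OF this paut_shifts[OF flip_paut[OF T(1)]]]
  have 2: "close (q + 1) (\<lambda>g. exp_lie k (flip T g)) (\<lambda>g. ?E (flip T g) + lie ?d (flip T g))" by simp
  have 3: "close (q + 1) (\<lambda>g. ?E (flip T g)) (\<lambda>g. ?E g + lie (neg e) g)"
    by (rule close_near_id_left[OF fT lie_e(2) E(2,1)])
  have 4: "close (q + 1) (\<lambda>g. lie ?d (flip T g)) (lie ?d)"
    by (rule close_comp_left[OF linear_lie hk paut_close[OF flip_paut[OF T(1)]]]) simp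
  have "close (q + 1) (\<lambda>g. ?E g + lie e g) (\<lambda>g. (?E g + lie (neg e) g) + lie ?d g)"
    using close_trans[OF close_sym[OF 1], OF close_trans[OF _ close_add[OF 3 4]], OF 2[folded eq]] .
  moreover have "(\<lambda>g. ?E g + lie e g - (?E g + lie (neg e) g + lie ?d g)) = lie (e - neg e - ?d)"
    by (rule ext, simp only: lie_diff) (simp only: algebra_simps)
  ultimately have "shifts (q + 1) (lie (e - neg e - ?d))" by simp
  then have *: "e - neg e - ?d \<in> Vham (q + 6)" by (simp add: shifts_lie_iff add.commute)
  have "(-1) ^ (i + j) * cf ?d i j m = cf ?d i j m" for i j m
    unfolding cf_neg[symmetric] using h(2) k(2) by (simp add: hom_diff[OF neg_hom])
  then have d: "odd (i + j) \<Longrightarrow> cf ?d i j m = 0" for i j m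
    by (metis (no_types) minus_one_power_iff mult_minus1 neg_equal_zero)
  have d0: "cf ?d i j m = 0" if "0 < i + j" "2 * i + 3 * j + 6 * m < q + 6" for i j m
  proof (cases "even (i + j)")
    case True
    have "cf (e - neg e - ?d) i j m = 0" using * that unfolding Vham_def by blast
    then show ?thesis using True by (simp add: cf_neg)
  qed (rule d)
  then have dV: "?d \<in> Vham (q + 6)" by (simp add: Vham_def)
  \<comment> \<open>\<open>e\<close> is so far even only up to higher weight. Exact evenness is
    wanted so that its flow commutes with \<open>neg\<close>, and dropping the odd part does not
    change the leading term.\<close>
  define e' where "e' = const_ser (1 / 2) * (e + neg e)"
  have "cf (e - neg e) i j m = 0 \<Longrightarrow> cf (e - e') i j m = 0" for i j m
    by (simp add: e'_def)
  moreover have "e - neg e \<in> Vham (q + 6)" using Vham_add[OF * dV] by simp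
  ultimately have "e - e' \<in> Vham (q + 6)" unfolding Vham_def by blast
  then have "close (q + 1) (lie e) (lie e')"
    using shifts_lie[of "e - e'" "q + 1"] by (simp add: lie_diff[abs_def] add.commute)
  then have "close (q + 1) (\<lambda>g. g + lie e g) (\<lambda>g. g + lie e' g)" by (rule close_add[OF close_refl])
  then have "close (q + 1) T (\<lambda>g. g + lie e' g)" by (rule close_trans[OF e(2)])
  moreover have "neg e' = e'"
    by (simp add: e'_def hom_const_mult[OF neg_hom] hom_add[OF neg_hom] add.commute)
  moreover have "e' \<in> V (q + 5)"
    using shiftsD[OF neg_shifts e(1)] e(1) by (simp add: e'_def filt_add filt_const_mult)
  ultimately show ?thesis using dV that by blast
qed

lemma flip_inv_exp_lie:
  assumes e: "shifts 1 (lie e)" "neg e = e"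
  shows "neg (Hilbert_Choice.inv (exp_lie e) g) = Hilbert_Choice.inv (exp_lie e) (neg g)"
proof (rule paut_inj[OF exp_lie_paut[OF e(1)]])
  let ?S = "exp_lie e"
  have "?S (neg u) = neg (?S u)" for u
    using flip_exp_lie[OF e(1), of "neg u"] e(2) by (simp add: flip_def)
  then show "?S (neg (Hilbert_Choice.inv ?S g)) = ?S (Hilbert_Choice.inv ?S (neg g))"
    by (simp add: paut_f_inv[OF exp_lie_paut[OF e(1)]])
qed

text \<open>As \<open>e\<close> is even, \<open>S\<close> commutes with \<open>neg\<close>. The
  twisted equation therefore keeps its shape when \<open>S\<close> is applied, and only
  \<open>k\<close> is transported to \<open>S k\<close>.\<close>

lemma conjugacy_split:
  fixes e defines "S \<equiv> Hilbert_Choice.inv (exp_lie e)"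
  assumes T: "paut T" "close (q + 1) T (\<lambda>g. g + lie e g)" "1 \<le> q"
    and e: "e \<in> V (q + 5)" "neg e = e" and k: "k \<in> V 6"
    and eq: "\<And>g. T (exp_lie h g) = exp_lie k (flip T g)"
  shows "paut (\<lambda>g. S (T g))" "close (q + 1) (\<lambda>g. S (T g)) (\<lambda>g. g)"
    "S (T (exp_lie h g)) = exp_lie (S k) (flip (\<lambda>g. S (T g)) g)"
proof -
  have sq: "shifts q (lie e)" by (rule shifts_lie[OF V_Vham[OF e(1)]])
  have s1: "shifts 1 (lie e)" by (rule shifts_mono[OF sq T(3)])
  note X = exp_lie_paut[OF s1]
  have S: "paut S" unfolding S_def by (rule paut_inv[OF X])
  show "paut (\<lambda>g. S (T g))" by (rule paut_comp[OF S T(1)])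
  have "close (q + 1) T (exp_lie e)"
    by (rule close_trans[OF T(2) close_sym[OF exp_lie_close_derivation[OF sq T(3)]]])
  from close_comp_left[OF paut_linear[OF S] paut_shifts[OF S] this, of "q + 1"]
  show "close (q + 1) (\<lambda>g. S (T g)) (\<lambda>g. g)" by (simp add: S_def paut_inv_f[OF X])
  have V6: "shifts 1 (lie u)" if "u \<in> V 6" for u
    using shifts_lie[of u 1] V_Vham[OF that] by simp
  have "S k \<in> V 6" using shiftsD[OF paut_shifts[OF S] k] by simp
  then have "S (exp_lie k (flip T g)) = exp_lie (S k) (S (flip T g))"
    by (intro psym_exp_lie paut_psym[OF S] V6 k)
  moreover have "S (flip T g) = flip (\<lambda>g. S (T g)) g"
    using flip_inv_exp_lie[OF s1 e(2)] by (simp add: flip_def S_def)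
  ultimately show "S (T (exp_lie h g)) = exp_lie (S k) (flip (\<lambda>g. S (T g)) g)"
    by (simp add: eq)
qed

text \<open>The Hamiltonians \<open>ham u\<close> without monomials in \<epsilon> alone. For even
  positive powers of \<open>x\<close>, weight at least 7 excludes exactly \<open>x\<^sup>2\<close>
  at \<epsilon> = 0, as does the condition \<open>k + 2 * m \<ge> 2\<close>.\<close>

definition nform :: "ser \<Rightarrow> bool" where
  "nform h \<longleftrightarrow> h - const_ser (1 / 2) * y_ser ^ 2 \<in> V 7 \<and>
     (\<forall>i j m. cf (h - const_ser (1 / 2) * y_ser ^ 2) i j m \<noteq> 0 \<longrightarrow> j = 0 \<and> even i \<and> 0 < i)"

lemma y2_mon: "y_ser ^ 2 = mon 0 2 0"
  by (simp add: mon_def)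

lemma y2_in_V: "const_ser (1 / 2) * y_ser ^ 2 \<in> V 6"
  by (rule filtI) (auto simp: y2_mon cf_mon)

lemma nform_V6: assumes "nform h" shows "h \<in> V 6"
proof -
  have "h - const_ser (1 / 2) * y_ser ^ 2 \<in> V 6" using assms by (auto simp: nform_def intro: filt_mono)
  from filt_add[OF this y2_in_V] show ?thesis by simp
qed

lemma nform_shifts: "nform h \<Longrightarrow> shifts 1 (lie h)"
  using shifts_lie[of h 1] V_Vham[OF nform_V6] by simp

lemma nform_neg: assumes "nform h" shows "neg h = h"
proof (rule ser_eqI)
  fix i j m
  have "cf h i j m = 0" if odd: "odd (i + j)"
  proof (rule ccontr)
    assume "cf h i j m \<noteq> 0"
    moreover have "cf (const_ser (1 / 2) * y_ser ^ 2) i j m = 0" using odd by (auto simp: y2_mon cf_mon)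
    ultimately have "cf (h - const_ser (1 / 2) * y_ser ^ 2) i j m \<noteq> 0" by (simp only: cf_diff)
    then have "j = 0 \<and> even i" using assms unfolding nform_def by blast
    then show False using odd by simp
  qed
  then show "cf (neg h) i j m = cf h i j m" by (cases "even (i + j)") (simp_all add: cf_neg)
qed

lemma nform_diff: assumes "nform h" "nform k" "cf (k - h) i j m \<noteq> 0" shows "j = 0" "0 < i"
proof -
  let ?y = "const_ser (1 / 2) * y_ser ^ 2"
  have "cf (k - ?y) i j m \<noteq> 0 \<or> cf (h - ?y) i j m \<noteq> 0" using assms(3) by auto
  then show "j = 0" "0 < i" using assms(1,2) unfolding nform_def by metis+
qed

lemma cf_y_mult: "cf (y_ser * f) i j m = (if j = 0 then 0 else cf f i (j - 1) m)"
proof -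
  have "fps_nth (fps_const fps_X * f) m = fps_X * fps_nth f m" by simp
  then show ?thesis by (simp add: y_ser_def cf_def)
qed

text \<open>Source of the homological operator \<open>y \<partial>\<^sub>x\<close> in both halves of
  the proof: to first order the inverse flow subtracts \<open>lie e k\<close>, and the leading part
  \<open>y\<^sup>2 / 2\<close> of \<open>k\<close> contributes
  \<open>- y \<partial>\<^sub>x e\<close> to it.\<close>

lemma inv_exp_lie_nform:
  assumes k: "nform k" and e: "e \<in> V (q + 5)" and q: "1 \<le> q"
  shows "Hilbert_Choice.inv (exp_lie e) k - k - y_ser * ser_dx e \<in> V (q + 7)"
proof -
  note k6 = nform_V6[OF k]
  have sq: "shifts q (lie e)" by (rule shifts_lie[OF V_Vham[OF e]])
  have s1: "shifts 1 (lie e)" by (rule shifts_mono[OF sq q])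
  define S where "S = Hilbert_Choice.inv (exp_lie e)"
  have S: "paut S" unfolding S_def by (rule paut_inv[OF exp_lie_paut[OF s1]])
  have Sk6: "S k \<in> V 6" using shiftsD[OF paut_shifts[OF S] k6] by simp
  have Skk: "S k - k \<in> V (6 + q)"
    unfolding S_def by (rule shiftsD[OF paut_inv_close[OF exp_lie_paut[OF s1] exp_lie_close_id[OF sq q]] k6])
  have "exp_lie e (S k) = k" by (simp add: S_def paut_f_inv[OF exp_lie_paut[OF s1]])
  then have 1: "k - (S k + lie e (S k)) \<in> V (6 + (q + 1))"
    using shiftsD[OF exp_lie_close_derivation[OF sq q] Sk6] by simp
  have 2: "lie e (S k - k) \<in> V (6 + (q + 1))"
    by (rule shiftsD_le[OF sq Skk]) (use q in simp)
  have 3: "lie e (k - const_ser (1 / 2) * y_ser ^ 2) \<in> V (6 + (q + 1))"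
    using shiftsD[OF sq, of _ 7] k by (simp add: nform_def)
  have "- (k - (S k + lie e (S k))) - lie e (S k - k) - lie e (k - const_ser (1 / 2) * y_ser ^ 2) \<in> V (6 + (q + 1))"
    by (rule filt_diff[OF filt_diff[OF filt_uminus[OF 1] 2] 3])
  moreover have half: "const_ser (1 / 2) * (u + u) = u" for u
    by (rule ser_eqI) (simp only: cf_const_mult cf_add, simp)
  have "lie e (const_ser (1 / 2) * y_ser ^ 2) = - (y_ser * ser_dx e)"
    using half[of "y_ser * ser_dx e"]
    by (simp add: lie_def poisson_const_mult power2_eq_square poisson_mult_left poisson_x_y algebra_simps)
  ultimately have "S k - k - y_ser * ser_dx e \<in> V (q + 7)"
    by (simp add: linear_diff[OF linear_lie] algebra_simps)
  then show ?thesis by (simp add: S_def)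
qed

lemma normal_form_step:
  assumes h: "nform h" and k: "nform k" and T: "paut T" "close q T (\<lambda>g. g)" "1 \<le> q"
    and hk: "k - h \<in> V (q + 5)"
    and eq: "\<And>g. T (exp_lie h g) = exp_lie k (flip T g)"
  shows "k - h \<in> V (q + 6) \<and> (\<exists>T'. paut T' \<and> close (q + 1) T' (\<lambda>g. g) \<and>
    (\<forall>g. T' (exp_lie h g) = exp_lie k (flip T' g)))"
proof -
  obtain e where e: "e \<in> V (q + 5)" "neg e = e" and Te: "close (q + 1) T (\<lambda>g. g + lie e g)"
    and "k - h \<in> Vham (q + 6)"
    by (rule conjugacy_leading_term[OF T nform_shifts[OF h] nform_neg[OF h] nform_shifts[OF k] nform_neg[OF k]
        shifts_lie[OF V_Vham[OF hk]] eq])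
  then have "2 * i + 3 * j + 6 * m < q + 6 \<Longrightarrow> 0 < i \<Longrightarrow> cf (k - h) i j m = 0" for i j m
    unfolding Vham_def by blast
  \<comment> \<open>\<open>Vham\<close> says nothing about monomials in \<epsilon> alone, but a
    difference of normal forms has none.\<close>
  then have hk': "k - h \<in> V (q + 6)"
    using nform_diff(2)[OF h k] by (metis filtI)
  note k6 = nform_V6[OF k]
  have sq: "shifts q (lie e)" by (rule shifts_lie[OF V_Vham[OF e(1)]])
  have s1: "shifts 1 (lie e)" by (rule shifts_mono[OF sq T(3)])
  define S where "S = Hilbert_Choice.inv (exp_lie e)"
  note split = conjugacy_split[OF T(1) Te T(3) e k6 eq, folded S_def]
  have S: "paut S" unfolding S_def by (rule paut_inv[OF exp_lie_paut[OF s1]])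
  have Sk6: "S k \<in> V 6" using shiftsD[OF paut_shifts[OF S] k6] by simp
  have Sk: "S k - k - y_ser * ser_dx e \<in> V (q + 7)"
    unfolding S_def by (rule inv_exp_lie_nform[OF k e(1) T(3)])
  have "y_ser * ser_dx e \<in> V (q + 6)"
    using filt_mult_le[OF y_in_V V_dx[OF e(1)], of "q + 6"] by simp
  then have "(S k - k - y_ser * ser_dx e) + y_ser * ser_dx e + (k - h) \<in> V (q + 6)"
    by (intro filt_add hk' filt_mono[OF Sk]) auto
  then have Skh: "S k - h \<in> Vham (q + 1 + 5)" by (intro V_Vham) (simp add: add.commute)
  have negSk: "neg (S k) = S k" unfolding S_def by (simp add: flip_inv_exp_lie[OF s1 e(2)] nform_neg[OF k])
  \<comment> \<open>Second application, one weight further. \<open>S k\<close> need not be a normal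
    form; what is asked for here is that it is even and raises weights.\<close>
  have "S k - h \<in> Vham (q + 1 + 6)"
    by (rule conjugacy_leading_term[OF split(1,2) _ nform_shifts[OF h] nform_neg[OF h] _ negSk shifts_lie[OF Skh] split(3)])
      (use shifts_lie[of "S k" 1] V_Vham[OF Sk6] in simp_all)
  from Vham_diff[OF this V_Vham[of _ "q + 1 + 6"], of "S k - k - y_ser * ser_dx e"] Sk
  have hom: "(k - h) + y_ser * ser_dx e \<in> Vham (q + 7)" by (simp add: algebra_simps)
  \<comment> \<open>The operator \<open>y \<partial>\<^sub>x\<close> sends
    \<open>x\<^sup>i y\<^sup>j\<close> to a multiple of a monomial that contains \<open>y\<close>,
    which cannot be compensated by \<open>k - h\<close>.\<close>
  have e0: "cf e i j m = 0" if "0 < i" "2 * i + 3 * j + 6 * m < q + 6" for i j m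
  proof -
    have "cf (k - h) (i - 1) (Suc j) m = 0" using nform_diff(1)[OF h k] by blast
    moreover have "2 * (i - 1) + 3 * Suc j + 6 * m < q + 7" using that by simp
    then have "cf (k - h + y_ser * ser_dx e) (i - 1) (Suc j) m = 0"
      using hom unfolding Vham_def by blast
    ultimately have "cf (y_ser * ser_dx e) (i - 1) (Suc j) m = 0" by (simp only: cf_add)
    then show ?thesis using that by (simp add: cf_y_mult)
  qed
  have e_odd: "cf e 0 j m = 0" if "odd j" for j m
    using cf_neg[of e 0 j m] e(2) that by simp
  \<comment> \<open>The exponents of \<open>(y\<^sup>2)\<^sup>l \<epsilon>\<^sup>m\<close> of weight
    exactly \<open>q + 5\<close>. There are none for most \<open>q\<close>, and then
    \<open>f\<close> is 0.\<close>
  define I where "I = {(l, m). 6 * l + 6 * m = q + 5}"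
  have fin: "finite I" by (rule finite_subset[of _ "{..q + 5} \<times> {..q + 5}"]) (auto simp: I_def)
  define f where "f = (\<Sum>(l, m)\<in>I. const_ser (cf e 0 (2 * l) m) * ((const_ser 2 * k) ^ l * eps_ser ^ m))"
  define f0 where "f0 = (\<Sum>(l, m)\<in>I. const_ser (cf e 0 (2 * l) m) * mon 0 (2 * l) m)"
  have "f0 - e \<in> V (q + 6)"
  proof (rule filtI)
    fix i j m assume w: "2 * i + 3 * j + 6 * m < q + 6"
    have "cf f0 i j m = (\<Sum>t\<in>I. if t = (j div 2, m) then (if i = 0 \<and> even j then cf e 0 j m else 0) else 0)"
      unfolding f0_def cf_sum
    proof (rule sum.cong[OF refl], clarify)
      fix l m'
      have "j = 2 * l \<longleftrightarrow> l = j div 2 \<and> even j" by auto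
      then show "cf (const_ser (cf e 0 (2 * l) m') * mon 0 (2 * l) m') i j m =
          (if (l, m') = (j div 2, m) then if i = 0 \<and> even j then cf e 0 j m else 0 else 0)"
        by (simp add: cf_mon)
    qed
    also have "\<dots> = (if (j div 2, m) \<in> I \<and> i = 0 \<and> even j then cf e 0 j m else 0)"
      by (simp add: fin)
    also have "\<dots> = cf e i j m"
    proof (cases "i = 0 \<and> even j")
      case True
      then have "6 * (j div 2) = 3 * j" by auto
      then have "(j div 2, m) \<in> I \<longleftrightarrow> 3 * j + 6 * m = q + 5" unfolding I_def by simp presburger
      then show ?thesis using True w filtD[OF e(1), of 0 j m] by auto
    next
      case False
      then have "cf e i j m = 0" using e0[OF _ w] e_odd[of j m] by (cases "i = 0") auto
      with False show ?thesis by auto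
    qed
    finally show "cf (f0 - e) i j m = 0" by simp
  qed
  moreover have "f - f0 \<in> V (q + 6)"
  proof -
    let ?k = "const_ser 2 * k"
    have k2: "?k - y_ser ^ 2 \<in> V 7"
    proof -
      have "const_ser 2 * (k - const_ser (1 / 2) * y_ser ^ 2) \<in> V 7"
        using k by (simp add: nform_def filt_const_mult)
      moreover have "const_ser 2 * (k - const_ser (1 / 2) * y_ser ^ 2) = ?k - y_ser ^ 2"
        by (rule ser_eqI) simp
      ultimately show ?thesis by simp
    qed
    have y2: "y_ser ^ 2 \<in> V 6" using filt_power[OF y_in_V, of 2] by simp
    have pow: "?k ^ l - (y_ser ^ 2) ^ l \<in> V (6 * l + 1)" for l
    proof (induction l)
      case (Suc l)
      have "?k ^ Suc l - (y_ser ^ 2) ^ Suc l = ?k * (?k ^ l - (y_ser ^ 2) ^ l) + (?k - y_ser ^ 2) * (y_ser ^ 2) ^ l"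
        by (simp add: algebra_simps)
      also have "\<dots> \<in> V (6 * Suc l + 1)"
        using filt_mult_le[OF filt_const_mult[OF k6] Suc, of "6 * Suc l + 1"]
          filt_mult_le[OF k2 filt_power[OF y2], of "6 * Suc l + 1" l]
        by (intro filt_add) auto
      finally show ?case .
    qed simp
    have mon: "mon 0 (2 * l) m = (y_ser ^ 2) ^ l * eps_ser ^ m" for l m
      by (simp add: mon_def power_mult)
    have "f - f0 = (\<Sum>(l, m)\<in>I. const_ser (cf e 0 (2 * l) m) * ((?k ^ l - (y_ser ^ 2) ^ l) * eps_ser ^ m))"
      unfolding f_def f0_def sum_subtractf[symmetric]
      by (rule sum.cong) (simp_all only: mon case_prod_unfold left_diff_distrib right_diff_distrib)
    also have "\<dots> \<in> V (q + 6)"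
    proof (rule filt_sum)
      fix t assume "t \<in> I"
      then obtain l m where t: "t = (l, m)" "6 * l + 6 * m = q + 5" by (auto simp: I_def)
      have "(?k ^ l - (y_ser ^ 2) ^ l) * eps_ser ^ m \<in> V (q + 6)"
        using filt_mult_le[OF pow[of l] filt_power[OF eps_in_V, of m], of "q + 6"] t(2) by simp
      then show "(case t of (l, m) \<Rightarrow> const_ser (cf e 0 (2 * l) m) * ((?k ^ l - (y_ser ^ 2) ^ l) * eps_ser ^ m)) \<in> V (q + 6)"
        by (simp add: t filt_const_mult)
    qed
    finally show ?thesis .
  qed
  ultimately have fe: "f - e \<in> V (q + 6)" using filt_add by fastforce
  have f5: "f \<in> V (q + 5)"
    using filt_add[OF filt_mono[OF fe, of "q + 5"] e(1)] by simp
  have negf: "neg f = f" unfolding f_def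
    by (simp add: linear_sum[OF hom_linear[OF neg_hom]] case_prod_unfold hom_const[OF neg_hom]
        hom_mult[OF neg_hom] hom_power[OF neg_hom] hom_eps[OF neg_hom] nform_neg[OF k])
  have "close (q + 1) (lie e) (lie f)"
    using shifts_lie[OF V_Vham, of "e - f" "q + 1"] filt_uminus[OF fe] by (simp add: lie_diff[abs_def] add.commute)
  then have Tf: "close (q + 1) T (\<lambda>g. g + lie f g)"
    using close_trans[OF Te close_add[OF close_refl]] by blast
  have lin: "ser_linear (poisson k)" 
    by (simp add: ser_linear_def poisson_add_right poisson_const_mult)
  have "poisson u v = 0 \<Longrightarrow> poisson u (v ^ l) = 0" for u v l
    by (induction l) (simp_all add: poisson_mult_right)
  then have pk_pow: "poisson k ((const_ser 2 * k) ^ l) = 0" and pk_eps: "poisson k (eps_ser ^ l) = 0" for l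
    by (simp_all add: poisson_const_mult)
  have "lie f k = 0" unfolding lie_def f_def
    unfolding linear_sum[OF lin]
    by (intro sum.neutral) (auto simp: poisson_const_mult pk_pow poisson_mult_right[of k _ "eps_ser ^ m" for m] pk_eps)
  then have "exp_lie f k = k" by (rule exp_lie_fixed)
  moreover have "paut (exp_lie f)"
    by (rule exp_lie_paut, rule shifts_mono[OF shifts_lie[OF V_Vham[OF f5]] T(3)])
  ultimately have "Hilbert_Choice.inv (exp_lie f) k = k" using paut_inv_f by metis
  then show ?thesis
    using conjugacy_split[OF T(1) Tf T(3) f5 negf k6 eq] hk' by auto
qed

lemma normal_form_unique:
  assumes h: "nform h" and k: "nform k" and T: "paut T"
    and eq: "\<And>g. T (exp_lie h g) = exp_lie k (flip T g)"
  shows "h = k"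
proof -
  have "k - h \<in> V (n + 6) \<and> (\<exists>T'. paut T' \<and> close (n + 1) T' (\<lambda>g. g) \<and>
    (\<forall>g. T' (exp_lie h g) = exp_lie k (flip T' g)))" for n
  proof (induction n)
    case 0
    show ?case using filt_diff[OF nform_V6[OF k] nform_V6[OF h]] T eq paut_close[OF T] by auto
  next
    case (Suc n)
    then show ?case using normal_form_step[OF h k, of _ "n + 1"] by (simp add: add.commute) blast
  qed
  then have "k - h \<in> V n" for n using filt_mono[of "k - h" 2 3 6 "n + 6" n] by simp
  then show ?thesis using filt_eqI by metis
qed

section \<open>Existence of the normal form\<close>

text \<open>With \<open>S\<close> generated by half of \<open>ob\<close>, the left side receives
  \<open>- ob / 2\<close> through \<open>flip S\<close> and the right side \<open>+ ob / 2\<close>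
  through \<open>S\<close>, which together account for \<open>ob\<close>. The even term
  \<open>a\<close> is moved into the Hamiltonian at the same time.\<close>

lemma odd_part_step:
  fixes ob :: ser
  defines "S \<equiv> exp_lie (const_ser (1 / 2) * ob)"
  assumes M: "close (q + 1) M (\<lambda>g. exp_lie h g + lie (ob + a) g)" "1 \<le> q"
    and h: "shifts 1 (lie h)" and ob: "ob \<in> V (q + 5)" "neg ob = - ob" and a: "a \<in> Vham (q + 5)"
  shows "close (q + 1) (\<lambda>g. M (flip S g)) (\<lambda>g. S (exp_lie (h + a) g))"
proof -
  let ?c = "const_ser (1 / 2) * ob" and ?E = "exp_lie h"
  have c: "?c \<in> V (q + 5)" by (rule filt_const_mult[OF ob(1)])
  have sc: "shifts q (lie ?c)" "shifts q (lie (- ?c))"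
    using shifts_lie[OF V_Vham[OF c]] shifts_lie[OF V_Vham[OF filt_uminus[OF c]]] by simp_all
  have sa: "shifts q (lie a)" by (rule shifts_lie[OF a])
  have soa: "shifts q (lie (ob + a))"
    using shifts_add[OF shifts_lie[OF V_Vham[OF ob(1)]] sa] by (simp add: lie_add[abs_def])
  have E: "paut ?E" by (rule exp_lie_paut[OF h])
  have S: "paut S" unfolding S_def by (rule exp_lie_paut[OF shifts_mono[OF sc(1) M(2)]])
  have S1: "close (q + 1) S (\<lambda>g. g + lie ?c g)"
    unfolding S_def by (rule exp_lie_close_derivation[OF sc(1) M(2)])
  have "flip S = exp_lie (- ?c)"
    unfolding S_def using flip_exp_lie[OF shifts_mono[OF sc(1) M(2)]]
    by (auto simp: hom_const_mult[OF neg_hom] ob(2))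
  then have fS: "close (q + 1) (flip S) (\<lambda>g. g + lie (- ?c) g)"
    using exp_lie_close_derivation[OF sc(2) M(2)] by simp
  have l1: "close (q + 1) (\<lambda>g. M (flip S g)) (\<lambda>g. ?E (flip S g) + lie (ob + a) (flip S g))"
    using close_comp_right[OF M(1) paut_shifts[OF flip_paut[OF S]]] by simp
  have l2: "close (q + 1) (\<lambda>g. ?E (flip S g)) (\<lambda>g. ?E g + lie (- ?c) g)"
    by (rule close_near_id_left[OF fS sc(2) paut_linear[OF E] paut_close[OF E]])
  have l3: "close (q + 1) (\<lambda>g. lie (ob + a) (flip S g)) (lie (ob + a))"
    by (rule close_comp_left[OF linear_lie soa paut_close[OF flip_paut[OF S]]]) simp
  have ha: "close (q + 1) (exp_lie (h + a)) (\<lambda>g. ?E g + lie a g)"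
    by (rule exp_lie_perturb[OF h sa M(2)])
  have sha: "shifts 1 (lie (h + a))"
    using shifts_add[OF h shifts_mono[OF sa M(2)]] by (simp add: lie_add[abs_def])
  have r1: "close (q + 1) (\<lambda>g. S (exp_lie (h + a) g)) (\<lambda>g. exp_lie (h + a) g + lie ?c g)"
    by (rule close_near_id_right[OF S1 linear_lie sc(1) paut_close[OF exp_lie_paut[OF sha]]])
  have "ob = ?c + ?c" by (rule ser_eqI) (simp only: cf_add cf_const_mult)
  then have "lie ob g = lie ?c g + lie ?c g" for g by (metis lie_add)
  then have "(?E g + lie (- ?c) g) + lie (ob + a) g = (?E g + lie a g) + lie ?c g" for g
    by (simp add: lie_add lie_uminus)
  with close_trans[OF l1 close_add[OF l2 l3]]
  have "close (q + 1) (\<lambda>g. M (flip S g)) (\<lambda>g. (?E g + lie a g) + lie ?c g)" by (simp only:)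
  moreover have "close (q + 1) (\<lambda>g. (?E g + lie a g) + lie ?c g) (\<lambda>g. S (exp_lie (h + a) g))"
    by (rule close_sym[OF close_trans[OF r1 close_add[OF ha close_refl]]])
  ultimately show ?thesis by (rule close_trans)
qed

text \<open>For even \<open>c\<close> the twist disappears, and conjugation by \<open>S\<close>
  carries \<open>exp_lie h\<close> exactly to the flow of the transported Hamiltonian. So nothing
  happens at the weight of \<open>c\<close> itself, and the first change is
  \<open>y \<partial>\<^sub>x c\<close> one weight later. Since \<open>c\<close> raises weights by
  \<open>q - 1\<close> only, unipotence of \<open>S\<close> requires
  \<open>2 \<le> q\<close>.\<close>

lemma even_part_step:
  fixes c :: ser
  defines "S \<equiv> exp_lie c"
  assumes M: "close (q + 1) M (\<lambda>g. exp_lie h g + lie e g)" "2 \<le> q" "paut M"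
    and h: "nform h" and e: "e \<in> V (q + 5)" and c: "c \<in> V (q + 4)" "neg c = c"
  shows "close (q + 1) (\<lambda>g. Hilbert_Choice.inv S (M (flip S g))) (\<lambda>g. exp_lie h g + lie (e + y_ser * ser_dx c) g)"
proof -
  let ?E = "exp_lie h" and ?I = "Hilbert_Choice.inv S" and ?d = "Hilbert_Choice.inv S h - h"
  have c': "c \<in> V ((q - 1) + 5)" using c(1) M(2) by (simp add: algebra_simps)
  have sc: "shifts (q - 1) (lie c)" by (rule shifts_lie[OF V_Vham[OF c']])
  have sc1: "shifts 1 (lie c)" by (rule shifts_mono[OF sc]) (use M(2) in simp)
  have se: "shifts q (lie e)" by (rule shifts_lie[OF V_Vham[OF e]])
  have S: "paut S" unfolding S_def by (rule exp_lie_paut[OF sc1])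
  have I: "paut ?I" by (rule paut_inv[OF S])
  have E: "paut ?E" by (rule exp_lie_paut[OF nform_shifts[OF h]])
  have fS: "flip S = S" unfolding S_def using flip_exp_lie[OF sc1] c(2) by auto
  have 1: "close (q + 1) (\<lambda>g. M (S g)) (\<lambda>g. ?E (S g) + lie e g)"
  proof (rule close_trans)
    show "close (q + 1) (\<lambda>g. M (S g)) (\<lambda>g. ?E (S g) + lie e (S g))"
      using close_comp_right[OF M(1) paut_shifts[OF S]] by simp
    show "close (q + 1) (\<lambda>g. ?E (S g) + lie e (S g)) (\<lambda>g. ?E (S g) + lie e g)"
      by (rule close_add[OF close_refl close_comp_left[OF linear_lie se paut_close[OF S]]]) simp
  qed
  have Ih: "?I h \<in> V 6" using shiftsD[OF paut_shifts[OF I] nform_V6[OF h]] by simp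
  have sIh: "shifts 1 (lie (?I h))" using shifts_lie[of "?I h" 1] V_Vham[OF Ih] by simp
  have 2: "close (q + 1) (\<lambda>g. ?I (M (S g))) (\<lambda>g. exp_lie (?I h) g + lie e g)"
  proof (rule close_trans)
    show "close (q + 1) (\<lambda>g. ?I (M (S g))) (\<lambda>g. ?I (?E (S g)) + ?I (lie e g))"
      using close_comp_left[OF paut_linear[OF I] paut_shifts[OF I] 1, of "q + 1"]
      by (simp add: linear_add[OF paut_linear[OF I]])
    have "?I (?E (S g)) = exp_lie (?I h) g" for g
      by (simp add: psym_exp_lie[OF paut_psym[OF I] nform_shifts[OF h] sIh] paut_inv_f[OF S])
    moreover have "close (q + 1) (\<lambda>g. ?I (lie e g)) (lie e)"
      using close_comp_right[OF paut_close[OF I] se, of "q + 1"] by simp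
    ultimately show "close (q + 1) (\<lambda>g. ?I (?E (S g)) + ?I (lie e g)) (\<lambda>g. exp_lie (?I h) g + lie e g)"
      using close_add[OF close_refl] by simp
  qed
  have d: "?d - y_ser * ser_dx c \<in> V (q + 6)"
  proof -
    have "?I h - h - y_ser * ser_dx c \<in> V ((q - 1) + 7)"
      unfolding S_def by (rule inv_exp_lie_nform[OF h c']) (use M(2) in simp)
    moreover have "(q - 1) + 7 = q + 6" using M(2) by simp
    ultimately show ?thesis by (simp only:)
  qed
  have yc: "y_ser * ser_dx c \<in> V (q + 5)"
    using filt_mult_le[OF y_in_V V_dx[OF c(1)], of "q + 5"] by simp
  have "?d \<in> V (q + 5)" using filt_add[OF filt_mono[OF d, of "q + 5"] yc] by simp
  then have sd: "shifts q (lie ?d)" by (intro shifts_lie V_Vham)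
  have 3: "close (q + 1) (exp_lie (?I h)) (\<lambda>g. ?E g + lie ?d g)"
    using exp_lie_perturb[OF nform_shifts[OF h] sd] M(2) by simp
  have 4: "close (q + 1) (lie ?d) (lie (y_ser * ser_dx c))"
    using shifts_lie[of "?d - y_ser * ser_dx c" "q + 1"] V_Vham[OF d] by (simp add: lie_diff[abs_def] add.commute)
  have 5: "close (q + 1) (exp_lie (?I h)) (\<lambda>g. ?E g + lie (y_ser * ser_dx c) g)"
    by (rule close_trans[OF 3 close_add[OF close_refl 4]])
  have "close (q + 1) (\<lambda>g. ?I (M (S g))) (\<lambda>g. (?E g + lie (y_ser * ser_dx c) g) + lie e g)"
    by (rule close_trans[OF 2 close_add[OF 5 close_refl]])
  moreover have "(?E g + lie (y_ser * ser_dx c) g) + lie e g = ?E g + lie (e + y_ser * ser_dx c) g" for g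
    by (simp add: lie_add)
  ultimately show ?thesis by (simp only: fS)
qed

lemma close_lie_Vham:
  "f - g \<in> Vham (q + 6) \<Longrightarrow> close (q + 1) (\<lambda>u. E u + lie f u) (\<lambda>u. E u + lie g u)"
  using shifts_lie[of "f - g" "q + 1"] by (simp add: lie_diff[abs_def] add.commute)

text \<open>The homological equation.  A term \<open>x\<^sup>i y\<^sup>j \<epsilon>\<^sup>m\<close> of odd parity is removed since \<open>-1\<close> acts on it
  nontrivially, one of even parity with \<open>j > 0\<close> through \<open>y \<partial>\<^sub>x\<close>; the powers of \<open>x\<close> with even
  exponent remain.\<close>

lemma existence_step:
  assumes M: "paut M" and T: "paut T" and h: "nform h" and q: "2 \<le> q"
    and close: "close q (\<lambda>g. M (flip T g)) (\<lambda>g. T (exp_lie h g))"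
  obtains T' h' where "paut T'" "nform h'" "close (q + 1) (\<lambda>g. M (flip T' g)) (\<lambda>g. T' (exp_lie h' g))"
    "close (q - 1) T' T" "h' - h \<in> V (q + 5)"
proof -
  let ?E = "exp_lie h"
  have q1: "1 \<le> q" using q by simp
  have E: "paut ?E" by (rule exp_lie_paut[OF nform_shifts[OF h]])
  define M1 where "M1 = (\<lambda>g. Hilbert_Choice.inv T (M (flip T g)))"
  have M1: "paut M1" unfolding M1_def
    by (intro paut_comp[OF paut_inv[OF T]] paut_comp[OF M] flip_paut T)
  \<comment> \<open>Dividing by the flow of \<open>h\<close> produces an operator near the identity,
    whose leading term is Hamiltonian.\<close>
  define G where "G = (\<lambda>g. Hilbert_Choice.inv ?E (M1 g))"
  have G: "paut G" unfolding G_def by (rule paut_comp[OF paut_inv[OF E] M1])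
  have "close q M1 ?E"
    using close_comp_left[OF paut_linear[OF paut_inv[OF T]] paut_shifts[OF paut_inv[OF T]] close, of q]
    by (simp add: M1_def paut_inv_f[OF T])
  from close_comp_left[OF paut_linear[OF paut_inv[OF E]] paut_shifts[OF paut_inv[OF E]] this, of q]
  have "close q G (\<lambda>g. g)" by (simp add: G_def paut_inv_f[OF E])
  then obtain e where e: "e \<in> V (q + 5)" and Ge: "close (q + 1) G (\<lambda>g. g + lie e g)"
    using paut_leading_term[OF G _ q1] by blast
  have M1e: "close (q + 1) M1 (\<lambda>g. ?E g + lie e g)"
    using close_near_id_left[OF Ge shifts_lie[OF V_Vham[OF e]] paut_linear[OF E] paut_close[OF E]]
    by (simp add: G_def paut_f_inv[OF E])
  \<comment> \<open>Solves \<open>y \<partial>\<^sub>x c = - e\<close> on the even monomials that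
    contain \<open>y\<close>: one power of \<open>y\<close> is traded for one of
    \<open>x\<close>.\<close>
  define c where "c = mk_ser (\<lambda>i j m. if even (i + j) \<and> 0 < i then - cf e (i - 1) (j + 1) m / real i else 0)"
  have c: "c \<in> V (q + 4)"
  proof (rule filtI)
    fix i j m :: nat assume "2 * i + 3 * j + 6 * m < q + 4"
    then show "cf c i j m = 0" using filtD[OF e, of "i - 1" "j + 1" m] by (cases i) (auto simp: c_def)
  qed
  have negc: "neg c = c" by (rule ser_eqI) (auto simp: cf_neg c_def)
  have ycx: "cf (y_ser * ser_dx c) i j m = (if 0 < j \<and> even (i + j) then - cf e i j m else 0)" for i j m
    by (cases j) (auto simp: cf_y_mult c_def)
  let ?e1 = "e + y_ser * ser_dx c"
  define S1 where "S1 = exp_lie c"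
  define M2 where "M2 = (\<lambda>g. Hilbert_Choice.inv S1 (M1 (flip S1 g)))"
  have c': "c \<in> V ((q - 1) + 5)" using c q by (simp add: algebra_simps)
  have sc: "shifts (q - 1) (lie c)" by (rule shifts_lie[OF V_Vham[OF c']])
  have q2: "1 \<le> q - 1" using q by simp
  have S1: "paut S1" unfolding S1_def by (rule exp_lie_paut[OF shifts_mono[OF sc q2]])
  have M2e: "close (q + 1) M2 (\<lambda>g. ?E g + lie ?e1 g)"
    unfolding M2_def S1_def by (rule even_part_step[OF M1e q M1 h e c negc])
  \<comment> \<open>What is left of \<open>e\<close> splits into odd terms, collected in
    \<open>ob\<close>, even powers of \<open>x\<close>, collected in \<open>a\<close>, and monomials
    in \<epsilon> alone, which \<open>Vham\<close> ignores.\<close>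
  define ob where "ob = mk_ser (\<lambda>i j m. if odd (i + j) then cf e i j m else 0)"
  define a where "a = mk_ser (\<lambda>i j m. if j = 0 \<and> even i \<and> 0 < i then cf e i j m else 0)"
  have ob: "ob \<in> V (q + 5)" and a: "a \<in> V (q + 5)"
    using e by (auto simp: ob_def a_def filt_def)
  have negob: "neg ob = - ob" by (rule ser_eqI) (simp add: cf_neg ob_def)
  have "?e1 - (ob + a) \<in> Vham (q + 6)"
    unfolding Vham_def by (auto simp: ycx ob_def a_def)
  from close_trans[OF M2e close_lie_Vham[OF this]]
  have M2e': "close (q + 1) M2 (\<lambda>g. ?E g + lie (ob + a) g)" .
  define S2 where "S2 = exp_lie (const_ser (1 / 2) * ob)"
  have so: "shifts q (lie (const_ser (1 / 2) * ob))"
    by (rule shifts_lie[OF V_Vham[OF filt_const_mult[OF ob]]])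
  have S2: "paut S2" unfolding S2_def by (rule exp_lie_paut[OF shifts_mono[OF so q1]])
  have M3: "close (q + 1) (\<lambda>g. M2 (flip S2 g)) (\<lambda>g. S2 (exp_lie (h + a) g))"
    unfolding S2_def by (rule odd_part_step[OF M2e' q1 nform_shifts[OF h] ob negob V_Vham[OF a]])
  define T' where "T' = (\<lambda>g. T (S1 (S2 g)))"
  have TS: "paut (\<lambda>g. T (S1 g))" by (rule paut_comp[OF T S1])
  have "M (flip T' g) = T (S1 (M2 (flip S2 g)))" for g
    by (simp add: T'_def flip_def M2_def M1_def paut_f_inv[OF S1] paut_f_inv[OF T])
  then have "close (q + 1) (\<lambda>g. M (flip T' g)) (\<lambda>g. T' (exp_lie (h + a) g))"
    using close_comp_left[OF paut_linear[OF TS] paut_shifts[OF TS] M3, of "q + 1"] by (simp add: T'_def)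
  moreover have "paut T'" unfolding T'_def by (rule paut_comp[OF T paut_comp[OF S1 S2]])
  moreover have "nform (h + a)"
  proof -
    have 7: "a \<in> V 7" by (rule filt_mono[OF a]) (use q in simp)
    let ?y = "const_ser (1 / 2) * y_ser ^ 2"
    have eq: "h + a - ?y = (h - ?y) + a" by simp
    have "h - ?y \<in> V 7" and hc: "\<And>i j m. cf (h - ?y) i j m \<noteq> 0 \<Longrightarrow> j = 0 \<and> even i \<and> 0 < i"
      using h unfolding nform_def by blast+
    then have "h + a - ?y \<in> V 7" unfolding eq by (intro filt_add 7)
    moreover have "j = 0 \<and> even i \<and> 0 < i" if "cf (h + a - ?y) i j m \<noteq> 0" for i j m
    proof (rule ccontr)
      assume n: "\<not> (j = 0 \<and> even i \<and> 0 < i)"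
      then have "cf (h - ?y) i j m = 0" "cf a i j m = 0" using hc[of i j m] by (auto simp: a_def)
      then show False using that unfolding eq cf_add by simp
    qed
    ultimately show ?thesis unfolding nform_def by blast
  qed
  moreover have "close (q - 1) T' T"
  proof -
    \<comment> \<open>One weight is lost because \<open>c\<close> starts one weight below
      \<open>e\<close>; the limit over all steps still exists.\<close>
    have "close (q - 1) (\<lambda>g. S1 (S2 g)) (\<lambda>g. g)"
      unfolding S1_def S2_def
      by (rule close_id_comp[OF exp_lie_close_id[OF sc q2] shifts_mono[OF exp_lie_close_id[OF so q1]]]) simp
    from close_comp_left[OF paut_linear[OF T] paut_shifts[OF T] this, of "q - 1"]
    show ?thesis by (simp add: T'_def)
  qed
  ultimately show ?thesis using that[of T' "h + a"] a by simp
qed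

lemma existence_start:
  assumes M: "paut M" and M1: "cf (M x_ser) 0 1 0 = 1"
  obtains T h where "paut T" "nform h" "close 2 (\<lambda>g. M (flip T g)) (\<lambda>g. T (exp_lie h g))"
proof -
  obtain e where e: "e \<in> V 6" and Me: "close 2 M (\<lambda>g. g + lie e g)"
    using paut_leading_term[OF M paut_close[OF M]] by (auto simp: numeral_2_eq_2)
  have e20: "cf e 0 2 0 = 1 / 2"
  proof -
    have "M x_ser - (x_ser + lie e x_ser) \<in> V (2 + 2)" by (rule shiftsD[OF Me x_in_V])
    moreover have "lie e x_ser = ser_dy e" by (simp add: lie_def poisson_x_y)
    ultimately have "M x_ser - (x_ser + ser_dy e) \<in> V 4" by simp
    from filtD[OF this, of 0 1 0] have "cf (M x_ser - (x_ser + ser_dy e)) 0 1 0 = 0" by simp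
    then have "cf (M x_ser) 0 1 0 = cf (ser_dy e) 0 1 0" by (simp add: x_ser_mon cf_mon del: cf_dy)
    then show ?thesis by (simp add: M1[simplified] numeral_2_eq_2)
  qed
  define ob where "ob = const_ser (cf e 3 0 0) * mon 3 0 0"
  define a where "a = const_ser (1 / 2) * y_ser ^ 2"
  have ob: "ob \<in> V (1 + 5)" unfolding ob_def by (intro filt_const_mult filtI) (auto simp: cf_mon)
  have negob: "neg ob = - ob" by (rule ser_eqI) (auto simp: cf_neg ob_def cf_mon)
  have eoa: "e - (ob + a) \<in> Vham (1 + 6)" unfolding Vham_def
  proof (intro CollectI allI impI, elim conjE)
    fix i j m :: nat assume *: "0 < i + j" "2 * i + 3 * j + 6 * m < 1 + 6"
    show "cf (e - (ob + a)) i j m = 0"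
    proof (cases "2 * i + 3 * j + 6 * m < 6")
      case True
      then show ?thesis using filtD[OF e True] by (auto simp: ob_def a_def y2_mon cf_mon)
    next
      case False
      have "m = 0" using * by (cases m) auto
      then have "2 * i + 3 * j = 6" using * False by linarith
      then have "(i = 3 \<and> j = 0) \<or> (i = 0 \<and> j = 2)" by presburger
      then show ?thesis using \<open>m = 0\<close> e20 by (auto simp: ob_def a_def y2_mon cf_mon)
    qed
  qed
  have "exp_lie 0 u = u" for u by (rule exp_lie_fixed) (simp add: lie_def poisson_def)
  with close_trans[OF _ close_lie_Vham[OF eoa], of M "\<lambda>u. u"] Me
  have Me': "close (1 + 1) M (\<lambda>g. exp_lie 0 g + lie (ob + a) g)"
    by (simp add: numeral_2_eq_2)
  have s0: "shifts 1 (lie 0)" by (simp add: shifts_def lie_def poisson_def)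
  have "a \<in> V 6" unfolding a_def by (rule y2_in_V)
  then have "close 2 (\<lambda>g. M (flip (exp_lie (const_ser (1 / 2) * ob)) g))
      (\<lambda>g. exp_lie (const_ser (1 / 2) * ob) (exp_lie a g))"
    using odd_part_step[OF Me' order_refl s0 ob negob V_Vham] by (simp add: numeral_2_eq_2)
  moreover have "paut (exp_lie (const_ser (1 / 2) * ob))"
    by (rule exp_lie_paut[OF shifts_lie[OF V_Vham[OF filt_const_mult[OF ob]]]])
  moreover have "nform a" by (simp add: nform_def a_def)
  ultimately show ?thesis using that by blast
qed

lemma paut_limit:
  assumes T: "\<And>n. paut (T n)" and lim: "\<And>n g. T' g - T n g \<in> V n"
  shows "paut T'"
proof -
  have cl: "close 1 T' (\<lambda>g. g)"
  proof (rule shiftsI)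
    fix n g assume "g \<in> V n"
    from filt_add[OF lim[of g "n + 1"] shiftsD[OF paut_close[OF T[of "n + 1"]] this]]
    show "T' g - g \<in> V (n + 1)" by simp
  qed
  note h = paut_hom[OF T]
  have add: "T' (f + g) = T' f + T' g" for f g
  proof (rule filt_eqI[of _ _ 2 3 6])
    fix n
    have "(T' (f + g) - T n (f + g)) - (T' f - T n f) - (T' g - T n g) \<in> V n"
      by (intro filt_diff lim)
    then show "T' (f + g) - (T' f + T' g) \<in> V n" by (simp add: hom_add[OF h] algebra_simps)
  qed
  have mult: "T' (f * g) = T' f * T' g" for f g
  proof (rule filt_eqI[of _ _ 2 3 6])
    fix n
    have "(T' f - T n f) * T' g \<in> V n" "T n f * (T' g - T n g) \<in> V n"
      using filt_mult[OF lim[of f n], of "T' g" 0] filt_mult[OF _ lim[of g n], of "T n f" 0] by simp_all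
    from filt_diff[OF filt_diff[OF lim[of "f * g" n] this(1)] this(2)]
    show "T' (f * g) - T' f * T' g \<in> V n" by (simp add: hom_mult[OF h] algebra_simps)
  qed
  have const: "T' u = u" if "\<And>n. T n u = u" for u
    by (rule filt_eqI[of _ _ 2 3 6]) (use lim[of u] that in simp)
  have cu: "T' (const_ser a) = const_ser a" for a by (rule const) (rule hom_const[OF h])
  have "poisson (T' x_ser) (T' y_ser) = 1"
  proof (rule filt_eqI[of _ _ 2 3 6])
    fix n :: nat
    let ?T = "T (n + 5)"
    have "poisson (T' x_ser - ?T x_ser) (T' y_ser) \<in> V n" "poisson (?T x_ser) (T' y_ser - ?T y_ser) \<in> V n"
      by (rule V_poisson[OF lim[of x_ser "n + 5"], of _ 0] V_poisson[OF _ lim[of y_ser "n + 5"], of _ 0]; simp)+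
    from filt_add[OF this] have "poisson (T' x_ser) (T' y_ser) - poisson (?T x_ser) (?T y_ser) \<in> V n"
      by (simp add: poisson_diff_left poisson_diff_right)
    then show "poisson (T' x_ser) (T' y_ser) - 1 \<in> V n" using T[of "n + 5"] by (simp add: paut_def psym_def)
  qed
  then show ?thesis using cl close_idD[OF cl]
    by (simp add: paut_def psym_def ser_hom_def ser_linear_def add mult cu shifts_0_cont
        const hom_one[OF h] hom_eps[OF h])
qed

lemma normal_form_exists:
  assumes M: "paut M" and M1: "cf (M x_ser) 0 1 0 = 1"
  obtains T h where "paut T" "nform h" "\<And>g. M (flip T g) = T (exp_lie h g)"
proof -
  let ?P = "\<lambda>n (T, h). paut T \<and> nform h \<and> close (n + 2) (\<lambda>g. M (flip T g)) (\<lambda>g. T (exp_lie h g))"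
  let ?Q = "\<lambda>n (T, h) (T', h'). close (n + 1) T' T \<and> h' - h \<in> V (n + 7)"
  \<comment> \<open>Dependent choice of the approximations; \<open>?Q\<close> records how little
    they change, so that both sequences converge.\<close>
  have "\<exists>s. \<forall>n. ?P n (s n) \<and> ?Q n (s n) (s (Suc n))"
  proof (rule dependent_nat_choice)
    obtain T h where "paut T" "nform h" "close 2 (\<lambda>g. M (flip T g)) (\<lambda>g. T (exp_lie h g))"
      by (rule existence_start[OF M M1])
    then show "\<exists>s. ?P 0 s" by (intro exI[of _ "(T, h)"]) (simp add: numeral_2_eq_2)
  next
    fix s n assume P: "?P n s"
    obtain T h where s: "s = (T, h)" by (cases s)
    obtain T' h' where "paut T'" "nform h'" "close (n + 2 + 1) (\<lambda>g. M (flip T' g)) (\<lambda>g. T' (exp_lie h' g))"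
      "close (n + 2 - 1) T' T" "h' - h \<in> V (n + 2 + 5)"
      by (rule existence_step[OF M, of T h "n + 2"]) (use P in \<open>auto simp: s\<close>)
    then show "\<exists>s'. ?P (Suc n) s' \<and> ?Q n s s'"
      by (intro exI[of _ "(T', h')"]) (simp add: s numeral_eq_Suc)
  qed
  then obtain s where s: "\<forall>n. ?P n (s n) \<and> ?Q n (s n) (s (Suc n))" by (rule exE)
  define T where "T n = fst (s n)" for n
  define h where "h n = snd (s n)" for n
  have T: "paut (T n)" and h: "nform (h n)" and c: "close (n + 2) (\<lambda>g. M (flip (T n) g)) (\<lambda>g. T n (exp_lie (h n) g))"
    and Tn: "close (n + 1) (T (Suc n)) (T n)" and hn: "h (Suc n) - h n \<in> V (n + 7)" for n
    using spec[OF s, of n] by (simp_all only: T_def h_def case_prod_unfold)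
  have "T (Suc n) g - T n g \<in> V n" for n g
    using shiftsD_le[OF Tn, of g 0 n n] by simp
  then have "\<exists>u. \<forall>n. u - T n g \<in> V n" for g using series_limit[of "\<lambda>n. T n g"] by metis
  then obtain T' where T': "\<And>n g. T' g - T n g \<in> V n" by metis
  have "h (Suc n) - h n \<in> V n" for n by (rule filt_mono[OF hn]) simp
  then obtain h' where h': "\<And>n. h' - h n \<in> V n" using series_limit[of h] by blast
  have paut: "paut T'" by (rule paut_limit[OF T T'])
  have nf: "nform h'" unfolding nform_def
  proof (intro conjI allI impI)
    let ?y = "const_ser (1 / 2) * y_ser ^ 2"
    have "h 7 - ?y \<in> V 7" using h[of 7] by (simp add: nform_def)
    from filt_add[OF h'[of 7] this] show "h' - ?y \<in> V 7" by simp
    fix i j m assume *: "cf (h' - ?y) i j m \<noteq> 0"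
    let ?n = "Suc (2 * i + 3 * j + 6 * m)"
    have "cf (h' - h ?n) i j m = 0" by (rule filtD[OF h']) simp
    then have "cf (h ?n - ?y) i j m \<noteq> 0" using * by simp
    then show "j = 0" "even i" "0 < i" using h[of ?n] unfolding nform_def by blast+
  qed
  have "M (flip T' g) = T' (exp_lie h' g)" for g
  proof (rule filt_eqI[of _ _ 2 3 6])
    fix n :: nat
    \<comment> \<open>Passing from \<open>h' - h ?N\<close> to its Lie derivative costs 5, and one
      more keeps the shift in \<open>d\<close> positive for \<open>exp_lie_perturb\<close>.\<close>
    let ?N = "n + 6"
    have a: "T' u - T ?N u \<in> V n" for u by (rule filt_mono[OF T']) simp
    have "neg (T' (neg g) - T ?N (neg g)) \<in> V n"
      using shiftsD[OF neg_shifts a] by simp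
    then have "M (neg (T' (neg g) - T ?N (neg g))) \<in> V n"
      using shiftsD[OF paut_shifts[OF M]] by fastforce
    then have 1: "M (flip T' g) - M (flip (T ?N) g) \<in> V n"
      by (simp add: flip_def hom_diff[OF neg_hom] hom_diff[OF paut_hom[OF M]])
    have 2: "M (flip (T ?N) g) - T ?N (exp_lie (h ?N) g) \<in> V n"
      using shiftsD_le[OF c[of ?N], of g 0 n] by simp
    have d: "shifts (n + 1) (lie (h' - h ?N))"
      by (rule shifts_lie[OF V_Vham[OF filt_mono[OF h'[of ?N]]]]) simp
    have "exp_lie (h ?N + (h' - h ?N)) g - (exp_lie (h ?N) g + lie (h' - h ?N) g) \<in> V n"
      by (rule shiftsD_le[OF exp_lie_perturb[OF nform_shifts[OF h] d], of g 0]) auto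
    moreover have "lie (h' - h ?N) g \<in> V n" by (rule shiftsD_le[OF d, of g 0]) auto
    ultimately have "exp_lie h' g - exp_lie (h ?N) g \<in> V n" using filt_add by fastforce
    then have "T ?N (exp_lie h' g - exp_lie (h ?N) g) \<in> V n"
      using shiftsD[OF paut_shifts[OF T]] by fastforce
    then have 3: "T ?N (exp_lie h' g) - T ?N (exp_lie (h ?N) g) \<in> V n"
      by (simp add: hom_diff[OF paut_hom[OF T]])
    from filt_diff[OF filt_diff[OF filt_add[OF 1 2] 3] a[of "exp_lie h' g"]]
    show "M (flip T' g) - T' (exp_lie h' g) \<in> V n" by simp
  qed
  then show ?thesis using that paut nf by blast
qed

section \<open>Translation to formal maps\<close>

lemma subst_comp:
  assumes "fixes_origin F" "fixes_origin G"
  shows "ser_subst g (fmap_comp F G) = ser_subst (ser_subst g F) G" "fixes_origin (fmap_comp F G)"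
proof -
  have A: "ser_hom (\<lambda>g. ser_subst (ser_subst g F) G)"
    by (rule hom_comp[OF hom_subst[OF assms(2)] hom_subst[OF assms(1)]])
  have xy: "(ser_subst (ser_subst x_ser F) G, ser_subst (ser_subst y_ser F) G) = fmap_comp F G"
    by (simp add: fmap_comp_def subst_x[OF assms(1)] subst_y[OF assms(1)])
  show "fixes_origin (fmap_comp F G)" using hom_fixes_origin[OF A] by (simp only: xy)
  show "ser_subst g (fmap_comp F G) = ser_subst (ser_subst g F) G"
    using hom_subst_eq[OF A, of g] by (simp only: xy)
qed

lemma subst_const: "fixes_origin G \<Longrightarrow> ser_subst (const_ser a) G = const_ser a"
  using hom_const[OF hom_subst] by blast

lemma fixes_origin_id: "fixes_origin fmap_id"
  by (simp add: fixes_origin_def fmap_id_def x_ser_mon y_ser_mon cf_mon)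

lemma subst_id: "ser_subst g fmap_id = g"
  using hom_subst_eq[OF hom_id, of g] by (simp add: fmap_id_def)

lemma fmap_eqI:
  assumes "fixes_origin F" "fixes_origin G" "\<And>g. ser_subst g F = ser_subst g G" shows "F = G"
  using assms(3)[of x_ser] assms(3)[of y_ser] by (simp add: subst_x subst_y assms(1,2) prod_eq_iff)

lemma inverse_subst:
  "fmap_inverse \<phi> \<psi> \<Longrightarrow> ser_subst (ser_subst g \<phi>) \<psi> = g"
  "fmap_inverse \<phi> \<psi> \<Longrightarrow> ser_subst (ser_subst g \<psi>) \<phi> = g"
  unfolding fmap_inverse_def by (metis subst_comp(1) subst_id)+

lemma fmap_inverseI:
  assumes "fixes_origin \<phi>" "fixes_origin \<psi>"
    "\<And>g. ser_subst (ser_subst g \<phi>) \<psi> = g" "\<And>g. ser_subst (ser_subst g \<psi>) \<phi> = g"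
  shows "fmap_inverse \<phi> \<psi>"
  using assms unfolding fmap_inverse_def
  by (auto intro!: fmap_eqI subst_comp(2) fixes_origin_id simp: subst_comp(1) subst_id)

lemma subst_conjugates:
  assumes "fmap_inverse \<phi> \<psi>" "F = fmap_comp \<psi> (fmap_comp K \<phi>)" "fixes_origin K"
  shows "ser_subst g F = ser_subst (ser_subst (ser_subst g \<psi>) K) \<phi>"
  using assms by (simp add: fmap_inverse_def subst_comp)

lemma jac_det_poisson: "jac_det G = poisson (fst G) (snd G)"
  by (simp add: jac_det_def poisson_def)

lemma jac_det_comp:
  assumes "fixes_origin F" "fixes_origin G"
  shows "jac_det (fmap_comp F G) = jac_det G * ser_subst (jac_det F) G"
  using hom_poisson[OF hom_subst[OF assms(2)], of "fst F" "snd F"]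
  by (simp add: jac_det_poisson fmap_comp_def subst_x[OF assms(2)] subst_y[OF assms(2)])

lemma simplex3_1: "simplex3 1 = {(0, 0, 0), (1, 0, 0), (0, 1, 0), (0, 0, 1)}"
  unfolding simplex3_def by (auto simp: le_Suc_eq)

lemma cf_subst_linear:
  assumes "fixes_origin G"
  shows "cf (ser_subst g G) 1 0 0 = cf g 1 0 0 * cf (fst G) 1 0 0 + cf g 0 1 0 * cf (snd G) 1 0 0"
    and "cf (ser_subst g G) 0 1 0 = cf g 1 0 0 * cf (fst G) 0 1 0 + cf g 0 1 0 * cf (snd G) 0 1 0"
  using cf_subst[OF assms, of 1 0 0 1 g] cf_subst[OF assms, of 0 1 0 1 g]
  unfolding simplex3_1 by (simp_all add: cf_1 eps_ser_mon cf_mon)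

section \<open>Linear changes of variables\<close>

definition lin_map :: "real \<Rightarrow> real \<Rightarrow> real \<Rightarrow> real \<Rightarrow> fmap" where
  "lin_map a b c d = (const_ser a * x_ser + const_ser b * y_ser, const_ser c * x_ser + const_ser d * y_ser)"

lemma cf_lin_map:
  "cf (fst (lin_map a b c d)) 1 0 0 = a" "cf (fst (lin_map a b c d)) 0 1 0 = b"
  "cf (snd (lin_map a b c d)) 1 0 0 = c" "cf (snd (lin_map a b c d)) 0 1 0 = d"
  and fixes_origin_lin_map: "fixes_origin (lin_map a b c d)"
  by (simp_all add: fixes_origin_def lin_map_def x_ser_mon y_ser_mon cf_mon)

lemma jac_det_lin_map: "jac_det (lin_map a b c d) = const_ser (a * d - b * c)"
  by (simp add: jac_det_def lin_map_def ser_dx_add ser_dy_add ser_dx_const_mult ser_dy_const_mult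
      const_ser_mult const_ser_add[of "a * d" "- (b * c)", simplified] const_ser_uminus)

lemma lin_map_id: "lin_map 1 0 0 1 = fmap_id"
  by (simp add: lin_map_def fmap_id_def)

lemma lin_map_comp:
  "fmap_comp (lin_map a b c d) (lin_map a' b' c' d') =
   lin_map (a * a' + b * c') (a * b' + b * d') (c * a' + d * c') (c * b' + d * d')"
proof -
  note o = fixes_origin_lin_map[of a' b' c' d']
  show ?thesis
    by (simp add: fmap_comp_def lin_map_def[of a b c d] hom_add[OF hom_subst[OF o]]
        hom_const_mult[OF hom_subst[OF o]] subst_x[OF o] subst_y[OF o])
      (simp add: lin_map_def const_ser_add const_ser_mult algebra_simps)
qed

text \<open>The adjugate divided by the determinant, where \<open>1 / D = D\<close> because
  \<open>D\<close> is 1 or -1.\<close>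

lemma lin_map_inverse:
  assumes "(a * d - b * c)^2 = 1"
  defines "D \<equiv> a * d - b * c"
  shows "fmap_inverse (lin_map a b c d) (lin_map (D * d) (- D * b) (- D * c) (D * a))"
proof -
  have D: "D * D = 1" using assms by (simp add: power2_eq_square)
  have "a * (D * d) + b * (- D * c) = D * D" "c * (- D * b) + d * (D * a) = D * D"
    "D * d * a + - D * b * c = D * D" "- D * c * b + D * a * d = D * D"
    "a * (- D * b) + b * (D * a) = 0" "c * (D * d) + d * (- D * c) = 0"
    "D * d * b + - D * b * d = 0" "- D * c * a + D * a * c = 0"
    by (simp_all add: D_def algebra_simps)
  then show ?thesis
    unfolding fmap_inverse_def lin_map_comp by (simp only: D fixes_origin_lin_map lin_map_id)
qed

lemma subst_time_one:
  assumes "shifts 1 (lie H)"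
  shows "ser_subst g (fmap_uminus (time_one H)) = exp_lie H (neg g)"
    and "fixes_origin (fmap_uminus (time_one H))"
proof -
  note E = paut_hom[OF exp_lie_paut[OF assms]]
  have A: "ser_hom (\<lambda>g. exp_lie H (neg g))" by (rule hom_comp[OF E neg_hom])
  have xy: "(exp_lie H (neg x_ser), exp_lie H (neg y_ser)) = fmap_uminus (time_one H)"
    by (simp add: neg_xy hom_uminus[OF E] fmap_uminus_def time_one_def)
  show "fixes_origin (fmap_uminus (time_one H))" using hom_fixes_origin[OF A] by (simp only: xy)
  show "ser_subst g (fmap_uminus (time_one H)) = exp_lie H (neg g)"
    using hom_subst_eq[OF A, of g] by (simp only: xy)
qed

section \<open>The Hamiltonians \<open>ham u\<close> as normal forms\<close>

lemma time_one_cong: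
  assumes "\<And>i j m. 0 < i + j \<Longrightarrow> cf H i j m = cf H' i j m"
  shows "time_one H = time_one H'"
proof -
  have "ser_dx H = ser_dx H'" "ser_dy H = ser_dy H'"
    by (rule ser_eqI; simp add: assms)+
  then have "lie H = lie H'" by (simp add: fun_eq_iff lie_def poisson_def)
  then show ?thesis by (simp add: time_one_def exp_lie_def)
qed

lemma cf_ham: "cf (ham u) i j m = (if i = 0 \<and> j = 2 \<and> m = 0 then 1 / 2 else 0) +
   (if j = 0 \<and> even i \<and> 2 \<le> i div 2 + 2 * m then u (i div 2) m else 0)"
  by (simp add: ham_def U_ser_def y2_mon cf_mon)

lemma time_one_ham_cong:
  assumes "\<And>k m. 1 \<le> k \<Longrightarrow> 2 \<le> k + 2 * m \<Longrightarrow> u k m = u' k m"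
  shows "time_one (ham u) = time_one (ham u')"
  by (rule time_one_cong) (auto simp: cf_ham intro!: assms elim!: evenE)

text \<open>Normal forms contain no monomials in \<epsilon> alone, whereas the coefficients
  \<open>u 0 m\<close> put some into \<open>ham u\<close>.\<close>

definition drop_const :: "(nat \<Rightarrow> nat \<Rightarrow> real) \<Rightarrow> nat \<Rightarrow> nat \<Rightarrow> real" where
  "drop_const u k m = (if k = 0 then 0 else u k m)"

lemma time_one_drop_const: "time_one (ham u) = time_one (ham (drop_const u))"
  by (rule time_one_ham_cong) (simp add: drop_const_def)

lemma nform_ham: "nform (ham (drop_const u))"
proof -
  have *: "ham (drop_const u) - const_ser (1 / 2) * y_ser ^ 2 = U_ser (drop_const u)"
    by (simp add: ham_def)
  have "U_ser (drop_const u) \<in> V 7"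
    by (rule filtI) (auto simp: U_ser_def drop_const_def elim!: evenE)
  moreover have "j = 0 \<and> even i \<and> 0 < i" if "cf (U_ser (drop_const u)) i j m \<noteq> 0" for i j m
    using that by (auto simp: U_ser_def drop_const_def split: if_splits)
  ultimately show ?thesis unfolding nform_def * by blast
qed

lemma nform_ham_ex:
  assumes "nform h" obtains u where "h = ham u"
proof -
  let ?y = "const_ser (1 / 2) * y_ser ^ 2"
  have "h = ham (\<lambda>k m. cf h (2 * k) 0 m)"
  proof (rule ser_eqI)
    fix i j m
    have y: "cf ?y i j m = (if i = 0 \<and> j = 2 \<and> m = 0 then 1 / 2 else 0)" by (simp add: y2_mon cf_mon)
    have z: "cf (h - ?y) i j m = 0" if "\<not> (j = 0 \<and> even i \<and> 2 \<le> i div 2 + 2 * m)"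
    proof (rule ccontr)
      assume n: "cf (h - ?y) i j m \<noteq> 0"
      then have "j = 0" "even i" "0 < i" using assms unfolding nform_def by blast+
      from this that have "2 * i + 3 * j + 6 * m < 7" by (auto elim!: evenE)
      moreover have "h - ?y \<in> V 7" using assms by (simp add: nform_def)
      ultimately have "cf (h - ?y) i j m = 0" by (simp only: filtD)
      then show False using n by simp
    qed
    show "cf h i j m = cf (ham (\<lambda>k m. cf h (2 * k) 0 m)) i j m"
    proof (cases "j = 0 \<and> even i \<and> 2 \<le> i div 2 + 2 * m")
      case True then show ?thesis by (simp add: cf_ham)
    next
      case False
      then have "cf h i j m = cf ?y i j m" using z by simp
      then show ?thesis using False unfolding cf_ham y by auto
    qed
  qed
  then show ?thesis by (rule that)
qed

lemma exp_lie_nform_xy: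
  assumes h: "nform h"
  shows "exp_lie h x_ser - (x_ser + y_ser) \<in> V 4" "exp_lie h y_ser - y_ser \<in> V 4"
proof -
  have c: "close (1 + 1) (exp_lie h) (\<lambda>g. g + lie h g)"
    by (rule exp_lie_close_derivation[OF nform_shifts[OF h]]) simp
  have "h - const_ser (1 / 2) * y_ser ^ 2 \<in> V 7" using h by (simp add: nform_def)
  from V_dy[OF this] have "ser_dy h - ser_dy (const_ser (1 / 2) * y_ser ^ 2) \<in> V 4"
    by (simp add: ser_dy_diff)
  moreover have "ser_dy (const_ser (1 / 2) * y_ser ^ 2) = y_ser"
    by (rule ser_eqI, unfold y2_mon) (simp add: y_ser_mon cf_mon)
  moreover have "lie h x_ser = ser_dy h" by (simp add: lie_def poisson_x_y)
  ultimately have "lie h x_ser - y_ser \<in> V 4" by simp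
  moreover have "exp_lie h x_ser - (x_ser + lie h x_ser) \<in> V 4"
    using shiftsD[OF c x_in_V] by simp
  ultimately have "(exp_lie h x_ser - (x_ser + lie h x_ser)) + (lie h x_ser - y_ser) \<in> V 4"
    by (rule filt_add[rotated])
  then show "exp_lie h x_ser - (x_ser + y_ser) \<in> V 4" by (simp add: algebra_simps)
  show "exp_lie h y_ser - y_ser \<in> V 4"
    using shiftsD[OF paut_close[OF exp_lie_paut[OF nform_shifts[OF h]]] y_in_V] by simp
qed

lemma cf_exp_lie_nform:
  assumes h: "nform h"
  shows "cf (exp_lie h g) 1 0 0 = cf g 1 0 0" "cf (exp_lie h g) 0 1 0 = cf g 1 0 0 + cf g 0 1 0"
proof -
  note E = paut_hom[OF exp_lie_paut[OF nform_shifts[OF h]]]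
  let ?G = "(exp_lie h x_ser, exp_lie h y_ser)"
  have "cf (exp_lie h x_ser - (x_ser + y_ser)) 1 0 0 = 0" "cf (exp_lie h x_ser - (x_ser + y_ser)) 0 1 0 = 0"
    "cf (exp_lie h y_ser - y_ser) 1 0 0 = 0" "cf (exp_lie h y_ser - y_ser) 0 1 0 = 0"
    by (rule filtD[OF exp_lie_nform_xy(1)[OF h]] filtD[OF exp_lie_nform_xy(2)[OF h]]; simp)+
  then have "cf (fst ?G) 1 0 0 = 1" "cf (fst ?G) 0 1 0 = 1" "cf (snd ?G) 1 0 0 = 0" "cf (snd ?G) 0 1 0 = 1"
    by (simp_all add: x_ser_mon[unfolded One_nat_def] y_ser_mon[unfolded One_nat_def] cf_mon)
  then show "cf (exp_lie h g) 1 0 0 = cf g 1 0 0" "cf (exp_lie h g) 0 1 0 = cf g 1 0 0 + cf g 0 1 0"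
    using cf_subst_linear[OF hom_fixes_origin[OF E], of g, folded hom_subst_eq[OF E]] by simp_all
qed

text \<open>The linear part is minus the shear that the time-one map of a normal form has at the
  origin, so only the sign prevents the operator of \<open>G\<close> from being unipotent.\<close>

definition normalised :: "fmap \<Rightarrow> bool" where
  "normalised G \<longleftrightarrow> fixes_origin G \<and> jac_det G = 1 \<and>
     cf (fst G) 1 0 0 = - 1 \<and> cf (fst G) 0 1 0 = - 1 \<and> cf (snd G) 1 0 0 = 0 \<and> cf (snd G) 0 1 0 = - 1"

text \<open>Only the linear entries that would keep or lower a weight are prescribed. The
  coefficient of \<open>y\<close> in \<open>A x_ser\<close> is free since \<open>y\<close> is
  heavier than \<open>x\<close>.\<close>

lemma hom_pautI:
  assumes A: "ser_hom A" and jac: "poisson (A x_ser) (A y_ser) = 1"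
    and cf: "cf (A x_ser) 1 0 0 = 1" "cf (A y_ser) 1 0 0 = 0" "cf (A y_ser) 0 1 0 = 1"
  shows "paut A"
proof -
  have o: "cf (A x_ser) 0 0 0 = 0" "cf (A y_ser) 0 0 0 = 0"
    using hom_fixes_origin[OF A] by (simp_all add: fixes_origin_def)
  have "A x_ser - x_ser \<in> V (2 + 1)"
  proof (rule filtI)
    fix i j m :: nat assume "2 * i + 3 * j + 6 * m < 2 + 1"
    then have "j = 0" "m = 0" "i = 0 \<or> i = 1" by auto
    then show "cf (A x_ser - x_ser) i j m = 0" using cf o by (auto simp: x_ser_mon[unfolded One_nat_def] cf_mon)
  qed
  moreover have "A y_ser - y_ser \<in> V (3 + 1)"
  proof (rule filtI)
    fix i j m :: nat assume "2 * i + 3 * j + 6 * m < 3 + 1"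
    then have "m = 0 \<and> (i = 0 \<and> j = 0 \<or> i = 0 \<and> j = 1 \<or> i = 1 \<and> j = 0)" by presburger
    then show "cf (A y_ser - y_ser) i j m = 0" using cf o by (auto simp: y_ser_mon[unfolded One_nat_def] cf_mon)
  qed
  ultimately have "close 1 A (\<lambda>g. g)" by (rule hom_close_idI[OF A])
  then show ?thesis using A jac close_idD by (simp add: paut_def psym_def)
qed

lemma normalised_conjugacy:
  assumes "normalised G"
  obtains T h where "paut T" "nform h" "\<And>g. ser_subst (T g) G = T (exp_lie h (neg g))"
proof -
  have o: "fixes_origin G" using assms by (simp add: normalised_def)
  define M where "M = (\<lambda>g. ser_subst (neg g) G)"
  have Mhom: "ser_hom M" unfolding M_def by (rule hom_comp[OF hom_subst[OF o] neg_hom])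
  have Mxy: "M x_ser = - fst G" "M y_ser = - snd G"
    by (simp_all add: M_def neg_xy hom_uminus[OF hom_subst[OF o]] subst_x[OF o] subst_y[OF o])
  have "paut M"
    by (rule hom_pautI[OF Mhom]) (use assms in \<open>simp_all add: Mxy normalised_def jac_det_poisson
        poisson_uminus_left poisson_uminus_right\<close>)
  moreover have "cf (M x_ser) 0 1 0 = 1" using assms by (simp add: Mxy normalised_def)
  ultimately obtain T h where T: "paut T" "nform h" and eq: "\<And>g. M (flip T g) = T (exp_lie h g)"
    by (rule normal_form_exists) (rule that)
  have "ser_subst (T g) G = T (exp_lie h (neg g))" for g
    using eq[of "neg g"] by (simp add: M_def flip_def)
  then show ?thesis using T that by blast
qed

text \<open>The four equations \<open>lin\<close> say \<open>P A = - J P\<close>, where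
  \<open>A\<close> is the linear part of \<open>F\<close>, \<open>P\<close> has the rows
  \<open>(p, q)\<close> and \<open>(r, t)\<close>, and \<open>J\<close> is the Jordan block with
  eigenvalue 1.\<close>

lemma conjugacy_to_normalised:
  assumes F: "fixes_origin F" "jac_det F = 1"
    and lin: "p * cf (fst F) 1 0 0 + q * cf (snd F) 1 0 0 = - (p + r)"
      "p * cf (fst F) 0 1 0 + q * cf (snd F) 0 1 0 = - (q + t)"
      "r * cf (fst F) 1 0 0 + t * cf (snd F) 1 0 0 = - r"
      "r * cf (fst F) 0 1 0 + t * cf (snd F) 0 1 0 = - t"
    and det: "(p * t - q * r)^2 = 1"
  obtains L L' where "fmap_inverse L L'" "area_preserving L" "normalised (fmap_comp L (fmap_comp F L'))"
proof -
  define D where "D = p * t - q * r"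
  define L where "L = lin_map p q r t"
  define L' where "L' = lin_map (D * t) (- D * q) (- D * r) (D * p)"
  have inv: "fmap_inverse L L'" unfolding L_def L'_def D_def by (rule lin_map_inverse[OF det])
  have o: "fixes_origin L" "fixes_origin L'" by (simp_all add: L_def L'_def fixes_origin_lin_map)
  have DD: "D * D = 1" using det by (simp add: D_def power2_eq_square)
  have jL: "jac_det L = const_ser D" by (simp add: L_def D_def jac_det_lin_map)
  have "D * t * (D * p) - - D * q * (- D * r) = (D * D) * D" by (simp add: D_def algebra_simps)
  then have jL': "jac_det L' = const_ser D" by (simp add: L'_def jac_det_lin_map DD)
  have "D = 1 \<or> D = -1" using det by (simp add: D_def power2_eq_1_iff)
  then have "area_preserving L" by (auto simp: area_preserving_def jL const_ser_uminus)
  note FL' = subst_comp[OF F(1) o(2)]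
  note LFL' = subst_comp[OF o(1) FL'(2)]
  have jac: "jac_det (fmap_comp L (fmap_comp F L')) = 1"
    using DD by (simp add: jac_det_comp o F FL' FL'(2) jL jL' subst_const
        subst_one const_ser_mult[symmetric])
  have a: "cf (fst (fmap_comp L (fmap_comp F L'))) 1 0 0 =
      (p * cf (fst F) 1 0 0 + q * cf (snd F) 1 0 0) * (D * t) + (p * cf (fst F) 0 1 0 + q * cf (snd F) 0 1 0) * (- D * r)"
    and b: "cf (fst (fmap_comp L (fmap_comp F L'))) 0 1 0 =
      (p * cf (fst F) 1 0 0 + q * cf (snd F) 1 0 0) * (- D * q) + (p * cf (fst F) 0 1 0 + q * cf (snd F) 0 1 0) * (D * p)"
    and c: "cf (snd (fmap_comp L (fmap_comp F L'))) 1 0 0 =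
      (r * cf (fst F) 1 0 0 + t * cf (snd F) 1 0 0) * (D * t) + (r * cf (fst F) 0 1 0 + t * cf (snd F) 0 1 0) * (- D * r)"
    and d: "cf (snd (fmap_comp L (fmap_comp F L'))) 0 1 0 =
      (r * cf (fst F) 1 0 0 + t * cf (snd F) 1 0 0) * (- D * q) + (r * cf (fst F) 0 1 0 + t * cf (snd F) 0 1 0) * (D * p)"
    unfolding fmap_comp_def[of L] fst_conv snd_conv cf_subst_linear[OF FL'(2)]
    unfolding fmap_comp_def[of F] fst_conv snd_conv cf_subst_linear[OF o(2)]
    unfolding L_def L'_def cf_lin_map
    by (simp_all add: algebra_simps)
  have "- (p + r) * (D * t) + - (q + t) * (- D * r) = - (D * D)" "- (p + r) * (- D * q) + - (q + t) * (D * p) = - (D * D)"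
    "- r * (D * t) + - t * (- D * r) = 0" "- r * (- D * q) + - t * (D * p) = - (D * D)"
    by (simp_all add: D_def algebra_simps)
  then have "normalised (fmap_comp L (fmap_comp F L'))"
    unfolding normalised_def a b c d lin using LFL'(2) jac DD by simp
  then show ?thesis using inv \<open>area_preserving L\<close> that by blast
qed

lemma formal_existence:
  assumes F: "fixes_origin F" and L: "fmap_inverse L L'" "area_preserving L"
    and G: "normalised (fmap_comp L (fmap_comp F L'))"
  obtains \<phi> u where "canonical_change \<phi>" "conjugates \<phi> F (fmap_uminus (time_one (ham u)))"
proof -
  have o: "fixes_origin L" "fixes_origin L'" using L(1) by (simp_all add: fmap_inverse_def)
  obtain T h where T: "paut T" and h: "nform h"
    and eq: "\<And>g. ser_subst (T g) (fmap_comp L (fmap_comp F L')) = T (exp_lie h (neg g))"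
    by (rule normalised_conjugacy[OF G]) (rule that)
  obtain u where u: "h = ham u" by (rule nform_ham_ex[OF h])
  let ?I = "Hilbert_Choice.inv T" and ?K = "fmap_uminus (time_one h)"
  note I = paut_inv[OF T]
  define \<phi>1 where "\<phi>1 = (T x_ser, T y_ser)"
  define \<psi>1 where "\<psi>1 = (?I x_ser, ?I y_ser)"
  have S1: "ser_subst g \<phi>1 = T g" "ser_subst g \<psi>1 = ?I g" for g
    unfolding \<phi>1_def \<psi>1_def
    by (rule hom_subst_eq[OF paut_hom[OF T], symmetric] hom_subst_eq[OF paut_hom[OF I], symmetric])+
  have o1: "fixes_origin \<phi>1" "fixes_origin \<psi>1"
    unfolding \<phi>1_def \<psi>1_def by (rule hom_fixes_origin paut_hom T I)+
  define \<phi> where "\<phi> = fmap_comp \<phi>1 L"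
  define \<psi> where "\<psi> = fmap_comp L' \<psi>1"
  have S: "ser_subst g \<phi> = ser_subst (T g) L" "ser_subst g \<psi> = ?I (ser_subst g L')" for g
    by (simp_all add: \<phi>_def \<psi>_def subst_comp o o1 S1)
  have o\<phi>: "fixes_origin \<phi>" "fixes_origin \<psi>" by (simp_all add: \<phi>_def \<psi>_def subst_comp o o1)
  have inv: "fmap_inverse \<phi> \<psi>"
    by (rule fmap_inverseI[OF o\<phi>]) (simp_all add: S inverse_subst[OF L(1)] paut_inv_f[OF T] paut_f_inv[OF T])
  have "jac_det \<phi>1 = 1" using T by (simp add: \<phi>1_def jac_det_poisson paut_def psym_def)
  then have "jac_det \<phi> = jac_det L" by (simp add: \<phi>_def jac_det_comp o1 o subst_one)
  then have can: "canonical_change \<phi>" using L(2) o\<phi> by (simp add: canonical_change_def area_preserving_def)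
  note K = subst_time_one[OF nform_shifts[OF h]]
  have "F = fmap_comp \<psi> (fmap_comp ?K \<phi>)"
  proof (rule fmap_eqI[OF F])
    show "fixes_origin (fmap_comp \<psi> (fmap_comp ?K \<phi>))" by (simp add: subst_comp o\<phi> K)
    fix g
    have "ser_subst g (fmap_comp \<psi> (fmap_comp ?K \<phi>)) = ser_subst (T (exp_lie h (neg (?I (ser_subst g L'))))) L"
      by (simp add: subst_comp o\<phi> K S)
    also have "\<dots> = ser_subst (ser_subst (ser_subst g L') (fmap_comp L (fmap_comp F L'))) L"
      by (simp add: eq[symmetric] paut_f_inv[OF T])
    also have "\<dots> = ser_subst g F"
      by (simp add: subst_comp o F inverse_subst[OF L(1)])
    finally show "ser_subst g F = ser_subst g (fmap_comp \<psi> (fmap_comp ?K \<phi>))" by simp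
  qed
  then have "conjugates \<phi> F (fmap_uminus (time_one (ham u)))"
    unfolding conjugates_def u[symmetric] using inv by blast
  then show ?thesis using can that by blast
qed

text \<open>At linear order \<open>T\<close> commutes with the shear, so its linear part is
  triangular with equal diagonal entries \<open>p\<close>, and its Jacobian is \<open>p * p\<close>.
  This excludes a reversal of orientation and leaves \<open>p = 1\<close>, the unipotent case, and
  \<open>p = -1\<close>.\<close>

lemma conjugacy_unique:
  assumes h: "nform h" and k: "nform k" and T: "ser_hom T"
    and jac: "poisson (T x_ser) (T y_ser) = 1 \<or> poisson (T x_ser) (T y_ser) = -1"
    and eq: "\<And>g. T (exp_lie h (neg g)) = exp_lie k (neg (T g))"
  shows "h = k"
proof -
  have unip: "h = k" if A: "ser_hom A" and jac: "poisson (A x_ser) (A y_ser) = 1 \<or> poisson (A x_ser) (A y_ser) = -1"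
    and eq: "\<And>g. A (exp_lie h (neg g)) = exp_lie k (neg (A g))"
    and one: "cf (A x_ser) 1 0 0 = 1" "cf (A y_ser) 1 0 0 = 0" "cf (A y_ser) 0 1 0 = 1" for A
  proof -
    have "cf (poisson (A x_ser) (A y_ser)) 0 0 0 = 1"
      using one by (simp add: poisson_def cf_mult)
    then have "poisson (A x_ser) (A y_ser) = 1" using jac by (auto simp: cf_1)
    from hom_pautI[OF A this one] have "paut A" .
    then show ?thesis
      by (rule normal_form_unique[OF h k]) (use eq[of "neg g" for g] in \<open>simp add: flip_def\<close>)
  qed
  let ?G = "(T x_ser, T y_ser)"
  define p where "p = cf (T x_ser) 1 0 0"
  have Tlin: "cf (T g) 1 0 0 = cf g 1 0 0 * p + cf g 0 1 0 * cf (T y_ser) 1 0 0"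
    "cf (T g) 0 1 0 = cf g 1 0 0 * cf (T x_ser) 0 1 0 + cf g 0 1 0 * cf (T y_ser) 0 1 0" for g
    using cf_subst_linear[OF hom_fixes_origin[OF T], of g, folded hom_subst_eq[OF T]] by (simp_all add: p_def)
  have x: "cf x_ser 1 0 0 = 1" "cf x_ser 0 1 0 = 0" by (simp_all add: x_ser_mon cf_mon)
  have e: "cf (exp_lie h (neg x_ser)) 1 0 0 = - 1" "cf (exp_lie h (neg x_ser)) 0 1 0 = - 1"
    unfolding cf_exp_lie_nform[OF h] cf_neg using x by simp_all
  have r: "cf (T y_ser) 1 0 0 = 0"
    using arg_cong[OF eq[of x_ser], of "\<lambda>f. cf f 1 0 0"]
    unfolding cf_exp_lie_nform[OF k] Tlin(1)[of "exp_lie h u" for u] e cf_neg by (simp add: p_def)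
  have t: "cf (T y_ser) 0 1 0 = p"
    using arg_cong[OF eq[of x_ser], of "\<lambda>f. cf f 0 1 0"]
    unfolding cf_exp_lie_nform[OF k] Tlin(2)[of "exp_lie h u" for u] e cf_neg by (simp add: p_def)
  have "cf (poisson (T x_ser) (T y_ser)) 0 0 0 = p * p"
    using r t by (simp add: poisson_def cf_mult p_def)
  then have "p * p = 1 \<or> p * p = - 1" using jac by (auto simp: cf_1)
  then have "p * p = 1" using zero_le_square[of p] by linarith
  then consider "p = 1" | "p = -1" by (metis square_eq_1_iff)
  then show ?thesis
  proof cases
    case 1
    then show ?thesis using unip[OF T jac eq] r t by (simp add: p_def)
  next
    case 2
    \<comment> \<open>The central symmetry commutes with the flow of the even \<open>k\<close>, so
      composing \<open>T\<close> with it preserves the equation and reduces \<open>p = -1\<close> to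
      \<open>p = 1\<close>.\<close>
    have sk: "neg (exp_lie k (neg g)) = exp_lie k g" for g
      using flip_exp_lie[OF nform_shifts[OF k], of g] by (simp add: flip_def nform_neg[OF k])
    show ?thesis
    proof (rule unip[of "\<lambda>g. neg (T g)"])
      show "ser_hom (\<lambda>g. neg (T g))" by (rule hom_comp[OF neg_hom T])
      show "poisson (neg (T x_ser)) (neg (T y_ser)) = 1 \<or> poisson (neg (T x_ser)) (neg (T y_ser)) = -1"
        using jac by (auto simp: psym_poisson[OF neg_psym] hom_one[OF neg_hom] hom_uminus[OF neg_hom])
      show "neg (T (exp_lie h (neg g))) = exp_lie k (neg (neg (T g)))" for g
        by (simp add: eq sk)
    qed (use r t 2 in \<open>simp_all add: cf_neg p_def\<close>)
  qed
qed

lemma formal_uniqueness: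
  assumes F: "fixes_origin F"
    and c: "canonical_change \<phi>" "conjugates \<phi> F (fmap_uminus (time_one (ham u)))"
      "canonical_change \<phi>'" "conjugates \<phi>' F (fmap_uminus (time_one (ham u')))"
    and km: "1 \<le> k" "2 \<le> k + 2 * m"
  shows "u k m = u' k m"
proof -
  let ?h = "ham (drop_const u)" and ?h' = "ham (drop_const u')"
  note K = subst_time_one[OF nform_shifts[OF nform_ham[of u]]]
    and K' = subst_time_one[OF nform_shifts[OF nform_ham[of u']]]
  obtain \<psi> where \<psi>: "fmap_inverse \<phi> \<psi>" "F = fmap_comp \<psi> (fmap_comp (fmap_uminus (time_one ?h)) \<phi>)"
    using c(2) by (auto simp: conjugates_def time_one_drop_const[of u])
  obtain \<psi>' where \<psi>': "fmap_inverse \<phi>' \<psi>'" "F = fmap_comp \<psi>' (fmap_comp (fmap_uminus (time_one ?h')) \<phi>')"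
    using c(4) by (auto simp: conjugates_def time_one_drop_const[of u'])
  have o: "fixes_origin \<phi>" "fixes_origin \<psi>'" "fixes_origin \<phi>'"
    using \<psi>(1) \<psi>'(1) by (simp_all add: fmap_inverse_def)
  define T where "T = (\<lambda>g. ser_subst (ser_subst g \<phi>) \<psi>')"
  have T: "ser_hom T" unfolding T_def by (rule hom_comp[OF hom_subst[OF o(2)] hom_subst[OF o(1)]])
  have S: "ser_subst g F = ser_subst (exp_lie ?h (neg (ser_subst g \<psi>))) \<phi>"
    "ser_subst g F = ser_subst (exp_lie ?h' (neg (ser_subst g \<psi>'))) \<phi>'" for g
    using subst_conjugates[OF \<psi> K(2)] subst_conjugates[OF \<psi>' K'(2)] by (simp_all add: K K')
  have eq: "T (exp_lie ?h (neg g)) = exp_lie ?h' (neg (T g))" for g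
  proof -
    have "ser_subst (exp_lie ?h (neg g)) \<phi> = ser_subst (exp_lie ?h' (neg (T g))) \<phi>'"
      using S[of "ser_subst g \<phi>"] by (simp add: T_def inverse_subst[OF \<psi>(1)])
    then show ?thesis by (simp add: T_def inverse_subst[OF \<psi>'(1)])
  qed
  have one: "ser_subst (- 1) G = - 1" if "fixes_origin G" for G
    by (simp add: hom_uminus[OF hom_subst[OF that]] subst_one[OF that])
  \<comment> \<open>The hypothesis concerns the Jacobian of \<open>\<phi>'\<close> only; that of its
    inverse follows by differentiating \<open>\<psi>' \<circ> \<phi>' = id\<close>.\<close>
  have "jac_det \<phi>' * ser_subst (jac_det \<psi>') \<phi>' = 1"
    using jac_det_comp[OF o(2,3)] \<psi>'(1) by (simp add: fmap_inverse_def fmap_id_def jac_det_poisson poisson_x_y)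
  then have "ser_subst (jac_det \<psi>') \<phi>' = 1 \<or> ser_subst (jac_det \<psi>') \<phi>' = -1"
    using c(3) by (auto simp: canonical_change_def area_preserving_def minus_equation_iff)
  then have "ser_subst (ser_subst (jac_det \<psi>') \<phi>') \<psi>' = 1 \<or> ser_subst (ser_subst (jac_det \<psi>') \<phi>') \<psi>' = -1"
    using one[OF o(2)] subst_one[OF o(2)] by auto
  then have jac': "jac_det \<psi>' = 1 \<or> jac_det \<psi>' = -1" by (simp add: inverse_subst[OF \<psi>'(1)])
  have "poisson (T x_ser) (T y_ser) = jac_det (fmap_comp \<phi> \<psi>')"
    by (simp add: T_def subst_x[OF o(1)] subst_y[OF o(1)] jac_det_poisson fmap_comp_def)
  then have "poisson (T x_ser) (T y_ser) = 1 \<or> poisson (T x_ser) (T y_ser) = -1"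
    using jac' c(1) by (auto simp: jac_det_comp[OF o(1,2)] canonical_change_def area_preserving_def one[OF o(2)] subst_one[OF o(2)])
  then have "?h = ?h'" by (rule conjugacy_unique[OF nform_ham nform_ham T _ eq])
  then have "cf ?h (2 * k) 0 m = cf ?h' (2 * k) 0 m" by simp
  then show ?thesis using km by (simp add: cf_ham drop_const_def)
qed

section \<open>The linear part\<close>

lemma det_2:
  assumes A: "A \<in> carrier_mat 2 2"
  shows "Determinant.det A = A $$ (0, 0) * A $$ (1, 1) - A $$ (0, 1) * A $$ (1, 0)"
proof -
  have "Determinant.det A = (\<Sum>j<2. A $$ (0, j) * cofactor A 0 j)"
    by (rule laplace_expansion_row[OF A]) simp
  also have "\<dots> = A $$ (0, 0) * cofactor A 0 0 + A $$ (0, 1) * cofactor A 0 1"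
    by (simp add: numeral_2_eq_2)
  also have "cofactor A 0 0 = A $$ (1, 1)"
    using A by (simp add: cofactor_def det_single mat_delete_def)
  also have "cofactor A 0 1 = - A $$ (1, 0)"
    using A by (simp add: cofactor_def det_single mat_delete_def)
  finally show ?thesis by simp
qed

lemma lin_part_carrier: "lin_part F \<in> carrier_mat 2 2"
  by (simp add: lin_part_def mat_of_rows_list_def numeral_2_eq_2)

lemma lin_part_index:
  "lin_part F $$ (0, 0) = cf (fst F) 1 0 0" "lin_part F $$ (0, 1) = cf (fst F) 0 1 0"
  "lin_part F $$ (1, 0) = cf (snd F) 1 0 0" "lin_part F $$ (1, 1) = cf (snd F) 0 1 0"
  by (simp_all add: lin_part_def mat_of_rows_list_def)

text \<open>The characteristic polynomial is monic of degree 2 and divisible by the square of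
  \<open>[:1, 1:]\<close>, hence equal to it; trace and determinant are its coefficients.\<close>

lemma lin_part_trace_det:
  assumes "Polynomial.order (-1) (char_poly (lin_part F)) = 2"
  shows "cf (fst F) 1 0 0 + cf (snd F) 0 1 0 = - 2"
    and "cf (fst F) 1 0 0 * cf (snd F) 0 1 0 - cf (fst F) 0 1 0 * cf (snd F) 1 0 0 = 1"
proof -
  let ?A = "lin_part F" and ?p = "char_poly (lin_part F)"
  note A = lin_part_carrier[of F]
  have "degree ?p = 2" "lead_coeff ?p = 1" using degree_monic_char_poly[OF A] by auto
  have "?p \<noteq> 0" using \<open>lead_coeff ?p = 1\<close> by auto
  have p: "?p = [: ?A $$ (0, 0) * ?A $$ (1, 1) - ?A $$ (0, 1) * ?A $$ (1, 0), - (?A $$ (0, 0) + ?A $$ (1, 1)), 1 :]"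
    using A by (simp add: char_poly_def det_2 char_poly_matrix_def algebra_simps)
  have "[:1, 1:] ^ 2 dvd ?p" using order_1[of "-1" ?p] assms by simp
  then obtain r where r: "?p = [:1, 1:] ^ 2 * r" by (rule dvdE)
  have "degree ([:1, 1:] ^ 2 :: real poly) = 2" by (simp add: degree_power_eq)
  then have "degree r = 0" using \<open>?p \<noteq> 0\<close> \<open>degree ?p = 2\<close> unfolding r by (subst (asm) degree_mult_eq) auto
  then obtain c where "r = [:c:]" by (rule degree_eq_zeroE)
  then have "?p = [:c, 2 * c, c:]" using r by (simp add: power2_eq_square)
  then show "cf (fst F) 1 0 0 + cf (snd F) 0 1 0 = - 2"
    and "cf (fst F) 1 0 0 * cf (snd F) 0 1 0 - cf (fst F) 0 1 0 * cf (snd F) 1 0 0 = 1"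
    unfolding p lin_part_index by auto
qed

lemma lin_part_off_diagonal:
  assumes "\<not> diagonalisable (lin_part F)"
  shows "cf (fst F) 0 1 0 \<noteq> 0 \<or> cf (snd F) 1 0 0 \<noteq> 0"
proof (rule ccontr)
  assume *: "\<not> (cf (fst F) 0 1 0 \<noteq> 0 \<or> cf (snd F) 1 0 0 \<noteq> 0)"
  have "diagonal_mat (lin_part F)" unfolding diagonal_mat_def
  proof (intro allI impI)
    fix i j assume "i < dim_row (lin_part F)" "j < dim_col (lin_part F)" "i \<noteq> j"
    then have "(i = 0 \<and> j = 1) \<or> (i = 1 \<and> j = 0)" using lin_part_carrier[of F] by auto
    then show "lin_part F $$ (i, j) = 0" using * lin_part_index[of F] by auto
  qed
  moreover have "similar_mat (lin_part F) (lin_part F)" by (rule similar_mat_refl[OF lin_part_carrier])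
  ultimately show False using assms unfolding diagonalisable_def by blast
qed

text \<open>In \<open>P A = - J P\<close> the second row of \<open>P\<close> is minus the first row
  times \<open>A + 1\<close>, and the remaining equation holds because \<open>A + 1\<close> has
  square 0. The first row is taken as a multiple of a coordinate vector not annihilated by
  \<open>A + 1\<close>. The scaling makes the determinant 1 or -1; its sign depends on that of the
  off-diagonal entry, which is where a reflection may be needed.\<close>

lemma normalising_change:
  assumes F: "fixes_origin F" "jac_det F = 1"
    and order: "Polynomial.order (-1) (char_poly (lin_part F)) = 2"
    and nd: "\<not> diagonalisable (lin_part F)"
  obtains L L' where "fmap_inverse L L'" "area_preserving L" "normalised (fmap_comp L (fmap_comp F L'))"
proof -
  define a where "a = cf (fst F) 1 0 0"
  define b where "b = cf (fst F) 0 1 0"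
  define c where "c = cf (snd F) 1 0 0"
  define d where "d = - 2 - a"
  have d': "cf (snd F) 0 1 0 = d" using lin_part_trace_det(1)[OF order] by (simp add: a_def d_def)
  have bc: "b * c = - ((a + 1) * (a + 1))"
    using lin_part_trace_det(2)[OF order] unfolding d' by (simp add: a_def b_def c_def d_def algebra_simps)
  show ?thesis
  proof (cases "b = 0")
    case False
    define s where "s = 1 / sqrt \<bar>b\<bar>"
    have ss: "s * s * \<bar>b\<bar> = 1" using False by (simp add: s_def field_simps)
    show ?thesis
    proof (rule conjugacy_to_normalised[OF F, of s 0 "- s * (a + 1)" "- s * b"])
      have "(s * (- s * b) - 0 * (- s * (a + 1)))\<^sup>2 = (s * s * \<bar>b\<bar>)\<^sup>2"
        by (simp add: power_mult_distrib)
      then show "(s * (- s * b) - 0 * (- s * (a + 1)))\<^sup>2 = 1" by (simp only: ss) simp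
      have "- s * (a + 1) * a + - s * b * c = - s * ((a + 1) * a + b * c)" by (simp add: algebra_simps)
      then show "- s * (a + 1) * cf (fst F) 1 0 0 + - s * b * cf (snd F) 1 0 0 = - (- s * (a + 1))"
        unfolding a_def[symmetric] c_def[symmetric] bc by (simp add: algebra_simps)
      show "- s * (a + 1) * cf (fst F) 0 1 0 + - s * b * cf (snd F) 0 1 0 = - (- s * b)"
        unfolding b_def[symmetric] d' by (simp add: d_def algebra_simps)
    qed (use that in \<open>auto simp: a_def b_def algebra_simps\<close>)
  next
    case True
    then have a: "a = - 1" using bc by auto
    have c: "c \<noteq> 0" using lin_part_off_diagonal[OF nd] True by (simp add: b_def c_def)
    define t where "t = 1 / sqrt \<bar>c\<bar>"
    have tt: "t * t * \<bar>c\<bar> = 1" using c by (simp add: t_def field_simps)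
    show ?thesis
    proof (rule conjugacy_to_normalised[OF F, of 0 t "- t * c" 0])
      have "(0 * 0 - t * (- t * c))\<^sup>2 = (t * t * \<bar>c\<bar>)\<^sup>2" by (simp add: power_mult_distrib)
      then show "(0 * 0 - t * (- t * c))\<^sup>2 = 1" by (simp only: tt) simp
    qed (use that True a d' in \<open>auto simp: a_def b_def c_def d_def\<close>)
  qed
qed

lemma normal_form_of_family:
  assumes "area_preserving F"
    and origin: "fixes_origin F"
    and double_eigenvalue: "Polynomial.order (-1) (char_poly (lin_part F)) = 2"
    and not_diagonalisable: "\<not> diagonalisable (lin_part F)"
  obtains \<phi> u where "canonical_change \<phi>" "conjugates \<phi> F (fmap_uminus (time_one (ham u)))"
proof -
  \<comment> \<open>The double eigenvalue -1 gives determinant 1 at the origin, which decides the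
    sign in \<open>area_preserving\<close>.\<close>
  have "cf (jac_det F) 0 0 0 = 1"
    using lin_part_trace_det(2)[OF double_eigenvalue] by (simp add: jac_det_def cf_mult)
  then have "jac_det F = 1" using assms(1) by (auto simp: area_preserving_def cf_1)
  from normalising_change[OF origin this double_eigenvalue not_diagonalisable]
  obtain L L' where "fmap_inverse L L'" "area_preserving L" "normalised (fmap_comp L (fmap_comp F L'))" by blast
  from formal_existence[OF origin this] show ?thesis using that by blast
qed

section \<open>Taylor series of smooth families\<close>

text \<open>Directional derivatives treat the three partial derivatives uniformly, so each rule is
  proved once for all \<open>v \<in> axes\<close>.\<close>

definition dd :: "pt \<Rightarrow> (pt \<Rightarrow> real) \<Rightarrow> pt \<Rightarrow> real" where
  "dd v f p = deriv (\<lambda>t. f (p + t *\<^sub>R v)) 0"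

definition diffdir :: "pt \<Rightarrow> (pt \<Rightarrow> real) \<Rightarrow> pt \<Rightarrow> bool" where
  "diffdir v f p \<longleftrightarrow> (\<lambda>t. f (p + t *\<^sub>R v)) field_differentiable (at 0)"

definition axes :: "pt set" where "axes = {(1, 0, 0), (0, 1, 0), (0, 0, 1)}"

lemma DERIV_shift_0: "((\<lambda>t. g (x + t)) has_field_derivative D) (at 0) \<longleftrightarrow> (g has_field_derivative D) (at x)"
  for g :: "real \<Rightarrow> real"
  using DERIV_shift[of g D 0 x] by (simp add: add.commute)

lemma deriv_shift_0: "deriv (\<lambda>t. g (x + t)) 0 = deriv g x" for g :: "real \<Rightarrow> real"
  by (simp add: deriv_def DERIV_shift_0)

lemma field_differentiable_shift_0:
  "(\<lambda>t. g (x + t)) field_differentiable (at 0) \<longleftrightarrow> g field_differentiable (at x)" for g :: "real \<Rightarrow> real"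
  by (simp add: field_differentiable_def DERIV_shift_0)

lemma partials_dd: "pdx f = dd (1, 0, 0) f" "pdy f = dd (0, 1, 0) f" "pde f = dd (0, 0, 1) f"
  using deriv_shift_0[of "\<lambda>t. f (t, y, e)" x for x y e] deriv_shift_0[of "\<lambda>t. f (x, t, e)" y for x y e]
    deriv_shift_0[of "\<lambda>t. f (x, y, t)" e for x y e]
  by (auto simp: fun_eq_iff pdx_def pdy_def pde_def dd_def)

lemma has_partials_on_diffdir: "has_partials_on S f \<longleftrightarrow> (\<forall>v\<in>axes. \<forall>p\<in>S. diffdir v f p)"
proof -
  have "diffdir (1, 0, 0) f (x, y, e) \<longleftrightarrow> (\<lambda>t. f (t, y, e)) field_differentiable (at x)"
    "diffdir (0, 1, 0) f (x, y, e) \<longleftrightarrow> (\<lambda>t. f (x, t, e)) field_differentiable (at y)"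
    "diffdir (0, 0, 1) f (x, y, e) \<longleftrightarrow> (\<lambda>t. f (x, y, t)) field_differentiable (at e)" for x y e
    using field_differentiable_shift_0[of "\<lambda>t. f (t, y, e)" x] field_differentiable_shift_0[of "\<lambda>t. f (x, t, e)" y]
      field_differentiable_shift_0[of "\<lambda>t. f (x, y, t)" e]
    by (auto simp: diffdir_def)
  then show ?thesis by (auto simp: has_partials_on_def axes_def)
qed

lemma Ck_on_Suc:
  "Ck_on (Suc k) S f \<longleftrightarrow> continuous_on S f \<and> (\<forall>v\<in>axes. (\<forall>p\<in>S. diffdir v f p) \<and> Ck_on k S (dd v f))"
  by (auto simp: has_partials_on_diffdir partials_dd axes_def)

lemma Ck_on_mono: "Ck_on (Suc k) S f \<Longrightarrow> Ck_on k S f"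
  by (induction k arbitrary: f) (simp, simp only: Ck_on_Suc, blast)

lemma smooth_onD:
  assumes "smooth_on S f" "v \<in> axes"
  shows "continuous_on S f" "smooth_on S (dd v f)" "p \<in> S \<Longrightarrow> diffdir v f p"
proof -
  have "Ck_on (Suc k) S f" for k using assms(1) by (simp add: smooth_on_def del: Ck_on.simps)
  then show "continuous_on S f" "smooth_on S (dd v f)" "p \<in> S \<Longrightarrow> diffdir v f p"
    using assms(2) unfolding Ck_on_Suc smooth_on_def by blast+
qed

lemma eventually_on_line:
  assumes "open S" "(p::pt) \<in> S" shows "eventually (\<lambda>t. p + t *\<^sub>R v \<in> S) (nhds 0)"
proof -
  have "((\<lambda>t. p + t *\<^sub>R v) \<longlongrightarrow> p + 0 *\<^sub>R v) (nhds 0)"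
    by (intro tendsto_intros filterlim_ident)
  then show ?thesis using assms by (simp add: topological_tendstoD)
qed

lemma dd_cong:
  assumes "open S" "p \<in> S" "\<And>q. q \<in> S \<Longrightarrow> f q = g q"
  shows "dd v f p = dd v g p" "diffdir v f p \<longleftrightarrow> diffdir v g p"
proof -
  have ev: "eventually (\<lambda>t. f (p + t *\<^sub>R v) = g (p + t *\<^sub>R v)) (nhds 0)"
    using eventually_on_line[OF assms(1,2)] by (rule eventually_mono) (rule assms(3))
  show "dd v f p = dd v g p" unfolding dd_def by (rule deriv_cong_ev[OF ev refl])
  show "diffdir v f p \<longleftrightarrow> diffdir v g p" unfolding diffdir_def field_differentiable_def
    using DERIV_cong_ev[OF refl ev refl] by simp
qed

lemma Ck_on_cong:
  assumes "open S" "\<And>q. q \<in> S \<Longrightarrow> f q = g q" "Ck_on k S f" shows "Ck_on k S g"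
  using assms(2,3)
proof (induction k arbitrary: f g)
  case 0 then show ?case by (simp cong: continuous_on_cong)
next
  case (Suc k)
  have "continuous_on S g" using Suc.prems by (simp cong: continuous_on_cong)
  moreover have "\<forall>p\<in>S. diffdir v g p" "Ck_on k S (dd v g)" if "v \<in> axes" for v
  proof -
    have d: "\<forall>p\<in>S. diffdir v f p" "Ck_on k S (dd v f)" using Suc.prems(2) that unfolding Ck_on_Suc by blast+
    note c = dd_cong[OF assms(1), of _ f g v, OF _ Suc.prems(1)]
    show "\<forall>p\<in>S. diffdir v g p" using d(1) c(2) by blast
    show "Ck_on k S (dd v g)" by (rule Suc.IH[OF c(1) d(2)])
  qed
  ultimately show ?case unfolding Ck_on_Suc by blast
qed

lemma dd_add: "diffdir v f p \<Longrightarrow> diffdir v g p \<Longrightarrow> dd v (\<lambda>q. f q + g q) p = dd v f p + dd v g p"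
  and dd_diff: "diffdir v f p \<Longrightarrow> diffdir v g p \<Longrightarrow> dd v (\<lambda>q. f q - g q) p = dd v f p - dd v g p"
  and dd_mult: "diffdir v f p \<Longrightarrow> diffdir v g p \<Longrightarrow> dd v (\<lambda>q. f q * g q) p = dd v f p * g p + f p * dd v g p"
  and diffdir_add: "diffdir v f p \<Longrightarrow> diffdir v g p \<Longrightarrow> diffdir v (\<lambda>q. f q + g q) p"
  and diffdir_diff: "diffdir v f p \<Longrightarrow> diffdir v g p \<Longrightarrow> diffdir v (\<lambda>q. f q - g q) p"
  and diffdir_mult: "diffdir v f p \<Longrightarrow> diffdir v g p \<Longrightarrow> diffdir v (\<lambda>q. f q * g q) p"
  by (simp_all add: dd_def diffdir_def deriv_add deriv_diff deriv_mult field_differentiable_add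
      field_differentiable_diff field_differentiable_mult)

lemma Ck_on_add:
  assumes "open S" "Ck_on k S f" "Ck_on k S g"
  shows "Ck_on k S (\<lambda>q. f q + g q)" "Ck_on k S (\<lambda>q. f q - g q)"
  using assms(2,3)
proof (induction k arbitrary: f g)
  case 0
  { case 1 then show ?case by (simp add: continuous_on_add)
  next case 2 then show ?case by (simp add: continuous_on_diff) }
next
  case (Suc k)
  have "\<forall>p\<in>S. diffdir v (\<lambda>q. f q + g q) p" "Ck_on k S (dd v (\<lambda>q. f q + g q))"
    "\<forall>p\<in>S. diffdir v (\<lambda>q. f q - g q) p" "Ck_on k S (dd v (\<lambda>q. f q - g q))"
    if v: "v \<in> axes" "Ck_on (Suc k) S f" "Ck_on (Suc k) S g" for v f g
  proof -
    have d: "\<forall>p\<in>S. diffdir v f p" "\<forall>p\<in>S. diffdir v g p" "Ck_on k S (dd v f)" "Ck_on k S (dd v g)"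
      using v unfolding Ck_on_Suc by blast+
    show "\<forall>p\<in>S. diffdir v (\<lambda>q. f q + g q) p" "\<forall>p\<in>S. diffdir v (\<lambda>q. f q - g q) p"
      using d diffdir_add diffdir_diff by blast+
    show "Ck_on k S (dd v (\<lambda>q. f q + g q))"
      by (rule Ck_on_cong[OF assms(1) _ Suc.IH(1)[OF d(3,4)]]) (use d in \<open>simp add: dd_add\<close>)
    show "Ck_on k S (dd v (\<lambda>q. f q - g q))"
      by (rule Ck_on_cong[OF assms(1) _ Suc.IH(2)[OF d(3,4)]]) (use d in \<open>simp add: dd_diff\<close>)
  qed
  note * = this
  { case 1
    then have "continuous_on S (\<lambda>q. f q + g q)" unfolding Ck_on_Suc by (blast intro: continuous_on_add)
    then show ?case unfolding Ck_on_Suc[of k S "\<lambda>q. f q + g q"] using *(1,2)[OF _ 1] by blast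
  next
    case 2
    then have "continuous_on S (\<lambda>q. f q - g q)" unfolding Ck_on_Suc by (blast intro: continuous_on_diff)
    then show ?case unfolding Ck_on_Suc[of k S "\<lambda>q. f q - g q"] using *(3,4)[OF _ 2] by blast }
qed

lemma Ck_on_mult:
  assumes "open S" "Ck_on k S f" "Ck_on k S g" shows "Ck_on k S (\<lambda>q. f q * g q)"
  using assms(2,3)
proof (induction k arbitrary: f g)
  case 0 then show ?case by (simp add: continuous_on_mult)
next
  case (Suc k)
  have k: "Ck_on k S f" "Ck_on k S g" using Suc.prems Ck_on_mono by blast+
  have "\<forall>p\<in>S. diffdir v (\<lambda>q. f q * g q) p" "Ck_on k S (dd v (\<lambda>q. f q * g q))" if v: "v \<in> axes" for v
  proof -
    have d: "\<forall>p\<in>S. diffdir v f p" "\<forall>p\<in>S. diffdir v g p" "Ck_on k S (dd v f)" "Ck_on k S (dd v g)"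
      using Suc.prems v unfolding Ck_on_Suc by blast+
    show "\<forall>p\<in>S. diffdir v (\<lambda>q. f q * g q) p" using d diffdir_mult by blast
    show "Ck_on k S (dd v (\<lambda>q. f q * g q))"
      by (rule Ck_on_cong[OF assms(1) _ Ck_on_add(1)[OF assms(1) Suc.IH[OF d(3) k(2)] Suc.IH[OF k(1) d(4)]]])
        (use d in \<open>simp add: dd_mult\<close>)
  qed
  moreover have "continuous_on S (\<lambda>q. f q * g q)"
    using Suc.prems unfolding Ck_on_Suc by (blast intro: continuous_on_mult)
  ultimately show ?case unfolding Ck_on_Suc[of k S "\<lambda>q. f q * g q"] by blast
qed

lemma smooth_on_diff: "open S \<Longrightarrow> smooth_on S f \<Longrightarrow> smooth_on S g \<Longrightarrow> smooth_on S (\<lambda>q. f q - g q)"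
  and smooth_on_mult: "open S \<Longrightarrow> smooth_on S f \<Longrightarrow> smooth_on S g \<Longrightarrow> smooth_on S (\<lambda>q. f q * g q)"
  by (simp_all add: smooth_on_def Ck_on_add Ck_on_mult)

section \<open>Symmetry of mixed partial derivatives\<close>

lemma dd_has_derivative:
  assumes "diffdir v f (q + s *\<^sub>R v)"
  shows "((\<lambda>t. f (q + t *\<^sub>R v)) has_real_derivative dd v f (q + s *\<^sub>R v)) (at s)"
proof -
  have "((\<lambda>t. f (q + s *\<^sub>R v + t *\<^sub>R v)) has_real_derivative dd v f (q + s *\<^sub>R v)) (at 0)"
    using assms unfolding diffdir_def dd_def by (simp add: field_differentiable_derivI)
  then have "((\<lambda>t. (\<lambda>t. f (q + t *\<^sub>R v)) (s + t)) has_real_derivative dd v f (q + s *\<^sub>R v)) (at 0)"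
    by (simp add: scaleR_add_left add.assoc)
  then show ?thesis by (rule iffD1[OF DERIV_shift_0[of "\<lambda>t. f (q + t *\<^sub>R v)" s]])
qed

text \<open>The mean value theorem in direction \<open>v\<close> and then in direction
  \<open>w\<close>. The second difference is symmetric in \<open>v\<close> and \<open>w\<close>, so
  the two orders of differentiation can be compared through it.\<close>

lemma second_difference:
  fixes p v w :: pt and h :: real
  assumes "0 < h" and S: "\<And>s t. 0 \<le> s \<Longrightarrow> s \<le> h \<Longrightarrow> 0 \<le> t \<Longrightarrow> t \<le> h \<Longrightarrow> p + s *\<^sub>R v + t *\<^sub>R w \<in> S"
    and f: "\<And>q. q \<in> S \<Longrightarrow> diffdir v f q" "\<And>q. q \<in> S \<Longrightarrow> diffdir w (dd v f) q"
  obtains s t where "0 < s" "s < h" "0 < t" "t < h"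
    "f (p + h *\<^sub>R v + h *\<^sub>R w) - f (p + h *\<^sub>R v) - f (p + h *\<^sub>R w) + f p = h * (h * dd w (dd v f) (p + s *\<^sub>R v + t *\<^sub>R w))"
proof -
  let ?g = "\<lambda>s. f ((p + h *\<^sub>R w) + s *\<^sub>R v) - f (p + s *\<^sub>R v)"
  have "(?g has_real_derivative dd v f ((p + h *\<^sub>R w) + s *\<^sub>R v) - dd v f (p + s *\<^sub>R v)) (at s)" if "0 \<le> s" "s \<le> h" for s
    using S[of s h] S[of s 0] that \<open>0 < h\<close>
    by (intro DERIV_diff dd_has_derivative f) (simp_all add: algebra_simps)
  from MVT2[OF \<open>0 < h\<close> this] obtain s where s: "0 < s" "s < h"
    "?g h - ?g 0 = (h - 0) * (dd v f ((p + h *\<^sub>R w) + s *\<^sub>R v) - dd v f (p + s *\<^sub>R v))" by blast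
  have "((\<lambda>t. dd v f ((p + s *\<^sub>R v) + t *\<^sub>R w)) has_real_derivative dd w (dd v f) ((p + s *\<^sub>R v) + t *\<^sub>R w)) (at t)"
    if "0 \<le> t" "t \<le> h" for t
    using S[of s t] that s by (intro dd_has_derivative f) simp
  from MVT2[OF \<open>0 < h\<close> this] obtain t where t: "0 < t" "t < h"
    "dd v f (p + s *\<^sub>R v + h *\<^sub>R w) - dd v f (p + s *\<^sub>R v) = h * dd w (dd v f) (p + s *\<^sub>R v + t *\<^sub>R w)"
    by auto
  have "f (p + h *\<^sub>R v + h *\<^sub>R w) - f (p + h *\<^sub>R v) - f (p + h *\<^sub>R w) + f p = ?g h - ?g 0"
    by (simp add: algebra_simps)
  also have "\<dots> = h * (h * dd w (dd v f) (p + s *\<^sub>R v + t *\<^sub>R w))"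
    unfolding s(3) t(3)[symmetric] by (simp add: algebra_simps)
  finally show ?thesis using s t that by blast
qed

lemma dd_commute:
  assumes S: "open S" and f: "smooth_on S f" and vw: "v \<in> axes" "w \<in> axes" and p: "p \<in> S"
  shows "dd v (dd w f) p = dd w (dd v f) p"
proof (rule ccontr)
  let ?A = "dd w (dd v f)" and ?B = "dd v (dd w f)"
  assume "?B p \<noteq> ?A p"
  define \<delta> where "\<delta> = \<bar>?A p - ?B p\<bar> / 2"
  have \<delta>: "0 < \<delta>" using \<open>?B p \<noteq> ?A p\<close> by (simp add: \<delta>_def)
  have sm: "smooth_on S (dd v f)" "smooth_on S (dd w f)" using smooth_onD(2)[OF f] vw by auto
  have "continuous_on S ?A" "continuous_on S ?B"
    using smooth_onD(1)[OF smooth_onD(2)[OF sm(1) vw(2)] vw(1)] smooth_onD(1)[OF smooth_onD(2)[OF sm(2) vw(1)] vw(1)] .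
  then have "isCont ?A p" "isCont ?B p" using S p by (simp_all add: continuous_on_eq_continuous_at)
  then obtain r1 r2 where r1: "0 < r1" "\<And>q. dist q p < r1 \<Longrightarrow> dist (?A q) (?A p) < \<delta>"
    and r2: "0 < r2" "\<And>q. dist q p < r2 \<Longrightarrow> dist (?B q) (?B p) < \<delta>"
    unfolding continuous_at_eps_delta using \<delta> by metis
  obtain r3 where r3: "0 < r3" "ball p r3 \<subseteq> S" using S p open_contains_ball by blast
  define r where "r = min r1 (min r2 r3)"
  have r: "0 < r" using r1 r2 r3 by (simp add: r_def)
  \<comment> \<open>A square of side \<open>h\<close> then stays within distance
    \<open>2 * h < r\<close> of its corner \<open>p\<close>.\<close>
  define h where "h = r / 3"
  have h: "0 < h" using r by (simp add: h_def)
  have n: "norm v = 1" "norm w = 1" using vw by (auto simp: axes_def norm_Pair)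
  have near: "dist (p + s *\<^sub>R v' + t *\<^sub>R w') p < r"
    if "0 \<le> s" "s \<le> h" "0 \<le> t" "t \<le> h" "norm v' = 1" "norm w' = 1" for s t v' w'
  proof -
    have "dist (p + s *\<^sub>R v' + t *\<^sub>R w') p = norm (s *\<^sub>R v' + t *\<^sub>R w')" by (simp add: dist_norm add.assoc)
    also have "\<dots> \<le> s + t" using norm_triangle_ineq[of "s *\<^sub>R v'" "t *\<^sub>R w'"] that by simp
    also have "\<dots> < r" using that r by (simp add: h_def)
    finally show ?thesis .
  qed
  have inS: "q \<in> S" if "dist q p < r" for q
    using that r3(2) by (auto simp: r_def dist_commute)
  obtain s t where A: "0 < s" "s < h" "0 < t" "t < h"
    "f (p + h *\<^sub>R v + h *\<^sub>R w) - f (p + h *\<^sub>R v) - f (p + h *\<^sub>R w) + f p = h * (h * ?A (p + s *\<^sub>R v + t *\<^sub>R w))"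
    by (rule second_difference[OF h, of p v w S f])
      (use near n inS smooth_onD(3)[OF f vw(1)] smooth_onD(3)[OF sm(1) vw(2)] in auto)
  obtain s' t' where B: "0 < s'" "s' < h" "0 < t'" "t' < h"
    "f (p + h *\<^sub>R w + h *\<^sub>R v) - f (p + h *\<^sub>R w) - f (p + h *\<^sub>R v) + f p = h * (h * ?B (p + s' *\<^sub>R w + t' *\<^sub>R v))"
    by (rule second_difference[OF h, of p w v S f])
      (use near n inS smooth_onD(3)[OF f vw(2)] smooth_onD(3)[OF sm(2) vw(1)] in auto)
  have "f (p + h *\<^sub>R w + h *\<^sub>R v) = f (p + h *\<^sub>R v + h *\<^sub>R w)" by (simp add: algebra_simps)
  then have "h * (h * ?A (p + s *\<^sub>R v + t *\<^sub>R w)) = h * (h * ?B (p + s' *\<^sub>R w + t' *\<^sub>R v))"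
    using A(5) B(5) by linarith
  then have "?A (p + s *\<^sub>R v + t *\<^sub>R w) = ?B (p + s' *\<^sub>R w + t' *\<^sub>R v)" using h by simp
  moreover have "dist (?A (p + s *\<^sub>R v + t *\<^sub>R w)) (?A p) < \<delta>"
    using near[of s t v w] A n by (intro r1(2)) (simp add: r_def)
  moreover have "dist (?B (p + s' *\<^sub>R w + t' *\<^sub>R v)) (?B p) < \<delta>"
    using near[of s' t' w v] B n by (intro r2(2)) (simp add: r_def)
  moreover have "2 * \<delta> = dist (?A p) (?B p)" by (simp add: \<delta>_def dist_real_def)
  ultimately show False
    using dist_triangle3[of "?A p" "?B p" "?A (p + s *\<^sub>R v + t *\<^sub>R w)"] by simp
qed

lemma smooth_on_funpow: "smooth_on S f \<Longrightarrow> v \<in> axes \<Longrightarrow> smooth_on S ((dd v ^^ k) f)"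
  by (induction k) (auto intro: smooth_onD(2))

lemma dd_funpow_cong:
  assumes "open S" "p \<in> S" "\<And>q. q \<in> S \<Longrightarrow> f q = g q" shows "(dd v ^^ k) f p = (dd v ^^ k) g p"
  using assms(2)
proof (induction k arbitrary: p)
  case (Suc k)
  show ?case using dd_cong(1)[OF assms(1) Suc.prems Suc.IH] by simp
qed (simp add: assms(3))

lemma dd_funpow_commute:
  assumes S: "open S" and f: "smooth_on S f" and vw: "v \<in> axes" "w \<in> axes" and p: "p \<in> S"
  shows "dd v ((dd w ^^ k) f) p = (dd w ^^ k) (dd v f) p"
  using p
proof (induction k arbitrary: p)
  case (Suc k)
  have "dd v ((dd w ^^ Suc k) f) p = dd w (dd v ((dd w ^^ k) f)) p"
    using dd_commute[OF S smooth_on_funpow[OF f vw(2)] vw Suc.prems, of k] by simp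
  also have "\<dots> = dd w ((dd w ^^ k) (dd v f)) p" by (rule dd_cong(1)[OF S Suc.prems Suc.IH])
  finally show ?case by simp
qed simp

lemma dd_funpow_add:
  assumes S: "open S" and fg: "smooth_on S f" "smooth_on S g" and v: "v \<in> axes" and p: "p \<in> S"
  shows "(dd v ^^ k) (\<lambda>q. f q + g q) p = (dd v ^^ k) f p + (dd v ^^ k) g p"
    "(dd v ^^ k) (\<lambda>q. f q - g q) p = (dd v ^^ k) f p - (dd v ^^ k) g p"
  using p
proof (induction k arbitrary: p)
  case (Suc k)
  have d: "diffdir v ((dd v ^^ k) f) q" "diffdir v ((dd v ^^ k) g) q" if "q \<in> S" for q
    using smooth_onD(3)[OF smooth_on_funpow[OF fg(1) v] v that] smooth_onD(3)[OF smooth_on_funpow[OF fg(2) v] v that] .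
  { case 1
    then show ?case using dd_cong(1)[OF S 1 Suc.IH(1)] dd_add[OF d] by simp
  next
    case 2
    then show ?case using dd_cong(1)[OF S 2 Suc.IH(2)] dd_diff[OF d] by simp }
qed simp_all

section \<open>Taylor expansion at the origin as a homomorphism compatible with derivatives\<close>

definition taylor :: "(pt \<Rightarrow> real) \<Rightarrow> ser" where
  "taylor f = mk_ser (taylor_cf f 0)"

lemma cf_taylor: "cf (taylor f) i j m =
   (dd (1, 0, 0) ^^ i) ((dd (0, 1, 0) ^^ j) ((dd (0, 0, 1) ^^ m) f)) 0 / (fact i * fact j * fact m)"
  by (simp add: taylor_def taylor_cf_def partials_dd[abs_def])

lemma axes_mem: "(1, 0, 0) \<in> axes" "(0, 1, 0) \<in> axes" "(0, 0, 1) \<in> axes"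
  by (simp_all add: axes_def)

lemma taylor_cong:
  assumes S: "open S" "0 \<in> S" and eq: "\<And>q. q \<in> S \<Longrightarrow> f q = g q" shows "taylor f = taylor g"
  by (rule ser_eqI) (simp add: cf_taylor dd_funpow_cong[OF S dd_funpow_cong[OF S(1) _ dd_funpow_cong[OF S(1) _ eq]]])

lemma taylor_add:
  assumes S: "open S" "0 \<in> S" and f: "smooth_on S f" "smooth_on S g"
  shows "taylor (\<lambda>q. f q + g q) = taylor f + taylor g" "taylor (\<lambda>q. f q - g q) = taylor f - taylor g"
proof -
  note e = dd_funpow_add[OF S(1) f axes_mem(3)]
  note sf = smooth_on_funpow[OF f(1) axes_mem(3)] smooth_on_funpow[OF f(2) axes_mem(3)]
  note y = dd_funpow_add[OF S(1) sf(1) sf(2) axes_mem(2)]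
  note sy = smooth_on_funpow[OF sf(1) axes_mem(2)] smooth_on_funpow[OF sf(2) axes_mem(2)]
  note x = dd_funpow_add[OF S(1) sy(1) sy(2) axes_mem(1) S(2)]
  show "taylor (\<lambda>q. f q + g q) = taylor f + taylor g" "taylor (\<lambda>q. f q - g q) = taylor f - taylor g"
    by (rule ser_eqI; simp add: cf_taylor
        dd_funpow_cong[OF S dd_funpow_cong[OF S(1) _ e(1)]] dd_funpow_cong[OF S dd_funpow_cong[OF S(1) _ e(2)]]
        dd_funpow_cong[OF S y(1)] dd_funpow_cong[OF S y(2)] x add_divide_distrib diff_divide_distrib)+
qed

definition ser_de :: "ser \<Rightarrow> ser" where "ser_de g = fps_deriv g"

lemma cf_de: "cf (ser_de g) i j m = real (m + 1) * cf g i j (m + 1)"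
  by (simp add: ser_de_def cf_def fps_of_nat[symmetric] fps_const_mult[symmetric] del: of_nat_Suc fps_const_mult)

lemma ser_de_mult: "ser_de (f * g) = ser_de f * g + f * ser_de g"
  by (simp add: ser_de_def algebra_simps)

text \<open>\<open>taylor_cf\<close> differentiates in a fixed order, \<epsilon> first and
  \<open>x\<close> last, so a new derivative must be commuted past the others to reach its
  place.\<close>

lemma taylor_dd:
  assumes S: "open S" "0 \<in> S" and f: "smooth_on S f"
  shows "taylor (dd (1, 0, 0) f) = ser_dx (taylor f)" "taylor (dd (0, 1, 0) f) = ser_dy (taylor f)"
    "taylor (dd (0, 0, 1) f) = ser_de (taylor f)"
proof -
  let ?x = "dd (1, 0, 0)" and ?y = "dd (0, 1, 0)" and ?e = "dd (0, 0, 1)"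
  have sf: "smooth_on S ((?e ^^ m) f)" for m by (rule smooth_on_funpow[OF f axes_mem(3)])
  have x: "(?x ^^ i) (?x ((?y ^^ j) ((?e ^^ m) f))) 0 = (?x ^^ i) ((?y ^^ j) ((?e ^^ m) (?x f))) 0" for i j m
  proof (rule dd_funpow_cong[OF S])
    fix q assume q: "q \<in> S"
    have "?x ((?y ^^ j) ((?e ^^ m) f)) q = (?y ^^ j) (?x ((?e ^^ m) f)) q"
      by (rule dd_funpow_commute[OF S(1) sf axes_mem(1,2) q])
    also have "\<dots> = (?y ^^ j) ((?e ^^ m) (?x f)) q"
      by (rule dd_funpow_cong[OF S(1) q dd_funpow_commute[OF S(1) f axes_mem(1,3)]])
    finally show "?x ((?y ^^ j) ((?e ^^ m) f)) q = (?y ^^ j) ((?e ^^ m) (?x f)) q" .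
  qed
  have y: "(?x ^^ i) ((?y ^^ j) (?y ((?e ^^ m) f))) 0 = (?x ^^ i) ((?y ^^ j) ((?e ^^ m) (?y f))) 0" for i j m
    by (rule dd_funpow_cong[OF S dd_funpow_cong[OF S(1) _ dd_funpow_commute[OF S(1) f axes_mem(2,3)]]])
  show "taylor (?x f) = ser_dx (taylor f)"
    by (rule ser_eqI) (simp add: cf_taylor x[symmetric] funpow_swap1 del: of_nat_Suc)
  show "taylor (?y f) = ser_dy (taylor f)"
    by (rule ser_eqI) (simp add: cf_taylor y[symmetric] funpow_swap1 del: of_nat_Suc)
  show "taylor (?e f) = ser_de (taylor f)"
    by (rule ser_eqI) (simp add: cf_taylor cf_de funpow_swap1 del: of_nat_Suc)
qed

text \<open>Induction on the total degree, with \<open>f\<close> and \<open>g\<close> arbitrary: a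
  coefficient of positive degree is, up to a nonzero factor, a coefficient of one degree less of a
  partial derivative, and both sides obey the product rule.\<close>

lemma taylor_mult:
  assumes S: "open S" "0 \<in> S" and f: "smooth_on S f" "smooth_on S g"
  shows "taylor (\<lambda>q. f q * g q) = taylor f * taylor g"
proof -
  have "cf (taylor (\<lambda>q. f q * g q)) i j m = cf (taylor f * taylor g) i j m"
    if "n = i + j + m" "smooth_on S f" "smooth_on S g" for n i j m f g
    using that
  proof (induction n arbitrary: i j m f g)
    case 0
    then show ?case by (simp add: cf_mult cf_taylor)
  next
    case (Suc n)
    note f = Suc.prems(2) and g = Suc.prems(3)
    have step: "cf (taylor (dd v (\<lambda>q. f q * g q))) a b c = cf (taylor (dd v f) * taylor g + taylor f * taylor (dd v g)) a b c"
      if v: "v \<in> axes" and abc: "n = a + b + c" for v a b c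
    proof -
      note s = smooth_onD(2)[OF f v] smooth_onD(2)[OF g v]
      have "taylor (dd v (\<lambda>q. f q * g q)) = taylor (\<lambda>q. dd v f q * g q + f q * dd v g q)"
        by (rule taylor_cong[OF S]) (intro dd_mult smooth_onD(3)[OF f v] smooth_onD(3)[OF g v])
      also have "\<dots> = taylor (\<lambda>q. dd v f q * g q) + taylor (\<lambda>q. f q * dd v g q)"
        by (intro taylor_add[OF S] smooth_on_mult[OF S(1)] s f g)
      finally show ?thesis using Suc.IH[OF abc s(1) g] Suc.IH[OF abc f s(2)] by simp
    qed
    note fg = smooth_on_mult[OF S(1) f g]
    consider i' where "i = Suc i'" | j' where "j = Suc j'" | m' where "m = Suc m'"
      using Suc.prems(1) by (cases i; cases j; cases m) auto
    then show ?case
    proof cases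
      case 1
      then have "cf (ser_dx (taylor (\<lambda>q. f q * g q))) i' j m = cf (ser_dx (taylor f * taylor g)) i' j m"
        using step[OF axes_mem(1), of i' j m] Suc.prems(1)
        unfolding taylor_dd(1)[OF S fg] taylor_dd(1)[OF S f] taylor_dd(1)[OF S g] ser_dx_mult by simp
      then show ?thesis by (simp add: 1 del: of_nat_Suc)
    next
      case 2
      then have "cf (ser_dy (taylor (\<lambda>q. f q * g q))) i j' m = cf (ser_dy (taylor f * taylor g)) i j' m"
        using step[OF axes_mem(2), of i j' m] Suc.prems(1)
        unfolding taylor_dd(2)[OF S fg] taylor_dd(2)[OF S f] taylor_dd(2)[OF S g] ser_dy_mult by simp
      then show ?thesis by (simp add: 2 del: of_nat_Suc)
    next
      case 3
      then have "cf (ser_de (taylor (\<lambda>q. f q * g q))) i j m' = cf (ser_de (taylor f * taylor g)) i j m'"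
        using step[OF axes_mem(3), of i j m'] Suc.prems(1)
        unfolding taylor_dd(3)[OF S fg] taylor_dd(3)[OF S f] taylor_dd(3)[OF S g] ser_de_mult by simp
      then show ?thesis by (simp add: 3 cf_de del: of_nat_Suc)
    qed
  qed
  then show ?thesis using f by (intro ser_eqI) blast
qed

lemma taylor_const: "taylor (\<lambda>_. s) = const_ser s"
proof (rule ser_eqI)
  fix i j m
  have dd0: "dd v (\<lambda>_. c) = (\<lambda>_. 0)" for v c by (simp add: dd_def fun_eq_iff)
  have "(dd v ^^ k) (\<lambda>_. c) = (\<lambda>_. if k = 0 then c else 0)" for v k c
    by (induction k) (auto simp: dd0)
  then show "cf (taylor (\<lambda>_. s)) i j m = cf (const_ser s) i j m"
    by (simp add: cf_taylor) (simp add: const_ser_def cf_def)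
qed

text \<open>The Jacobian is continuous with values 1 and -1, hence constant near the origin, and so
  is its Taylor series. This yields one sign for the formal Jacobian.\<close>

lemma taylor_map_area_preserving:
  assumes "smooth_family f" shows "area_preserving (taylor_map f)"
proof -
  obtain S where S: "open S" "0 \<in> S" and f: "smooth_on S (fst \<circ> f)" "smooth_on S (snd \<circ> f)"
    and ap: "area_preserving_on S f" using assms by (auto simp: smooth_family_def)
  let ?x = "dd (1, 0, 0)" and ?y = "dd (0, 1, 0)"
  let ?P = "\<lambda>q. ?x (fst \<circ> f) q * ?y (snd \<circ> f) q" and ?Q = "\<lambda>q. ?y (fst \<circ> f) q * ?x (snd \<circ> f) q"
  define J where "J = (\<lambda>q. ?P q - ?Q q)"
  note sx = smooth_onD(2)[OF f(1) axes_mem(1)] smooth_onD(2)[OF f(2) axes_mem(1)]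
    and sy = smooth_onD(2)[OF f(1) axes_mem(2)] smooth_onD(2)[OF f(2) axes_mem(2)]
  note P = smooth_on_mult[OF S(1) sx(1) sy(2)] and Q = smooth_on_mult[OF S(1) sy(1) sx(2)]
  have J1: "\<bar>J q\<bar> = 1" if "q \<in> S" for q
    using ap that by (simp add: area_preserving_on_def J_def partials_dd)
  have "continuous_on S J"
    unfolding J_def by (rule smooth_onD(1)[OF smooth_on_diff[OF S(1) P Q] axes_mem(1)])
  then have "isCont J 0" using S by (simp add: continuous_on_eq_continuous_at)
  then have "\<exists>r>0. \<forall>q. dist q 0 < r \<longrightarrow> dist (J q) (J 0) < 1"
    unfolding continuous_at_eps_delta by (elim allE[where x = 1]) simp
  then obtain r where r: "0 < r" "\<And>q. dist q 0 < r \<Longrightarrow> dist (J q) (J 0) < 1" by blast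
  have "taylor J = taylor (\<lambda>_. J 0)"
  proof (rule taylor_cong)
    show "open (S \<inter> ball 0 r)" "0 \<in> S \<inter> ball 0 r" using S r by auto
    fix q assume "q \<in> S \<inter> ball 0 r"
    then have "\<bar>J q\<bar> = 1" "\<bar>J 0\<bar> = 1" "\<bar>J q - J 0\<bar> < 1"
      using J1 S r(2)[of q] by (auto simp: dist_real_def dist_commute)
    then show "J q = J 0" by linarith
  qed
  then have "taylor J = const_ser (J 0)" by (simp add: taylor_const)
  moreover have "taylor J = jac_det (taylor_map f)"
    unfolding J_def taylor_add(2)[OF S P Q] taylor_mult[OF S sx(1) sy(2)] taylor_mult[OF S sy(1) sx(2)]
    unfolding taylor_dd[OF S f(1)] taylor_dd[OF S f(2)]
    by (simp add: jac_det_def taylor_map_def taylor_def)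
  moreover have "J 0 = 1 \<or> J 0 = -1" using J1[OF S(2)] by linarith
  ultimately show ?thesis by (auto simp: area_preserving_def const_ser_uminus)
qed

theorem theorem3:
  fixes F :: fmap
  assumes family: "(\<exists>f. analytic_family f \<and> F = taylor_map f) \<or>
      (\<exists>f. smooth_family f \<and> F = taylor_map f) \<or>
      area_preserving F"
    and origin: "fixes_origin F"
    and double_eigenvalue: "Polynomial.order (-1) (char_poly (lin_part F)) = 2"
    and not_diagonalisable: "\<not> diagonalisable (lin_part F)"
  shows "(\<exists>\<phi> u. canonical_change \<phi> \<and> conjugates \<phi> F (fmap_uminus (time_one (ham u)))) \<and>
    (\<forall>\<phi> \<phi>' u u'.
       canonical_change \<phi> \<and> conjugates \<phi> F (fmap_uminus (time_one (ham u))) \<and>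
       canonical_change \<phi>' \<and> conjugates \<phi>' F (fmap_uminus (time_one (ham u'))) \<longrightarrow>
       (\<forall>k m. k \<ge> 1 \<and> k + 2 * m \<ge> 2 \<longrightarrow> u k m = u' k m)) \<and>
    (\<forall>u u'. (\<forall>k m. k \<ge> 1 \<and> k + 2 * m \<ge> 2 \<longrightarrow> u k m = u' k m) \<longrightarrow>
       time_one (ham u) = time_one (ham u'))"
proof (intro conjI allI impI)
  have "analytic_family f \<Longrightarrow> smooth_family f" for f
    unfolding analytic_family_def smooth_family_def analytic_fun_on_def by blast
  then have "area_preserving F" using family taylor_map_area_preserving by blast
  from normal_form_of_family[OF this origin double_eigenvalue not_diagonalisable]
  show "\<exists>\<phi> u. canonical_change \<phi> \<and> conjugates \<phi> F (fmap_uminus (time_one (ham u)))" by blast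
next
  fix \<phi> \<phi>' u u' and k m :: nat
  assume "canonical_change \<phi> \<and> conjugates \<phi> F (fmap_uminus (time_one (ham u))) \<and>
       canonical_change \<phi>' \<and> conjugates \<phi>' F (fmap_uminus (time_one (ham u')))" "k \<ge> 1 \<and> k + 2 * m \<ge> 2"
  then show "u k m = u' k m" using formal_uniqueness[OF origin] by blast
next
  fix u u' :: "nat \<Rightarrow> nat \<Rightarrow> real"
  assume "\<forall>k m. k \<ge> 1 \<and> k + 2 * m \<ge> 2 \<longrightarrow> u k m = u' k m"
  then show "time_one (ham u) = time_one (ham u')" by (intro time_one_ham_cong) auto
qed

end
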